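(* For every integer $d\geq 2$ and every nonzero quadratic form $Q\in\mathbb{Q}[X_1,\dots,X_d]$, as $n\to\infty$, \[ n-o(n)\;\leq\; f_Q([n]^d,\mathbb{R}^d)\;\leq\; d\cdot n. \]
   Context: A quadratic form is a homogeneous polynomial of degree $2$. For a quadratic form $Q\in\mathbb{R}[X_1,\dots,X_d]$, a $Q$-quadric in $\mathbb{R}^d$ is a set of the form $\{x\in\mathbb{R}^d: Q(x)+f(x)=0\}$, where $f\in\mathbb{R}[X_1,\dots,X_d]$ has degree at most $1$. Let $[n]=\{1,\dots,n\}$ and regard $[n]^d\subset\mathbb{R}^d$. $f_Q([n]^d,\mathbb{R}^d)$ is the maximum size of a subset $D\subseteq[n]^d$ such that (i) no $d+1$ points of $D$ lie on a common affine hyperplane of $\mathbb{R}^d$, and (ii) no $d+2$ points of $D$ lie on a common $Q$-quadric in $\mathbb{R}^d$. *)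

theory Defs
  imports "HOL-Analysis.Analysis" "HOL-Library.Poly_Mapping" "HOL-Library.Landau_Symbols"
begin

text \<open>
  A polynomial in the variables \<open>X\<^sub>i\<close> (\<open>i :: 'd\<close>) is a finitely supported map from exponent
  vectors to coefficients. The dimension is \<open>d = CARD('d)\<close>.
\<close>

type_synonym ('d, 'a) mpoly = "('d \<Rightarrow>\<^sub>0 nat) \<Rightarrow>\<^sub>0 'a"

definition monom_degree :: "('d::finite \<Rightarrow>\<^sub>0 nat) \<Rightarrow> nat" where
  "monom_degree m = (\<Sum>i\<in>UNIV. Poly_Mapping.lookup m i)"

definition eval_mpoly :: "('d::finite, real) mpoly \<Rightarrow> real ^ 'd \<Rightarrow> real" where
  "eval_mpoly p x = (\<Sum>m\<in>Poly_Mapping.keys p. Poly_Mapping.lookup p m * (\<Prod>i\<in>UNIV. (x $ i) ^ Poly_Mapping.lookup m i))"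

text \<open>The zero polynomial gets total degree 0, and it is homogeneous of every degree.\<close>

definition total_degree :: "('d::finite, 'a::zero) mpoly \<Rightarrow> nat" where
  "total_degree p = Max (insert 0 (monom_degree ` Poly_Mapping.keys p))"

definition homogeneous :: "nat \<Rightarrow> ('d::finite, 'a::zero) mpoly \<Rightarrow> bool" where
  "homogeneous k p \<longleftrightarrow> (\<forall>m\<in>Poly_Mapping.keys p. monom_degree m = k)"

definition quadratic_form :: "('d::finite, 'a::zero) mpoly \<Rightarrow> bool" where
  "quadratic_form Q \<longleftrightarrow> homogeneous 2 Q"

definition is_quadric :: "('d::finite, real) mpoly \<Rightarrow> (real ^ 'd) set \<Rightarrow> bool" where
  "is_quadric Q S \<longleftrightarrow>
     (\<exists>f :: ('d, real) mpoly. total_degree f \<le> 1 \<and> S = {x. eval_mpoly Q x + eval_mpoly f x = 0})"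

definition is_hyperplane :: "(real ^ 'd::finite) set \<Rightarrow> bool" where
  "is_hyperplane H \<longleftrightarrow> (\<exists>a b. a \<noteq> 0 \<and> H = {x. a \<bullet> x = b})"

definition grid :: "nat \<Rightarrow> (real ^ 'd::finite) set" where
  "grid n = {x. \<forall>i. x $ i \<in> real ` {1..n}}"

definition general_position :: "('d::finite, real) mpoly \<Rightarrow> (real ^ 'd) set \<Rightarrow> bool" where
  "general_position Q D \<longleftrightarrow>
     (\<forall>S\<subseteq>D. card S = CARD('d) + 1 \<longrightarrow> \<not> (\<exists>H. is_hyperplane H \<and> S \<subseteq> H)) \<and>
     (\<forall>S\<subseteq>D. card S = CARD('d) + 2 \<longrightarrow> \<not> (\<exists>C. is_quadric Q C \<and> S \<subseteq> C))"

text \<open>Only meaningful for finite \<open>A\<close>.\<close>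

definition max_general_position :: "('d::finite, real) mpoly \<Rightarrow> (real ^ 'd) set \<Rightarrow> nat" where
  "max_general_position Q A = Max {card D | D. D \<subseteq> A \<and> general_position Q D}"

end

theory Submission
  imports Defs "HOL-Complex_Analysis.Complex_Analysis" "HOL-Number_Theory.Number_Theory"
begin

text \<open>
  Upper bound: \<open>[n]\<^sup>d\<close> is covered by the \<open>n\<close> hyperplanes \<open>x\<^sub>i = k\<close>, each containing at most \<open>d\<close> points.

  Lower bound: let \<open>p\<close> be a prime, \<open>v\<^sub>1, \<dots>, v\<^sub>d\<close> a basis of \<open>F\<^sub>p\<^sup>d\<close> all of whose members but one are
  isotropic for \<open>Q\<close>, and \<open>\<alpha>\<^sub>1, \<dots>, \<alpha>\<^sub>d\<close> distinct elements of \<open>F\<^sub>p\<close>. On the curve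
  \<open>t \<mapsto> \<Sum>\<^sub>k v\<^sub>k / (t - \<alpha>\<^sub>k)\<close> an affine form has at most \<open>d\<close> zeros. Since \<open>Q\<close> restricted to the curve
  has a double pole only at the anisotropic \<open>\<alpha>\<^sub>k\<close>, a \<open>Q\<close>-quadric meets it in at most \<open>d + 1\<close> points.
  Lifting the \<open>p - d\<close> points of the curve to \<open>[p]\<^sup>d\<close> keeps both properties, because a real relation
  between integer points yields an integer relation that is nontrivial modulo \<open>p\<close>.

  Such a basis exists as soon as finitely many integers depending on \<open>Q\<close> are squares modulo \<open>p\<close>: if
  \<open>Q(u) \<noteq> 0\<close>, the line through \<open>u\<close> and a unit vector \<open>e\<^sub>k\<close> contains an isotropic point iff a
  discriminant is a square. It remains to find such primes in \<open>[(1 - \<epsilon>)n, n]\<close> for all large \<open>n\<close>. By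
  quadratic reciprocity the condition on \<open>p\<close> is that finitely many real characters take the value \<open>1\<close>
  at \<open>p\<close>. The \<open>L\<close>-series of a real character does not vanish on the line \<open>Re s = 1\<close> (Mertens and
  Landau), and averaging against a Fejer kernel, as in the proof of the Wiener-Ikehara theorem,
  produces the primes.
\<close>

section \<open>Dirichlet series\<close>

definition dirichlet_series :: "(nat \<Rightarrow> real) \<Rightarrow> complex \<Rightarrow> complex" where
  "dirichlet_series a s = suminf (\<lambda>n. of_real (a n) * of_nat n powr (-s))"

definition dirichlet_abs_conv :: "(nat \<Rightarrow> real) \<Rightarrow> bool" where
  "dirichlet_abs_conv a \<longleftrightarrow> (\<forall>\<sigma>>1. summable (\<lambda>n. \<bar>a n\<bar> * real n powr (-\<sigma>)))"

lemma dirichlet_abs_convD: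
  "dirichlet_abs_conv a \<Longrightarrow> \<sigma> > 1 \<Longrightarrow> summable (\<lambda>n. \<bar>a n\<bar> * real n powr (-\<sigma>))"
  by (simp add: dirichlet_abs_conv_def)

lemma dirichlet_abs_conv_if_le:
  assumes "dirichlet_abs_conv b" "\<And>n. n > 0 \<Longrightarrow> \<bar>a n\<bar> \<le> \<bar>b n\<bar>"
  shows "dirichlet_abs_conv a"
  unfolding dirichlet_abs_conv_def
proof (intro allI impI)
  fix \<sigma> :: real assume "\<sigma> > 1"
  show "summable (\<lambda>n. \<bar>a n\<bar> * real n powr (-\<sigma>))"
  proof (rule summable_comparison_test'[OF dirichlet_abs_convD[OF assms(1) \<open>\<sigma> > 1\<close>]])
    show "norm (\<bar>a n\<bar> * real n powr (-\<sigma>)) \<le> \<bar>b n\<bar> * real n powr (-\<sigma>)" for n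
      using assms(2)[of n] by (cases "n = 0") (auto intro: mult_right_mono)
  qed
qed

lemma dirichlet_abs_conv_const: "dirichlet_abs_conv (\<lambda>_. c)"
  by (simp add: dirichlet_abs_conv_def summable_real_powr_iff)

lemma dirichlet_abs_conv_mult_ln:
  assumes "dirichlet_abs_conv a"
  shows "dirichlet_abs_conv (\<lambda>n. a n * ln (real n))"
  unfolding dirichlet_abs_conv_def
proof (intro allI impI)
  fix \<sigma> :: real assume "\<sigma> > 1"
  define e where "e = (\<sigma> - 1) / 2"
  have e: "e > 0" "1 + e > 1" using \<open>\<sigma> > 1\<close> by (simp_all add: e_def)
  show "summable (\<lambda>n. \<bar>a n * ln (real n)\<bar> * real n powr (-\<sigma>))"
  proof (rule summable_comparison_test'[where N = 1])
    show "summable (\<lambda>n. \<bar>a n\<bar> * real n powr (-(1 + e)) * (1 / e))"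
      by (intro summable_mult2 dirichlet_abs_convD[OF assms e(2)])
    fix n :: nat assume "n \<ge> 1"
    then have "ln (real n) \<le> real n powr e / e" using e by (intro ln_powr_bound) auto
    then have "ln (real n) * real n powr (-\<sigma>) \<le> real n powr e / e * real n powr (-\<sigma>)"
      by (rule mult_right_mono) simp
    also have "\<dots> = real n powr (e + -\<sigma>) * (1 / e)"
      using \<open>n \<ge> 1\<close> by (subst powr_add) simp
    also have "e + -\<sigma> = -(1 + e)" by (simp add: e_def field_simps)
    finally have "\<bar>a n\<bar> * (ln (real n) * real n powr (-\<sigma>))
        \<le> \<bar>a n\<bar> * (real n powr (-(1 + e)) * (1 / e))"
      by (rule mult_left_mono) simp
    then show "norm (\<bar>a n * ln (real n)\<bar> * real n powr (-\<sigma>))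
        \<le> \<bar>a n\<bar> * real n powr (-(1 + e)) * (1 / e)"
      using \<open>n \<ge> 1\<close> by (simp add: abs_mult mult.assoc)
  qed
qed

lemma dirichlet_abs_conv_diff:
  assumes "dirichlet_abs_conv a" "dirichlet_abs_conv b"
  shows "dirichlet_abs_conv (\<lambda>n. a n - b n)"
  unfolding dirichlet_abs_conv_def
proof (intro allI impI)
  fix \<sigma> :: real assume "\<sigma> > 1"
  show "summable (\<lambda>n. \<bar>a n - b n\<bar> * real n powr (-\<sigma>))"
  proof (rule summable_comparison_test'[where N = 0])
    show "summable (\<lambda>n. \<bar>a n\<bar> * real n powr (-\<sigma>) + \<bar>b n\<bar> * real n powr (-\<sigma>))"
      by (intro summable_add dirichlet_abs_convD assms \<open>\<sigma> > 1\<close>)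
    show "norm (\<bar>a n - b n\<bar> * real n powr (-\<sigma>))
        \<le> \<bar>a n\<bar> * real n powr (-\<sigma>) + \<bar>b n\<bar> * real n powr (-\<sigma>)" for n
      unfolding distrib_right[symmetric] by (simp add: mult_right_mono)
  qed
qed

lemma norm_dirichlet_term: "norm (of_real c * of_nat n powr s :: complex) = \<bar>c\<bar> * real n powr Re s"
  by (simp add: norm_mult norm_powr_real_powr)

lemma summable_norm_dirichlet_terms:
  assumes "dirichlet_abs_conv a" "Re s > 1"
  shows "summable (\<lambda>n. norm (of_real (a n) * of_nat n powr (-s) :: complex))"
  using dirichlet_abs_convD[OF assms] by (simp add: norm_dirichlet_term)

lemma dirichlet_series_sums:
  assumes "dirichlet_abs_conv a" "Re s > 1"
  shows "(\<lambda>n. of_real (a n) * of_nat n powr (-s)) sums dirichlet_series a s"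
  unfolding dirichlet_series_def
  by (rule summable_sums[OF summable_norm_cancel[OF summable_norm_dirichlet_terms[OF assms]]])

lemma dirichlet_series_cmult:
  assumes "dirichlet_abs_conv a" "Re s > 1"
  shows "dirichlet_series (\<lambda>n. c * a n) s = of_real c * dirichlet_series a s"
  using sums_mult[OF dirichlet_series_sums[OF assms], of "of_real c"]
  by (simp add: dirichlet_series_def sums_iff mult.assoc)

lemma dirichlet_series_diff:
  assumes "dirichlet_abs_conv a" "dirichlet_abs_conv b" "Re s > 1"
  shows "dirichlet_series (\<lambda>n. a n - b n) s = dirichlet_series a s - dirichlet_series b s"
  using sums_diff[OF dirichlet_series_sums[OF assms(1,3)] dirichlet_series_sums[OF assms(2,3)]]
  by (simp add: dirichlet_series_def sums_iff left_diff_distrib)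

lemma dirichlet_series_sum:
  assumes "\<And>i. i \<in> I \<Longrightarrow> dirichlet_abs_conv (a i)" "Re s > 1"
  shows "dirichlet_series (\<lambda>n. \<Sum>i\<in>I. a i n) s = (\<Sum>i\<in>I. dirichlet_series (a i) s)"
proof -
  have "(\<lambda>n. \<Sum>i\<in>I. of_real (a i n) * of_nat n powr (-s)) sums (\<Sum>i\<in>I. dirichlet_series (a i) s)"
    by (intro sums_sum dirichlet_series_sums assms)
  then show ?thesis by (simp add: dirichlet_series_def sums_iff sum_distrib_right)
qed

lemma continuous_on_dirichlet_series:
  assumes "summable (\<lambda>n. \<bar>a n\<bar> * real n powr (-\<sigma>))"
  shows "continuous_on {s. Re s \<ge> \<sigma>} (dirichlet_series a)"
proof -
  have "uniform_limit {s. Re s \<ge> \<sigma>} (\<lambda>N s. \<Sum>n<N. of_real (a n) * of_nat n powr (-s) :: complex)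
      (dirichlet_series a) sequentially"
    unfolding dirichlet_series_def
  proof (rule Weierstrass_m_test[OF _ assms])
    fix n :: nat and s :: complex assume "s \<in> {s. Re s \<ge> \<sigma>}"
    then show "norm (of_real (a n) * of_nat n powr (-s) :: complex) \<le> \<bar>a n\<bar> * real n powr (-\<sigma>)"
      unfolding norm_dirichlet_term by (cases "n = 0") (auto intro!: mult_left_mono powr_mono)
  qed
  then show ?thesis
    by (rule uniform_limit_theorem[rotated])
       (auto intro!: always_eventually holomorphic_on_imp_continuous_on holomorphic_intros)
qed

lemma Re_of_nat_powr_cis:
  "Re (of_nat n powr (- Complex \<sigma> t) * cis (t * x))
      = real n powr (-\<sigma>) * cos (t * (ln (real n) - x))"
proof (cases "n = 0")
  case False
  then have "of_nat n powr (- Complex \<sigma> t) = exp (- Complex \<sigma> t * of_real (ln (real n)))"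
    by (simp add: powr_def Ln_of_nat)
  also have "- Complex \<sigma> t * of_real (ln (real n))
      = of_real (- \<sigma> * ln (real n)) + \<i> * of_real (- t * ln (real n))"
    by (simp add: complex_eq_iff)
  also have "exp \<dots> = of_real (real n powr (-\<sigma>)) * cis (- t * ln (real n))"
    using False by (subst exp_add) (simp add: cis_conv_exp powr_def flip: exp_of_real)
  finally have "of_nat n powr (- Complex \<sigma> t) * cis (t * x)
      = of_real (real n powr (-\<sigma>)) * cis (- (t * (ln (real n) - x)))"
    by (simp add: cis_mult algebra_simps)
  then show ?thesis by simp
qed simp

lemma Re_dirichlet_series_cis_sums:
  assumes "dirichlet_abs_conv a" "\<sigma> > 1"
  shows "(\<lambda>n. a n * (real n powr (-\<sigma>) * cos (t * (ln (real n) - x))))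
     sums Re (dirichlet_series a (Complex \<sigma> t) * cis (t * x))"
proof -
  have "(\<lambda>n. Re (of_real (a n) * of_nat n powr (- Complex \<sigma> t) * cis (t * x)))
      sums Re (dirichlet_series a (Complex \<sigma> t) * cis (t * x))"
    using assms by (intro sums_Re sums_mult2 dirichlet_series_sums) auto
  moreover have "Re (of_real (a n) * of_nat n powr (- Complex \<sigma> t) * cis (t * x))
      = a n * (real n powr (-\<sigma>) * cos (t * (ln (real n) - x)))" for n
    unfolding Re_of_nat_powr_cis[symmetric] by (simp add: mult.assoc)
  ultimately show ?thesis by (simp only:)
qed

text \<open>The constant \<open>1\<close> has residue \<open>1\<close>, so \<open>c\<close> plays the role of the residue at \<open>s = 1\<close>.\<close>

definition boundary_residue :: "(nat \<Rightarrow> real) \<Rightarrow> real \<Rightarrow> bool" where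
  "boundary_residue a c \<longleftrightarrow> (\<exists>G. continuous_on {s. Re s \<ge> 1} G \<and>
     (\<forall>s. Re s > 1 \<longrightarrow> dirichlet_series a s - of_real c * dirichlet_series (\<lambda>_. 1) s = G s))"

lemma boundary_residue_sum:
  assumes "\<And>i. i \<in> I \<Longrightarrow> dirichlet_abs_conv (a i)" "\<And>i. i \<in> I \<Longrightarrow> boundary_residue (a i) (c i)"
  shows "boundary_residue (\<lambda>n. \<Sum>i\<in>I. a i n) (\<Sum>i\<in>I. c i)"
proof -
  obtain G where G: "\<And>i. i \<in> I \<Longrightarrow> continuous_on {s. Re s \<ge> 1} (G i)"
      "\<And>i s. i \<in> I \<Longrightarrow> Re s > 1 \<Longrightarrow> dirichlet_series (a i) s
          - of_real (c i) * dirichlet_series (\<lambda>_. 1) s = G i s"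
    using assms(2) unfolding boundary_residue_def by metis
  have "dirichlet_series (\<lambda>n. \<Sum>i\<in>I. a i n) s - of_real (\<Sum>i\<in>I. c i) * dirichlet_series (\<lambda>_. 1) s
      = (\<Sum>i\<in>I. G i s)"
    if "Re s > 1" for s
    using that assms(1)
    by (simp add: dirichlet_series_sum sum_distrib_right sum_subtractf flip: G(2))
  moreover have "continuous_on {s. Re s \<ge> 1} (\<lambda>s. \<Sum>i\<in>I. G i s)"
    by (intro continuous_intros G(1))
  ultimately show ?thesis unfolding boundary_residue_def by blast
qed

lemma boundary_residue_diff_summable:
  assumes "dirichlet_abs_conv a" "boundary_residue a c"
    and "dirichlet_abs_conv b" "summable (\<lambda>n. \<bar>b n\<bar> * real n powr (-1))"
  shows "boundary_residue (\<lambda>n. a n - b n) c"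
proof -
  obtain G where G: "continuous_on {s. Re s \<ge> 1} G"
      "\<And>s. Re s > 1 \<Longrightarrow> dirichlet_series a s - of_real c * dirichlet_series (\<lambda>_. 1) s = G s"
    using assms(2) unfolding boundary_residue_def by blast
  have "dirichlet_series (\<lambda>n. a n - b n) s - of_real c * dirichlet_series (\<lambda>_. 1) s
      = G s - dirichlet_series b s"
    if "Re s > 1" for s
    using that assms by (simp add: dirichlet_series_diff flip: G(2))
  moreover have "continuous_on {s. Re s \<ge> 1} (\<lambda>s. G s - dirichlet_series b s)"
    by (intro continuous_intros G(1) continuous_on_dirichlet_series assms(4))
  ultimately show ?thesis unfolding boundary_residue_def by blast
qed

section \<open>The Fejer kernel\<close>

definition fejer :: "real \<Rightarrow> real \<Rightarrow> real" where
  "fejer T u = (if u = 0 then T else 2 * (1 - cos (T * u)) / (T * u\<^sup>2))"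

lemma fejer_eq_sin:
  assumes "u \<noteq> 0"
  shows "fejer T u = 4 * (sin (T * u / 2))\<^sup>2 / (T * u\<^sup>2)"
  using assms cos_double_sin[of "T * u / 2"] by (simp add: fejer_def)

lemma has_integral_fejer_half:
  assumes "T > 0"
  shows "((\<lambda>t. (1 - t / T) * cos (t * u)) has_integral fejer T u / 2) {0..T}"
proof (cases "u = 0")
  case True
  have "((\<lambda>t. (1 - t / T) * cos (t * u))
      has_integral ((T - T\<^sup>2 / (2 * T)) - (0 - 0\<^sup>2 / (2 * T)))) {0..T}"
    using assms True
    by (intro fundamental_theorem_of_calculus)
       (auto intro!: derivative_eq_intros simp flip: has_real_derivative_iff_has_vector_derivative)
  then show ?thesis using assms True by (simp add: fejer_def power2_eq_square)
next
  case False
  let ?F = "\<lambda>t. (1 - t / T) * sin (t * u) / u - cos (t * u) / (T * u\<^sup>2)"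
  have "((\<lambda>t. (1 - t / T) * cos (t * u)) has_integral (?F T - ?F 0)) {0..T}"
    using assms False
    by (intro fundamental_theorem_of_calculus)
       (auto intro!: derivative_eq_intros simp: field_simps power2_eq_square
          simp flip: has_real_derivative_iff_has_vector_derivative)
  moreover have "?F T - ?F 0 = fejer T u / 2"
    using assms False by (simp add: fejer_def diff_divide_distrib)
  ultimately show ?thesis by (simp only:)
qed

lemma has_integral_fejer:
  assumes "T > 0"
  shows "((\<lambda>t. (1 - \<bar>t\<bar> / T) * cos (t * u)) has_integral fejer T u) {-T..T}"
proof -
  have "((\<lambda>t. (1 + t / T) * cos (t * u)) has_integral fejer T u / 2) {-T..0}"
    using has_integral_reflect_real[THEN iffD2, OF has_integral_fejer_half[OF assms, of u]]
    by (simp del: has_integral_reflect_real)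
  then have "((\<lambda>t. (1 - \<bar>t\<bar> / T) * cos (t * u)) has_integral fejer T u / 2) {-T..0}"
    by (rule has_integral_eq[rotated]) auto
  moreover have "((\<lambda>t. (1 - \<bar>t\<bar> / T) * cos (t * u)) has_integral fejer T u / 2) {0..T}"
    by (rule has_integral_eq[OF _ has_integral_fejer_half[OF assms]]) auto
  ultimately have "((\<lambda>t. (1 - \<bar>t\<bar> / T) * cos (t * u))
      has_integral (fejer T u / 2 + fejer T u / 2)) {-T..T}"
    using assms by (intro has_integral_combine[where c = 0]) auto
  then show ?thesis by simp
qed

lemma fejer_nonneg: "T > 0 \<Longrightarrow> fejer T u \<ge> 0"
  by (simp add: fejer_def)

lemma fejer_le_inverse_square:
  assumes "T > 0" "u \<noteq> 0"
  shows "fejer T u \<le> 4 / (T * u\<^sup>2)"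
proof -
  have "4 * (sin (T * u / 2))\<^sup>2 \<le> 4"
    using abs_square_le_1[THEN iffD2, OF abs_sin_le_one[of "T * u / 2"]] by linarith
  then show ?thesis
    unfolding fejer_eq_sin[OF assms(2)] by (rule divide_right_mono) (use assms in simp)
qed

lemma fejer_le:
  assumes "T > 0"
  shows "fejer T u \<le> T"
proof (cases "u = 0")
  case False
  have "(sin (T * u / 2))\<^sup>2 \<le> (T * u / 2)\<^sup>2"
    using abs_sin_x_le_abs_x by (metis abs_le_square_iff)
  then have "4 * (sin (T * u / 2))\<^sup>2 \<le> T * (T * u\<^sup>2)"
    by (simp add: power2_eq_square field_simps)
  then show ?thesis
    using assms False by (simp add: fejer_eq_sin pos_divide_le_eq)
qed (simp add: fejer_def)

lemma abs_sin_ge_half: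
  fixes y :: real
  assumes "\<bar>y\<bar> \<le> 1"
  shows "\<bar>sin y\<bar> \<ge> \<bar>y\<bar> / 2"
proof -
  have pos: "sin z \<ge> z / 2" if z: "0 < z" "z \<le> 1" for z :: real
  proof -
    obtain w where w: "0 < w" "w < z" "sin z - sin 0 = (z - 0) * cos w"
      using MVT2[of 0 z sin cos] z by (auto intro!: derivative_eq_intros)
    have "cos (pi / 3) \<le> cos w"
      using w z pi_gt3 by (intro cos_monotone_0_pi_le) auto
    then have "z * (1 / 2) \<le> z * cos w" using z by (intro mult_left_mono) (auto simp: cos_60)
    then show ?thesis using w by simp
  qed
  show ?thesis
    using pos[of y] pos[of "-y"] assms by (cases y "0::real" rule: linorder_cases) auto
qed

lemma fejer_ge:
  assumes "T > 0" "\<bar>T * u\<bar> \<le> 1"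
  shows "fejer T u \<ge> T / 4"
proof (cases "u = 0")
  case False
  have "(\<bar>T * u / 2\<bar> / 2)\<^sup>2 \<le> \<bar>sin (T * u / 2)\<bar>\<^sup>2"
    using assms by (intro power_mono abs_sin_ge_half) auto
  then have "T / 4 * (T * u\<^sup>2) \<le> 4 * (sin (T * u / 2))\<^sup>2"
    by (simp add: power2_eq_square field_simps)
  then show ?thesis
    using assms False by (simp add: fejer_eq_sin pos_le_divide_eq)
qed (use assms in \<open>simp add: fejer_def\<close>)

lemma fejer_one_le: "fejer 1 u \<le> 5 / (1 + u\<^sup>2)"
proof (cases "u\<^sup>2 \<le> 4")
  case True
  have "fejer 1 u \<le> 1" by (rule fejer_le) simp
  also have "1 \<le> 5 / (1 + u\<^sup>2)"
    using True by (subst le_divide_eq_1_pos) (auto intro: add_pos_nonneg)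
  finally show ?thesis .
next
  case False
  then have "u \<noteq> 0" by auto
  then have "fejer 1 u \<le> 4 / u\<^sup>2" using fejer_le_inverse_square[of 1 u] by simp
  also have "4 / w \<le> 5 / (1 + w)" if "w > 4" for w :: real
    using that by (simp add: field_simps)
  then have "4 / u\<^sup>2 \<le> 5 / (1 + u\<^sup>2)" using False by simp
  finally show ?thesis .
qed

lemma one_plus_square_shift_le:
  fixes v w :: real
  assumes "\<bar>w\<bar> \<le> 1"
  shows "1 + (v + w)\<^sup>2 \<le> 3 * (1 + v\<^sup>2)"
proof -
  have "w\<^sup>2 \<le> 1" using assms by (simp add: abs_square_le_1)
  moreover have "2 * (v * w) \<le> v\<^sup>2 + w\<^sup>2" using sum_squares_bound[of v w] by simp
  moreover have "0 \<le> v\<^sup>2" by simp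
  ultimately show ?thesis unfolding power2_sum mult.assoc by argo
qed

text \<open>\<open>fejer 1\<close> has zeros, but two shifts of it have no common zero.\<close>

lemma fejer_one_shift_ge: "fejer 1 u + fejer 1 (u + 1) \<ge> 1 / (24 * (1 + u\<^sup>2))"
proof -
  define S where "S v = 4 * (sin (v / 2))\<^sup>2" for v :: real
  have fejer_ge_S: "fejer 1 v \<ge> S v / (1 + v\<^sup>2)" for v
  proof (cases "v = 0")
    case False
    then show ?thesis
      by (auto simp: fejer_eq_sin S_def intro!: divide_left_mono mult_pos_pos add_pos_nonneg)
  qed (simp add: S_def fejer_def)
  have "1 / 4 \<le> \<bar>sin (1 / 2 :: real)\<bar>" using abs_sin_ge_half[of "1 / 2"] by simp
  also have "sin (1 / 2) = sin ((u + 1) / 2 - u / 2)" by (simp add: diff_divide_distrib[symmetric])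
  also have "\<bar>\<dots>\<bar> \<le> \<bar>sin ((u + 1) / 2)\<bar> * \<bar>cos (u / 2)\<bar> + \<bar>cos ((u + 1) / 2)\<bar> * \<bar>sin (u / 2)\<bar>"
    unfolding sin_diff abs_mult[symmetric] by (rule abs_triangle_ineq4)
  also have "\<dots> \<le> \<bar>sin ((u + 1) / 2)\<bar> * 1 + 1 * \<bar>sin (u / 2)\<bar>"
    by (intro add_mono mult_mono) auto
  finally have "(1 / 4)\<^sup>2 \<le> (\<bar>sin ((u + 1) / 2)\<bar> + \<bar>sin (u / 2)\<bar>)\<^sup>2"
    by (intro power_mono) auto
  also have "\<dots> \<le> 2 * ((sin ((u + 1) / 2))\<^sup>2 + (sin (u / 2))\<^sup>2)"
    using sum_squares_bound[of "\<bar>sin ((u + 1) / 2)\<bar>" "\<bar>sin (u / 2)\<bar>"] by (simp add: power2_sum)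
  finally have "1 / 8 \<le> S u + S (u + 1)" by (simp add: S_def power2_eq_square)
  then have "1 / 8 / (3 * (1 + u\<^sup>2)) \<le> (S u + S (u + 1)) / (3 * (1 + u\<^sup>2))"
    by (rule divide_right_mono) simp
  also have "\<dots> = S u / (3 * (1 + u\<^sup>2)) + S (u + 1) / (3 * (1 + u\<^sup>2))"
    by (rule add_divide_distrib)
  also have "\<dots> \<le> S u / (1 + u\<^sup>2) + S (u + 1) / (1 + (u + 1)\<^sup>2)"
    using one_plus_square_shift_le[of 1 u]
    by (intro add_mono divide_left_mono) (auto simp: S_def intro!: mult_pos_pos add_pos_nonneg)
  also have "\<dots> \<le> fejer 1 u + fejer 1 (u + 1)" by (intro add_mono fejer_ge_S)
  finally show ?thesis by simp
qed

lemma fejer_le_fejer_one_shifts: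
  assumes "T > 0" "0 < \<eta>" "\<eta> \<le> \<bar>u\<bar>"
  shows "fejer T u \<le> 96 * (1 + 1 / \<eta>\<^sup>2) / T * (fejer 1 u + fejer 1 (u + 1))"
proof -
  have "u \<noteq> 0" using assms by auto
  have "\<eta>\<^sup>2 \<le> u\<^sup>2" using assms by (simp add: abs_le_square_iff[symmetric])
  then have "(1 + u\<^sup>2) / u\<^sup>2 \<le> 1 + 1 / \<eta>\<^sup>2"
    using \<open>u \<noteq> 0\<close> assms(2) by (simp add: add_divide_distrib divide_left_mono)
  then have "1 / u\<^sup>2 \<le> (1 + 1 / \<eta>\<^sup>2) / (1 + u\<^sup>2)"
    using \<open>u \<noteq> 0\<close> by (simp add: pos_le_divide_eq add_pos_nonneg)
  then have "4 / T * (1 / u\<^sup>2) \<le> 4 / T * ((1 + 1 / \<eta>\<^sup>2) / (1 + u\<^sup>2))"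
    using assms(1) by (intro mult_left_mono) auto
  also have "\<dots> = 96 * (1 + 1 / \<eta>\<^sup>2) / T * (1 / (24 * (1 + u\<^sup>2)))"
  proof -
    have "4 / T * (p / q) = 96 * p / T * (1 / (24 * q))" for p q :: real by simp
    then show ?thesis .
  qed
  also have "\<dots> \<le> 96 * (1 + 1 / \<eta>\<^sup>2) / T * (fejer 1 u + fejer 1 (u + 1))"
    using assms by (intro mult_left_mono fejer_one_shift_ge) auto
  finally show ?thesis using fejer_le_inverse_square[OF assms(1) \<open>u \<noteq> 0\<close>] by simp
qed

section \<open>Fejer means and a Tauberian theorem\<close>

definition tent_fourier :: "real \<Rightarrow> (real \<Rightarrow> complex) \<Rightarrow> real \<Rightarrow> real" where
  "tent_fourier T g x = integral {-T..T} (\<lambda>t. (1 - \<bar>t\<bar> / T) * Re (g t * cis (t * x)))"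

lemma tent_fourier_diff:
  assumes "T > 0" "continuous_on {-T..T} f" "continuous_on {-T..T} g"
  shows "tent_fourier T (\<lambda>t. f t - g t) x = tent_fourier T f x - tent_fourier T g x"
proof -
  have "tent_fourier T f x - tent_fourier T g x = integral {-T..T}
      (\<lambda>t. (1 - \<bar>t\<bar> / T) * Re (f t * cis (t * x)) - (1 - \<bar>t\<bar> / T) * Re (g t * cis (t * x)))"
    unfolding tent_fourier_def using assms
    by (intro integral_diff[symmetric] integrable_continuous_real continuous_intros) auto
  then show ?thesis by (simp add: tent_fourier_def algebra_simps)
qed

lemma abs_tent_fourier_le:
  assumes T: "T > 0" and g: "continuous_on {-T..T} g" "\<And>t. t \<in> {-T..T} \<Longrightarrow> norm (g t) \<le> B"
  shows "\<bar>tent_fourier T g x\<bar> \<le> B * (2 * T)"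
proof -
  have "norm (tent_fourier T g x) \<le> B * (T - (-T))"
    unfolding tent_fourier_def
  proof (rule integral_bound)
    show "continuous_on {-T..T} (\<lambda>t. (1 - \<bar>t\<bar> / T) * Re (g t * cis (t * x)))"
      using T by (intro continuous_intros g) auto
    fix t assume t: "t \<in> {-T..T}"
    have "\<bar>1 - \<bar>t\<bar> / T\<bar> \<le> 1" using t T by (auto simp: abs_if field_simps)
    moreover have "\<bar>Re (g t * cis (t * x))\<bar> \<le> B"
      using abs_Re_le_cmod[of "g t * cis (t * x)"] g(2)[OF t] by (simp add: norm_mult)
    ultimately have "\<bar>1 - \<bar>t\<bar> / T\<bar> * \<bar>Re (g t * cis (t * x))\<bar> \<le> 1 * B"
      by (intro mult_mono) auto
    then show "norm ((1 - \<bar>t\<bar> / T) * Re (g t * cis (t * x))) \<le> B"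
      by (simp only: real_norm_def abs_mult mult_1)
  qed (use T in simp)
  then show ?thesis by simp
qed

text \<open>The shift by \<open>\<pi>/x\<close> changes the sign of the exponential.\<close>

lemma Fourier_integral_half_period_shift:
  fixes h :: "real \<Rightarrow> complex"
  assumes cont: "continuous_on UNIV h" and supp: "\<And>t. t \<notin> {a..b} \<Longrightarrow> h t = 0" and "x > 0"
  shows "2 * integral {a..b} (\<lambda>t. h t * cis (t * x))
     = integral {a - pi / x..b} (\<lambda>t. (h t - h (t + pi / x)) * cis (t * x))"
proof -
  define \<tau> where "\<tau> = pi / x"
  define f where "f = (\<lambda>t. h t * cis (t * x))"
  have "\<tau> > 0" using \<open>x > 0\<close> by (simp add: \<tau>_def)
  have cont_f: "continuous_on A f" for A
    unfolding f_def by (intro continuous_intros continuous_on_subset[OF cont]) simp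
  have cont_shift: "continuous_on A (\<lambda>t. f (t + \<tau>))" for A
    by (rule continuous_on_compose2[OF cont_f[of UNIV]]) (auto intro!: continuous_intros)
  have f_integral: "integral {c..d} f = integral {a..b} f" if "c \<le> a" "b \<le> d" for c d
  proof (rule integral_unique[OF has_integral_on_superset])
    show "(f has_integral integral {a..b} f) {a..b}"
      by (intro integrable_integral integrable_continuous_real cont_f)
  qed (use supp that in \<open>auto simp: f_def\<close>)
  have neg: "f (t + \<tau>) = - (h (t + \<tau>) * cis (t * x))" for t
  proof -
    have "(t + \<tau>) * x = t * x + pi" using \<open>x > 0\<close> by (simp add: \<tau>_def field_simps)
    then show ?thesis by (simp add: f_def flip: cis_mult)
  qed
  have "integral {a - \<tau>..b} (f \<circ> (\<lambda>t. t + \<tau>)) = integral {a - \<tau> + \<tau>..b + \<tau>} f"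
    by (rule integral_shift[OF cont_f])
  then have "integral {a - \<tau>..b} (\<lambda>t. f (t + \<tau>)) = integral {a..b} f"
    using f_integral[of a "b + \<tau>"] \<open>\<tau> > 0\<close> by (simp add: o_def)
  moreover have "integral {a - \<tau>..b} f = integral {a..b} f"
    using \<open>\<tau> > 0\<close> by (intro f_integral) auto
  moreover have "integral {a - \<tau>..b} (\<lambda>t. f t + f (t + \<tau>))
      = integral {a - \<tau>..b} f + integral {a - \<tau>..b} (\<lambda>t. f (t + \<tau>))"
    by (intro integral_add integrable_continuous_real cont_f cont_shift)
  ultimately have "integral {a - \<tau>..b} (\<lambda>t. f t + f (t + \<tau>)) = 2 * integral {a..b} f" by simp
  moreover have "f t + f (t + \<tau>) = (h t - h (t + \<tau>)) * cis (t * x)" for t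
    unfolding neg by (simp add: f_def left_diff_distrib)
  ultimately show ?thesis by (simp add: f_def \<tau>_def)
qed

lemma Riemann_Lebesgue_compact_support:
  fixes h :: "real \<Rightarrow> complex"
  assumes cont: "continuous_on UNIV h" and supp: "\<And>t. t \<notin> {a..b} \<Longrightarrow> h t = 0" and "a \<le> b"
  shows "((\<lambda>x. integral {a..b} (\<lambda>t. h t * cis (t * x))) \<longlongrightarrow> 0) at_top"
proof (rule tendstoI)
  fix e :: real assume "e > 0"
  define e' where "e' = e / (b - a + 1)"
  have "e' > 0" using \<open>e > 0\<close> \<open>a \<le> b\<close> by (simp add: e'_def)
  have "uniformly_continuous_on {a - 1..b + 1} h"
    by (intro compact_uniformly_continuous continuous_on_subset[OF cont]) auto
  then obtain d where d: "d > 0"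
      "\<And>s t. s \<in> {a - 1..b + 1} \<Longrightarrow> t \<in> {a - 1..b + 1} \<Longrightarrow> dist t s < d \<Longrightarrow> dist (h t) (h s) < e'"
    using \<open>e' > 0\<close> unfolding uniformly_continuous_on_def by metis
  have "((\<lambda>x::real. pi / x) \<longlongrightarrow> 0) at_top" by real_asymp
  then have "eventually (\<lambda>x::real. pi / x < min 1 d) at_top"
    using d(1) by (intro order_tendstoD) auto
  then show "eventually (\<lambda>x. dist (integral {a..b} (\<lambda>t. h t * cis (t * x))) 0 < e) at_top"
    using eventually_gt_at_top[of 0]
  proof eventually_elim
    case (elim x)
    define \<tau> where "\<tau> = pi / x"
    have \<tau>: "0 < \<tau>" "\<tau> < 1" "\<tau> < d" using elim by (auto simp: \<tau>_def)
    have "2 * integral {a..b} (\<lambda>t. h t * cis (t * x))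
        = integral {a - \<tau>..b} (\<lambda>t. (h t - h (t + \<tau>)) * cis (t * x))"
      unfolding \<tau>_def by (rule Fourier_integral_half_period_shift[OF cont supp elim(2)])
    also have "norm \<dots> \<le> e' * (b - (a - \<tau>))"
    proof (rule integral_bound)
      show "continuous_on {a - \<tau>..b} (\<lambda>t. (h t - h (t + \<tau>)) * cis (t * x))"
        by (intro continuous_intros continuous_on_compose2[OF cont]) auto
      fix t assume t: "t \<in> {a - \<tau>..b}"
      have "dist (h t) (h (t + \<tau>)) < e'" using t \<tau> by (intro d(2)) (auto simp: dist_norm)
      then show "norm ((h t - h (t + \<tau>)) * cis (t * x)) \<le> e'" by (simp add: norm_mult dist_norm)
    qed (use \<tau> \<open>a \<le> b\<close> in simp)
    also have "\<dots> \<le> e' * (b - a + 1)" using \<tau> \<open>e' > 0\<close> by (intro mult_left_mono) auto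
    also have "\<dots> = e" using \<open>a \<le> b\<close> by (simp add: e'_def)
    finally show ?case using \<open>e > 0\<close> by (simp add: norm_mult)
  qed
qed

lemma tent_fourier_tendsto_0:
  assumes T: "T > 0" and cont: "continuous_on {-T..T} g"
  shows "(tent_fourier T g \<longlongrightarrow> 0) at_top"
proof -
  define h where "h t = (if t \<in> {-T..T} then of_real (1 - \<bar>t\<bar> / T) * g t else 0)" for t
  have "continuous_on ({-T..T} \<union> ({..-T} \<union> {T..})) h"
    unfolding h_def using T by (intro continuous_on_cases continuous_intros cont) auto
  moreover have "{-T..T} \<union> ({..-T} \<union> {T..}) = UNIV" by auto
  ultimately have cont_h: "continuous_on UNIV h" by simp
  have "((\<lambda>x. Re (integral {-T..T} (\<lambda>t. h t * cis (t * x)))) \<longlongrightarrow> Re 0) at_top"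
    using T by (intro tendsto_Re Riemann_Lebesgue_compact_support cont_h) (auto simp: h_def)
  moreover have "Re (integral {-T..T} (\<lambda>t. h t * cis (t * x))) = tent_fourier T g x" for x
    unfolding tent_fourier_def
  proof (rule integral_unique[symmetric])
    have "((Re \<circ> (\<lambda>t. h t * cis (t * x)))
        has_integral Re (integral {-T..T} (\<lambda>t. h t * cis (t * x)))) {-T..T}"
      by (intro has_integral_linear bounded_linear_Re integrable_integral integrable_continuous_real
          continuous_intros continuous_on_subset[OF cont_h]) simp
    moreover have "(Re \<circ> (\<lambda>t. h t * cis (t * x))) t = (1 - \<bar>t\<bar> / T) * Re (g t * cis (t * x))"
        if "t \<in> {-T..T}" for t
      using that
      by (simp add: h_def left_diff_distrib right_diff_distrib diff_divide_distrib mult_ac)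
    ultimately show "((\<lambda>t. (1 - \<bar>t\<bar> / T) * Re (g t * cis (t * x))) has_integral
        Re (integral {-T..T} (\<lambda>t. h t * cis (t * x)))) {-T..T}"
      by (rule has_integral_eq[rotated])
  qed
  ultimately show ?thesis by simp
qed

definition fejer_mean :: "(nat \<Rightarrow> real) \<Rightarrow> real \<Rightarrow> real \<Rightarrow> real \<Rightarrow> real" where
  "fejer_mean a T \<sigma> x = suminf (\<lambda>n. a n * real n powr (-\<sigma>) * fejer T (ln (real n) - x))"

lemma summable_fejer_mean:
  assumes "dirichlet_abs_conv a" "\<sigma> > 1" "T > 0"
  shows "summable (\<lambda>n. a n * real n powr (-\<sigma>) * fejer T (ln (real n) - x))"
proof (rule summable_comparison_test')
  show "summable (\<lambda>n. \<bar>a n\<bar> * real n powr (-\<sigma>) * T)"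
    by (intro summable_mult2 dirichlet_abs_convD assms)
  show "norm (a n * real n powr (-\<sigma>) * fejer T (ln (real n) - x))
      \<le> \<bar>a n\<bar> * real n powr (-\<sigma>) * T" for n
    using assms(3) fejer_nonneg[of T "ln (real n) - x"] fejer_le[of T "ln (real n) - x"]
    by (auto simp: abs_mult intro!: mult_left_mono)
qed

lemma fejer_mean_sub_const:
  assumes "dirichlet_abs_conv a" "\<sigma> > 1" "T > 0"
  shows "fejer_mean (\<lambda>n. a n - c) T \<sigma> x = fejer_mean a T \<sigma> x - c * fejer_mean (\<lambda>_. 1) T \<sigma> x"
proof -
  have "(\<lambda>n. a n * real n powr (-\<sigma>) * fejer T (ln (real n) - x)
      - c * (1 * real n powr (-\<sigma>) * fejer T (ln (real n) - x)))
     sums (fejer_mean a T \<sigma> x - c * fejer_mean (\<lambda>_. 1) T \<sigma> x)"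
    unfolding fejer_mean_def
    by (intro sums_diff sums_mult summable_sums summable_fejer_mean dirichlet_abs_conv_const assms)
  then show ?thesis by (simp add: fejer_mean_def sums_iff left_diff_distrib mult.assoc)
qed

lemma uniform_limit_dirichlet_tent:
  assumes "dirichlet_abs_conv b" "\<sigma> > 1" "T > 0"
  shows "uniform_limit {-T..T}
     (\<lambda>N t. \<Sum>n<N. (1 - \<bar>t\<bar> / T) * (b n * (real n powr (-\<sigma>) * cos (t * (ln (real n) - x)))))
     (\<lambda>t. (1 - \<bar>t\<bar> / T) * Re (dirichlet_series b (Complex \<sigma> t) * cis (t * x))) sequentially"
proof -
  define f where
    "f n t = (1 - \<bar>t\<bar> / T) * (b n * (real n powr (-\<sigma>) * cos (t * (ln (real n) - x))))" for n t
  have "uniform_limit {-T..T} (\<lambda>N t. \<Sum>n<N. f n t) (\<lambda>t. suminf (\<lambda>n. f n t)) sequentially"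
  proof (rule Weierstrass_m_test[OF _ dirichlet_abs_convD[OF assms(1,2)]])
    fix n t assume "t \<in> {-T..T}"
    then have "\<bar>1 - \<bar>t\<bar> / T\<bar> \<le> 1" using assms(3) by (auto simp: abs_if field_simps)
    then have "\<bar>1 - \<bar>t\<bar> / T\<bar> * (\<bar>b n\<bar> * (real n powr (-\<sigma>) * \<bar>cos (t * (ln (real n) - x))\<bar>))
        \<le> 1 * (\<bar>b n\<bar> * (real n powr (-\<sigma>) * 1))"
      by (intro mult_mono) auto
    then show "norm (f n t) \<le> \<bar>b n\<bar> * real n powr (-\<sigma>)"
      unfolding f_def by (simp add: abs_mult)
  qed
  moreover have "suminf (\<lambda>n. f n t)
      = (1 - \<bar>t\<bar> / T) * Re (dirichlet_series b (Complex \<sigma> t) * cis (t * x))" for t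
    unfolding f_def
    by (rule sums_unique[symmetric, OF sums_mult[OF Re_dirichlet_series_cis_sums[OF assms(1,2)]]])
  ultimately show ?thesis unfolding f_def by (simp only:)
qed

lemma fejer_mean_eq_tent_fourier:
  assumes "dirichlet_abs_conv b" "\<sigma> > 1" "T > 0"
  shows "fejer_mean b T \<sigma> x = tent_fourier T (\<lambda>t. dirichlet_series b (Complex \<sigma> t)) x"
proof -
  define f where
    "f n t = (1 - \<bar>t\<bar> / T) * (b n * (real n powr (-\<sigma>) * cos (t * (ln (real n) - x))))" for n t
  define S where "S N = (\<Sum>n<N. b n * real n powr (-\<sigma>) * fejer T (ln (real n) - x))" for N
  have partial_sum: "((\<lambda>t. \<Sum>n<N. f n t) has_integral S N) {-T..T}" for N
    unfolding S_def
  proof (intro has_integral_sum)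
    fix n
    have "((\<lambda>t. (b n * real n powr (-\<sigma>)) * ((1 - \<bar>t\<bar> / T) * cos (t * (ln (real n) - x))))
        has_integral (b n * real n powr (-\<sigma>)) * fejer T (ln (real n) - x)) {-T..T}"
      by (intro has_integral_mult_right has_integral_fejer assms)
    then show "(f n has_integral b n * real n powr (-\<sigma>) * fejer T (ln (real n) - x)) {-T..T}"
      unfolding f_def by (simp add: mult_ac)
  qed simp
  obtain I J where limit: "\<And>N. ((\<lambda>t. \<Sum>n<N. f n t) has_integral I N) {-T..T}"
      "((\<lambda>t. (1 - \<bar>t\<bar> / T) * Re (dirichlet_series b (Complex \<sigma> t) * cis (t * x)))
          has_integral J) {-T..T}"
      "I \<longlonglongrightarrow> J"
  proof (rule uniform_limit_integral[OF uniform_limit_dirichlet_tent[OF assms, of x, folded f_def]])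
    show "continuous_on {-T..T} (\<lambda>t. \<Sum>n<N. f n t)" for N
      unfolding f_def by (intro continuous_intros) (use assms(3) in auto)
  qed auto
  have "I = S" by (intro ext has_integral_unique[OF limit(1) partial_sum])
  moreover have "J = tent_fourier T (\<lambda>t. dirichlet_series b (Complex \<sigma> t)) x"
    using limit(2) by (simp add: tent_fourier_def integral_unique)
  moreover have "S \<longlonglongrightarrow> fejer_mean b T \<sigma> x"
    unfolding S_def fejer_mean_def
    by (rule summable_LIMSEQ[OF summable_fejer_mean[OF assms]])
  ultimately show ?thesis using limit(3) LIMSEQ_unique by blast
qed

lemma inverse_nat_Lorentz_le_arctan_diff:
  fixes n :: nat
  assumes "n \<ge> 1"
  shows "1 / (real n * (1 + (ln (real n) - x)\<^sup>2))
      \<le> 6 * (arctan (ln (real (Suc n)) - x) - arctan (ln (real n) - x))"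
proof -
  have deriv: "((\<lambda>z. arctan (ln z - x)) has_real_derivative 1 / ((1 + (ln z - x)\<^sup>2) * z)) (at z)"
      if "z > 0" for z
    using that by (auto intro!: derivative_eq_intros simp: field_simps)
  obtain z where z: "real n < z" "z < real (Suc n)"
    "arctan (ln (real (Suc n)) - x) - arctan (ln (real n) - x) = 1 / ((1 + (ln z - x)\<^sup>2) * z)"
    using MVT2[of "real n" "real (Suc n)", OF _ deriv] assms by force
  define v where "v = ln (real n) - x"
  define w where "w = ln z - ln (real n)"
  have "w = ln (z / real n)" using z assms by (simp add: w_def ln_div)
  also have "\<dots> \<le> z / real n - 1" using z assms by (intro ln_le_minus_one) auto
  also have "\<dots> \<le> 1" using z assms by (simp add: field_simps)
  finally have "\<bar>w\<bar> \<le> 1" using z assms by (auto simp: w_def)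
  then have "(1 + (v + w)\<^sup>2) * z \<le> (3 * (1 + v\<^sup>2)) * (2 * real n)"
    using z assms by (intro mult_mono one_plus_square_shift_le) auto
  then have "1 / ((3 * (1 + v\<^sup>2)) * (2 * real n)) \<le> 1 / ((1 + (v + w)\<^sup>2) * z)"
    using z assms by (intro divide_left_mono) (auto intro!: mult_pos_pos add_pos_nonneg)
  then have "6 * (1 / ((3 * (1 + v\<^sup>2)) * (2 * real n))) \<le> 6 * (1 / ((1 + (v + w)\<^sup>2) * z))"
    by (rule mult_left_mono) simp
  moreover have "6 * (1 / ((3 * q) * (2 * p))) = 1 / (p * q)" for p q :: real by simp
  moreover have "ln z - x = v + w" by (simp add: v_def w_def)
  ultimately show ?thesis unfolding z(3) by (simp only: v_def[symmetric])
qed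

lemma sum_inverse_nat_Lorentz_le:
  "(\<Sum>n<N. real n powr (-1) * (1 / (1 + (ln (real n) - x)\<^sup>2))) \<le> 6 * pi"
proof (cases "N \<ge> 1")
  case True
  have "(\<Sum>n<N. real n powr (-1) * (1 / (1 + (ln (real n) - x)\<^sup>2)))
      = (\<Sum>n=1..<N. 1 / (real n * (1 + (ln (real n) - x)\<^sup>2)))"
    by (rule sum.mono_neutral_cong_right) (auto simp: not_le powr_minus_divide)
  also have "\<dots> \<le> (\<Sum>n=1..<N. 6 * (arctan (ln (real (Suc n)) - x) - arctan (ln (real n) - x)))"
    by (intro sum_mono inverse_nat_Lorentz_le_arctan_diff) auto
  also have "\<dots> = 6 * (arctan (ln (real N) - x) - arctan (ln (real 1) - x))"
    unfolding sum_distrib_left[symmetric]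
    using sum_Suc_diff'[OF True, of "\<lambda>n. arctan (ln (real n) - x)"] by simp
  also have "\<dots> \<le> 6 * pi"
    using arctan_bounded[of "ln (real N) - x"] arctan_bounded[of "ln (real 1) - x"] by argo
  finally show ?thesis .
qed (simp add: not_le)

lemma fejer_mean_1_le:
  assumes "\<sigma> > 1"
  shows "fejer_mean (\<lambda>_. 1) 1 \<sigma> x \<le> 30 * pi"
  unfolding fejer_mean_def
proof (rule suminf_le_const[OF summable_fejer_mean])
  fix N
  have "(\<Sum>n<N. 1 * real n powr (-\<sigma>) * fejer 1 (ln (real n) - x))
      \<le> (\<Sum>n<N. real n powr (-1) * (5 / (1 + (ln (real n) - x)\<^sup>2)))"
  proof (intro sum_mono mult_mono fejer_one_le fejer_nonneg)
    fix n :: nat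
    show "1 * real n powr (-\<sigma>) \<le> real n powr (-1)"
      using powr_mono[of "-\<sigma>" "-1" "real n"] assms by (cases "n = 0") auto
  qed auto
  also have "\<dots> = 5 * (\<Sum>n<N. real n powr (-1) * (1 / (1 + (ln (real n) - x)\<^sup>2)))"
    by (simp add: sum_distrib_left mult.commute)
  also have "\<dots> \<le> 5 * (6 * pi)" by (intro mult_left_mono sum_inverse_nat_Lorentz_le) simp
  finally show "(\<Sum>n<N. 1 * real n powr (-\<sigma>) * fejer 1 (ln (real n) - x)) \<le> 30 * pi" by simp
qed (use assms dirichlet_abs_conv_const in auto)

lemma nats_between_eq:
  assumes "0 \<le> a"
  shows "{n. a \<le> real n \<and> real n \<le> b} = (if b \<ge> 0 then {nat \<lceil>a\<rceil>..nat \<lfloor>b\<rfloor>} else {})"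
  using assms by (auto simp: nat_le_iff le_nat_iff ceiling_le_iff le_floor_iff)

lemma card_nats_between_ge:
  assumes "0 \<le> a"
  shows "real (card {n. a \<le> real n \<and> real n \<le> b}) \<ge> b - a - 1"
  unfolding nats_between_eq[OF assms] using assms by (auto simp: of_nat_diff nat_le_iff) linarith+

lemma fejer_mean_1_ge:
  assumes T: "T \<ge> 1" and x: "exp x \<ge> 2 * T" "x \<ge> 0" and \<sigma>: "1 < \<sigma>" "\<sigma> \<le> 2" "(\<sigma> - 1) * x \<le> 1"
  shows "fejer_mean (\<lambda>_. 1) T \<sigma> x \<ge> exp (-3) / 8"
proof -
  define W where "W = {n. exp x \<le> real n \<and> real n \<le> exp (x + 1 / T)}"
  have "finite W" by (simp add: W_def nats_between_eq)
  have "exp x / (2 * T) \<le> exp x * (1 + 1 / T) - exp x - 1" using x(1) T by (simp add: field_simps)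
  also have "\<dots> \<le> exp (x + 1 / T) - exp x - 1"
    unfolding exp_add by (intro diff_mono mult_left_mono exp_ge_add_one_self) auto
  also have "\<dots> \<le> real (card W)" unfolding W_def by (rule card_nats_between_ge) simp
  finally have card_W: "exp x / (2 * T) \<le> real (card W)" .
  have summand_ge: "1 * real n powr (-\<sigma>) * fejer T (ln (real n) - x) \<ge> exp (-x - 3) * (T / 4)"
      if "n \<in> W" for n
  proof (rule mult_mono)
    have "real n > 0" using that less_le_trans[OF exp_gt_zero] unfolding W_def by blast
    then have "ln (exp x) \<le> ln (real n)" "ln (real n) \<le> ln (exp (x + 1 / T))"
      using that by (simp_all add: W_def del: ln_exp)
    then have ln_n: "x \<le> ln (real n)" "ln (real n) \<le> x + 1 / T" by simp_all
    then show "T / 4 \<le> fejer T (ln (real n) - x)"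
      using T by (intro fejer_ge) (auto simp: abs_if field_simps)
    have "1 / T \<le> 1" using T by simp
    then have "\<sigma> * ln (real n) \<le> \<sigma> * (x + 1)" using ln_n \<sigma> by (intro mult_left_mono) auto
    also have "\<dots> \<le> x + 3" using \<sigma> by (simp add: algebra_simps)
    finally show "exp (-x - 3) \<le> 1 * real n powr (-\<sigma>)" using \<open>real n > 0\<close> by (simp add: powr_def)
  qed (use T in auto)
  have "exp (-3) / 8 = (exp x / (2 * T)) * (exp (-x - 3) * (T / 4))"
    using T by (simp add: exp_diff exp_minus field_simps)
  also have "\<dots> \<le> real (card W) * (exp (-x - 3) * (T / 4))"
    using card_W T by (intro mult_right_mono) auto
  also have "\<dots> \<le> (\<Sum>n\<in>W. 1 * real n powr (-\<sigma>) * fejer T (ln (real n) - x))"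
    by (rule sum_bounded_below) (rule summand_ge)
  also have "\<dots> \<le> fejer_mean (\<lambda>_. 1) T \<sigma> x"
    unfolding fejer_mean_def using T \<sigma> \<open>finite W\<close>
    by (intro sum_le_suminf summable_fejer_mean dirichlet_abs_conv_const)
       (auto intro!: mult_nonneg_nonneg fejer_nonneg)
  finally show ?thesis .
qed

lemma fejer_mean_boundary_residue:
  assumes a: "dirichlet_abs_conv a"
    and G: "\<And>s. Re s > 1 \<Longrightarrow> dirichlet_series a s - of_real c * dirichlet_series (\<lambda>_. 1) s = G s"
    and "\<sigma> > 1" "T > 0"
  shows "fejer_mean a T \<sigma> x = c * fejer_mean (\<lambda>_. 1) T \<sigma> x + tent_fourier T (\<lambda>t. G (Complex \<sigma> t)) x"
proof -
  have "dirichlet_series (\<lambda>n. a n - c) (Complex \<sigma> t) = G (Complex \<sigma> t)" for t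
    using dirichlet_series_diff[OF a dirichlet_abs_conv_const, of "Complex \<sigma> t" c]
      dirichlet_series_cmult[OF dirichlet_abs_conv_const, of "Complex \<sigma> t" c 1]
      G[of "Complex \<sigma> t"] \<open>\<sigma> > 1\<close>
    by simp
  then have "fejer_mean (\<lambda>n. a n - c) T \<sigma> x = tent_fourier T (\<lambda>t. G (Complex \<sigma> t)) x"
    using fejer_mean_eq_tent_fourier[OF dirichlet_abs_conv_diff[OF a dirichlet_abs_conv_const]
        assms(3,4), of c x]
    by simp
  then show ?thesis using fejer_mean_sub_const[OF a assms(3,4), of c x] by simp
qed

lemma compact_Complex_rectangle: "compact {s. Re s \<in> {a..b} \<and> Im s \<in> {c..d}}"
proof -
  have "{s. Re s \<in> {a..b} \<and> Im s \<in> {c..d}} = cbox (Complex a c) (Complex b d)"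
    by (auto simp: in_cbox_complex_iff)
  then show ?thesis by simp
qed

lemma continuous_on_vertical_line:
  assumes "continuous_on {s. Re s \<ge> b} G" "\<sigma> \<ge> b"
  shows "continuous_on A (\<lambda>t. G (Complex \<sigma> t))"
  by (rule continuous_on_compose2[OF assms(1)])
     (use assms(2) in \<open>auto simp: Complex_eq intro!: continuous_intros\<close>)

lemma tent_fourier_bounded_near_boundary:
  assumes G: "continuous_on {s. Re s \<ge> 1} G" and "T > 0"
  obtains B where "\<And>\<sigma> x. 1 < \<sigma> \<Longrightarrow> \<sigma> \<le> 2 \<Longrightarrow> \<bar>tent_fourier T (\<lambda>t. G (Complex \<sigma> t)) x\<bar> \<le> B"
proof -
  define K where "K = {s. Re s \<in> {1..2} \<and> Im s \<in> {-T..T}}"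
  have "bounded (G ` K)"
    unfolding K_def
    by (intro compact_imp_bounded compact_continuous_image compact_Complex_rectangle
        continuous_on_subset[OF G]) auto
  then obtain B where "\<And>s. s \<in> K \<Longrightarrow> norm (G s) \<le> B" unfolding bounded_iff by blast
  then have "\<bar>tent_fourier T (\<lambda>t. G (Complex \<sigma> t)) x\<bar> \<le> B * (2 * T)" if "1 < \<sigma>" "\<sigma> \<le> 2" for \<sigma> x
    using that \<open>T > 0\<close>
    by (intro abs_tent_fourier_le continuous_on_vertical_line[OF G]) (auto simp: K_def)
  then show ?thesis by (rule that)
qed

lemma tent_fourier_uniform_limit_at_boundary:
  assumes G: "continuous_on {s. Re s \<ge> 1} G" and "T > 0" "e > 0"
  obtains d where "d > 0" "\<And>\<sigma> x. 1 < \<sigma> \<Longrightarrow> \<sigma> < 1 + d \<Longrightarrow>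
     \<bar>tent_fourier T (\<lambda>t. G (Complex \<sigma> t)) x - tent_fourier T (\<lambda>t. G (Complex 1 t)) x\<bar> \<le> e"
proof -
  define K where "K = {s. Re s \<in> {1..2} \<and> Im s \<in> {-T..T}}"
  have "uniformly_continuous_on K G"
    unfolding K_def
    by (intro compact_uniformly_continuous compact_Complex_rectangle
        continuous_on_subset[OF G]) auto
  moreover have "e / (2 * T) > 0" using \<open>T > 0\<close> \<open>e > 0\<close> by simp
  ultimately obtain d where d: "d > 0"
      "\<And>s s'. s \<in> K \<Longrightarrow> s' \<in> K \<Longrightarrow> dist s' s < d \<Longrightarrow> dist (G s') (G s) < e / (2 * T)"
    unfolding uniformly_continuous_on_def by metis
  have close: "\<bar>tent_fourier T (\<lambda>t. G (Complex \<sigma> t)) x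
      - tent_fourier T (\<lambda>t. G (Complex 1 t)) x\<bar> \<le> e"
    if \<sigma>: "1 < \<sigma>" "\<sigma> < 1 + min 1 d" for \<sigma> x
  proof -
    have "norm (G (Complex \<sigma> t) - G (Complex 1 t)) \<le> e / (2 * T)" if t: "t \<in> {-T..T}" for t
    proof -
      have "Complex \<sigma> t - Complex 1 t = of_real (\<sigma> - 1)" by (simp add: complex_eq_iff)
      then have "dist (Complex \<sigma> t) (Complex 1 t) < d"
        using \<sigma> by (simp add: dist_norm del: of_real_diff)
      then have "dist (G (Complex \<sigma> t)) (G (Complex 1 t)) < e / (2 * T)"
        using t \<sigma> by (intro d(2)) (auto simp: K_def)
      then show ?thesis by (simp add: dist_norm)
    qed
    then have "\<bar>tent_fourier T (\<lambda>t. G (Complex \<sigma> t) - G (Complex 1 t)) x\<bar> \<le> e / (2 * T) * (2 * T)"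
      using \<sigma> \<open>T > 0\<close>
      by (intro abs_tent_fourier_le continuous_intros continuous_on_vertical_line[OF G]) auto
    also have "\<dots> = e" using \<open>T > 0\<close> by simp
    finally show ?thesis
      using \<sigma> tent_fourier_diff[of T "\<lambda>t. G (Complex \<sigma> t)" "\<lambda>t. G (Complex 1 t)" x,
          OF \<open>T > 0\<close> continuous_on_vertical_line[OF G] continuous_on_vertical_line[OF G]]
      by simp
  qed
  show ?thesis by (rule that[of "min 1 d"]) (use d(1) close in auto)
qed

lemma fejer_mean_bounded:
  assumes "dirichlet_abs_conv a" "boundary_residue a c" "c > 0"
  obtains C where "C > 0" "\<And>\<sigma> x. 1 < \<sigma> \<Longrightarrow> \<sigma> \<le> 2 \<Longrightarrow> fejer_mean a 1 \<sigma> x \<le> C"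
proof -
  obtain G where G: "continuous_on {s. Re s \<ge> 1} G"
      "\<And>s. Re s > 1 \<Longrightarrow> dirichlet_series a s - of_real c * dirichlet_series (\<lambda>_. 1) s = G s"
    using assms(2) unfolding boundary_residue_def by blast
  obtain B where B: "\<And>\<sigma> x. 1 < \<sigma> \<Longrightarrow> \<sigma> \<le> 2 \<Longrightarrow> \<bar>tent_fourier 1 (\<lambda>t. G (Complex \<sigma> t)) x\<bar> \<le> B"
    using tent_fourier_bounded_near_boundary[OF G(1) zero_less_one] by blast
  have "fejer_mean a 1 \<sigma> x \<le> c * (30 * pi) + \<bar>B\<bar>" if "1 < \<sigma>" "\<sigma> \<le> 2" for \<sigma> x
  proof -
    have "c * fejer_mean (\<lambda>_. 1) 1 \<sigma> x \<le> c * (30 * pi)"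
      using that assms(3) by (intro mult_left_mono fejer_mean_1_le) auto
    then show ?thesis
      using fejer_mean_boundary_residue[OF assms(1) G(2) that(1) zero_less_one, of x]
          B[OF that, of x]
      by linarith
  qed
  moreover have "c * (30 * pi) + \<bar>B\<bar> > 0" using assms(3) by (intro add_pos_nonneg) auto
  ultimately show ?thesis using that by blast
qed

lemma fejer_mean_eventually_ge:
  assumes a: "dirichlet_abs_conv a" "boundary_residue a c" and "c > 0" "T \<ge> 1"
  shows "eventually (\<lambda>x. \<exists>\<sigma>. 1 < \<sigma> \<and> \<sigma> \<le> 2 \<and> fejer_mean a T \<sigma> x \<ge> c * exp (-3) / 16) at_top"
proof -
  obtain G where G: "continuous_on {s. Re s \<ge> 1} G"
      "\<And>s. Re s > 1 \<Longrightarrow> dirichlet_series a s - of_real c * dirichlet_series (\<lambda>_. 1) s = G s"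
    using a(2) unfolding boundary_residue_def by blast
  define J where "J \<sigma> = tent_fourier T (\<lambda>t. G (Complex \<sigma> t))" for \<sigma>
  define e where "e = c * exp (-3) / 32"
  have pos: "T > 0" "e > 0" using assms(3,4) by (simp_all add: e_def)
  obtain d where d: "d > 0" "\<And>\<sigma> x. 1 < \<sigma> \<Longrightarrow> \<sigma> < 1 + d \<Longrightarrow> \<bar>J \<sigma> x - J 1 x\<bar> \<le> e"
    using tent_fourier_uniform_limit_at_boundary[OF G(1) pos] unfolding J_def by blast
  have "(J 1 \<longlongrightarrow> 0) at_top"
    unfolding J_def by (intro tent_fourier_tendsto_0 pos continuous_on_vertical_line[OF G(1)]) simp
  then have "eventually (\<lambda>x. \<bar>J 1 x\<bar> < e) at_top"
    using tendstoD[OF _ pos(2)] by fastforce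
  moreover have "eventually (\<lambda>x. exp x \<ge> 2 * T) at_top"
    using exp_at_top unfolding filterlim_at_top by blast
  ultimately show ?thesis
    using eventually_ge_at_top[of 1]
  proof eventually_elim
    case (elim x)
    define \<sigma> where "\<sigma> = 1 + min (d / 2) (1 / x)"
    have \<sigma>: "1 < \<sigma>" "\<sigma> < 1 + d" using d(1) elim(3) by (auto simp: \<sigma>_def)
    have "1 / x \<le> 1" using elim(3) by simp
    then have "\<sigma> \<le> 2" by (simp add: \<sigma>_def min_le_iff_disj)
    have "(\<sigma> - 1) * x \<le> 1 / x * x" using elim(3) by (intro mult_right_mono) (auto simp: \<sigma>_def)
    then have "(\<sigma> - 1) * x \<le> 1" using elim(3) by simp
    then have "c * (exp (-3) / 8) \<le> c * fejer_mean (\<lambda>_. 1) T \<sigma> x"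
      using elim \<sigma> \<open>\<sigma> \<le> 2\<close> assms(3,4) by (intro mult_left_mono fejer_mean_1_ge) auto
    moreover have "fejer_mean a T \<sigma> x = c * fejer_mean (\<lambda>_. 1) T \<sigma> x + J \<sigma> x"
      unfolding J_def by (rule fejer_mean_boundary_residue[OF a(1) G(2) \<sigma>(1) pos(1)])
    ultimately have "fejer_mean a T \<sigma> x \<ge> c * exp (-3) / 16"
      using d(2)[OF \<sigma>, of x] elim(1) unfolding e_def by linarith
    then show ?case using \<sigma>(1) \<open>\<sigma> \<le> 2\<close> by blast
  qed
qed

lemma fejer_mean_le_if_gap:
  assumes a: "dirichlet_abs_conv a" "\<And>n. a n \<ge> 0" and "T > 0" "\<sigma> > 1" "\<eta> > 0"
    and gap: "\<And>n. \<bar>ln (real n) - x\<bar> \<le> \<eta> \<Longrightarrow> a n = 0"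
  shows "fejer_mean a T \<sigma> x
    \<le> 96 * (1 + 1 / \<eta>\<^sup>2) / T * (fejer_mean a 1 \<sigma> x + fejer_mean a 1 \<sigma> (x - 1))"
proof -
  define E where "E = 96 * (1 + 1 / \<eta>\<^sup>2) / T"
  define f where "f T x n = a n * real n powr (-\<sigma>) * fejer T (ln (real n) - x)" for T x n
  have summable_f: "summable (f T x)" if "T > 0" for T x
    unfolding f_def using a(1) assms(4) that by (rule summable_fejer_mean)
  have "suminf (f T x) \<le> suminf (\<lambda>n. E * (f 1 x n + f 1 (x - 1) n))"
  proof (rule suminf_le)
    fix n
    show "f T x n \<le> E * (f 1 x n + f 1 (x - 1) n)"
    proof (cases "\<bar>ln (real n) - x\<bar> \<le> \<eta>")
      case False
      have "f T x n \<le> a n * real n powr (-\<sigma>)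
          * (E * (fejer 1 (ln (real n) - x) + fejer 1 (ln (real n) - x + 1)))"
        unfolding f_def E_def using False a(2)[of n] assms
        by (intro mult_left_mono fejer_le_fejer_one_shifts) auto
      then show ?thesis by (simp add: f_def algebra_simps)
    qed (simp add: f_def gap)
  qed (intro summable_mult summable_add summable_f assms zero_less_one)+
  also have "\<dots> = E * (suminf (f 1 x) + suminf (f 1 (x - 1)))"
    by (simp add: suminf_mult suminf_add summable_add summable_f)
  finally show ?thesis unfolding f_def E_def fejer_mean_def .
qed

text \<open>If \<open>a\<close> vanished on a window around \<open>x\<close>, its Fejer means at \<open>x\<close> would be \<open>O(1/T)\<close>, whereas those
  of the constant \<open>c\<close> are bounded below and the two differ by a Fourier integral which tends to \<open>0\<close>.\<close>

theorem positive_coeff_in_log_window: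
  assumes a: "dirichlet_abs_conv a" "\<And>n. a n \<ge> 0" "boundary_residue a c" and "c > 0" "\<eta> > 0"
  shows "eventually (\<lambda>x. \<exists>n. a n > 0 \<and> \<bar>ln (real n) - x\<bar> \<le> \<eta>) at_top"
proof -
  obtain C where C: "C > 0" "\<And>\<sigma> x. 1 < \<sigma> \<Longrightarrow> \<sigma> \<le> 2 \<Longrightarrow> fejer_mean a 1 \<sigma> x \<le> C"
    using fejer_mean_bounded[OF a(1,3) \<open>c > 0\<close>] by blast
  define \<kappa> where "\<kappa> = c * exp (-3) / 16"
  define E where "E = 96 * (1 + 1 / \<eta>\<^sup>2)"
  have pos: "\<kappa> > 0" "E > 0" using assms(4,5) by (simp_all add: \<kappa>_def E_def add_pos_nonneg)
  define T where "T = max 1 (E * (2 * C) * 2 / \<kappa>)"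
  have T: "T \<ge> 1" "E * (2 * C) * 2 / \<kappa> \<le> T" by (simp_all add: T_def)
  have "eventually (\<lambda>x. \<exists>\<sigma>. 1 < \<sigma> \<and> \<sigma> \<le> 2 \<and> fejer_mean a T \<sigma> x \<ge> \<kappa>) at_top"
    unfolding \<kappa>_def using a(1,3) \<open>c > 0\<close> T(1) by (rule fejer_mean_eventually_ge)
  then show ?thesis
  proof (rule eventually_mono)
    fix x assume "\<exists>\<sigma>. 1 < \<sigma> \<and> \<sigma> \<le> 2 \<and> fejer_mean a T \<sigma> x \<ge> \<kappa>"
    then obtain \<sigma> where \<sigma>: "1 < \<sigma>" "\<sigma> \<le> 2" "fejer_mean a T \<sigma> x \<ge> \<kappa>" by blast
    show "\<exists>n. a n > 0 \<and> \<bar>ln (real n) - x\<bar> \<le> \<eta>"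
    proof (rule ccontr)
      assume "\<not> (\<exists>n. a n > 0 \<and> \<bar>ln (real n) - x\<bar> \<le> \<eta>)"
      then have "fejer_mean a T \<sigma> x \<le> E / T * (fejer_mean a 1 \<sigma> x + fejer_mean a 1 \<sigma> (x - 1))"
        unfolding E_def using a(2) T(1) \<sigma>(1) assms(5)
        by (intro fejer_mean_le_if_gap a) (auto simp: order.order_iff_strict)
      also have "\<dots> \<le> E / T * (2 * C)"
        using C(2)[OF \<sigma>(1,2), of x] C(2)[OF \<sigma>(1,2), of "x - 1"] pos T(1)
        by (intro mult_left_mono) auto
      also have "\<dots> \<le> \<kappa> / 2" using pos T by (simp add: field_simps)
      finally show False using \<sigma>(3) pos(1) by linarith
    qed
  qed
qed

section \<open>Dirichlet convolution and Landau's theorem\<close>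

definition dirichlet_prod :: "(nat \<Rightarrow> real) \<Rightarrow> (nat \<Rightarrow> real) \<Rightarrow> nat \<Rightarrow> real" where
  "dirichlet_prod a b n = (\<Sum>d | d dvd n. a d * b (n div d))"

lemma has_sum_divisor_sums:
  fixes F :: "nat \<Rightarrow> nat \<Rightarrow> 'a :: banach"
  assumes "((\<lambda>(m, n). F m n) has_sum S) ({0<..} \<times> {0<..})"
  shows "((\<lambda>k. \<Sum>d | d dvd k. F d (k div d)) has_sum S) {0<..}"
proof -
  have "((\<lambda>(k, d). F d (k div d)) has_sum S) (Sigma {0<..} (\<lambda>k. {d. d dvd k}))
      \<longleftrightarrow> ((\<lambda>(m, n). F m n) has_sum S) ({0<..} \<times> {0<..})"
    by (rule has_sum_reindex_bij_witness[of _ "\<lambda>(m, n). (m * n, m)" "\<lambda>(k, d). (d, k div d)"])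
       (auto simp: dvd_pos_nat elim!: dvdE)
  then have "((\<lambda>(k, d). F d (k div d)) has_sum S) (Sigma {0<..} (\<lambda>k. {d. d dvd k}))"
    using assms by simp
  then show ?thesis
    by (rule has_sum_SigmaD) (auto intro!: has_sum_finite)
qed

lemma has_sum_mult_Times:
  fixes u :: "'b \<Rightarrow> 'a :: {real_normed_field, banach, second_countable_topology}" and v :: "'c \<Rightarrow> 'a"
  assumes "(\<lambda>m. norm (u m)) summable_on A" "(\<lambda>n. norm (v n)) summable_on B"
    and "(u has_sum U) A" "(v has_sum V) B"
  shows "((\<lambda>(m, n). u m * v n) has_sum (U * V)) (A \<times> B)"
proof (rule has_sum_SigmaI)
  show "((\<lambda>n. case (m, n) of (m, n) \<Rightarrow> u m * v n) has_sum (u m * V)) B" for m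
    by (simp add: has_sum_cmult_right assms)
  show "((\<lambda>m. u m * V) has_sum U * V) A" by (intro has_sum_cmult_left assms)
  have "(\<lambda>z. norm (case z of (m, n) \<Rightarrow> u m * v n)) summable_on A \<times> B"
  proof (rule summable_on_SigmaI)
    show "((\<lambda>n. norm (case (m, n) of (m, n) \<Rightarrow> u m * v n))
        has_sum norm (u m) * infsum (\<lambda>n. norm (v n)) B) B" for m
      using has_sum_cmult_right[OF has_sum_infsum[OF assms(2)], of "norm (u m)"]
      by (simp add: norm_mult)
    show "(\<lambda>m. norm (u m) * infsum (\<lambda>n. norm (v n)) B) summable_on A"
      by (rule summable_on_cmult_left[OF assms(1)])
  qed simp
  then show "(\<lambda>(m, n). u m * v n) summable_on A \<times> B" by (rule Infinite_Sum.abs_summable_summable)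
qed

lemma dirichlet_term_mult:
  assumes "d dvd k"
  shows "(of_real (a d) * of_nat d powr s) * (of_real (b (k div d)) * of_nat (k div d) powr s)
     = (of_real (a d * b (k div d)) * of_nat k powr s :: complex)"
proof -
  obtain e where e: "k = d * e" using assms by (elim dvdE)
  have "(of_nat k :: complex) powr s = of_nat d powr s * of_nat e powr s"
    unfolding e of_nat_mult by (rule powr_times_real) auto
  then show ?thesis using e by (cases "d = 0") (simp_all add: mult_ac)
qed

lemma dirichlet_prod_has_sum:
  assumes a: "dirichlet_abs_conv a" and b: "dirichlet_abs_conv b" and s: "Re s > 1"
  shows "((\<lambda>n. of_real (dirichlet_prod a b n) * of_nat n powr (-s))
     has_sum (dirichlet_series a s * dirichlet_series b s)) UNIV"
proof -
  define u where
    "u a n = (of_real (a n) * of_nat n powr (-s) :: complex)" for a :: "nat \<Rightarrow> real" and n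
  have u_has_sum: "(u a has_sum dirichlet_series a s) {0<..}"
      "(\<lambda>n. norm (u a n)) summable_on {0<..}"
    if a: "dirichlet_abs_conv a" for a
  proof -
    have "(u a has_sum dirichlet_series a s) UNIV"
      unfolding u_def
      by (intro norm_summable_imp_has_sum summable_norm_dirichlet_terms dirichlet_series_sums a s)
    then show "(u a has_sum dirichlet_series a s) {0<..}"
      by (rule has_sum_cong_neutral[THEN iffD1, rotated 3]) (auto simp: u_def)
    have "(\<lambda>n. norm (u a n)) summable_on UNIV"
      unfolding u_def using summable_norm_dirichlet_terms[OF a s]
      by (subst summable_on_UNIV_nonneg_real_iff) auto
    then show "(\<lambda>n. norm (u a n)) summable_on {0<..}" by (rule summable_on_subset) auto
  qed
  have "((\<lambda>k. \<Sum>d | d dvd k. u a d * u b (k div d))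
      has_sum (dirichlet_series a s * dirichlet_series b s)) {0<..}"
    by (intro has_sum_divisor_sums has_sum_mult_Times u_has_sum a b)
  moreover have "(\<Sum>d | d dvd k. u a d * u b (k div d))
      = of_real (dirichlet_prod a b k) * of_nat k powr (-s)" for k
    by (simp add: u_def dirichlet_term_mult dirichlet_prod_def sum_distrib_right of_real_sum
        del: of_real_mult)
  ultimately show ?thesis
    by (subst has_sum_cong_neutral[where T = "{0<..}"]) auto
qed

lemma dirichlet_series_dirichlet_prod:
  assumes "dirichlet_abs_conv a" "dirichlet_abs_conv b" "Re s > 1"
  shows "dirichlet_series (dirichlet_prod a b) s = dirichlet_series a s * dirichlet_series b s"
  using has_sum_imp_sums[OF dirichlet_prod_has_sum[OF assms]]
  by (simp add: dirichlet_series_def sums_iff)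

lemma dirichlet_abs_conv_dirichlet_prod:
  assumes "dirichlet_abs_conv a" "dirichlet_abs_conv b"
  shows "dirichlet_abs_conv (dirichlet_prod a b)"
  unfolding dirichlet_abs_conv_def
proof (intro allI impI)
  fix \<sigma> :: real assume "\<sigma> > 1"
  then have "(\<lambda>n. of_real (dirichlet_prod a b n) * of_nat n powr (- of_real \<sigma>) :: complex)
      summable_on UNIV"
    using dirichlet_prod_has_sum[OF assms, of "of_real \<sigma>"] by (auto simp: summable_on_def)
  then have "(\<lambda>n. norm (of_real (dirichlet_prod a b n) * of_nat n powr (- of_real \<sigma>) :: complex))
      summable_on UNIV"
    by (simp only: summable_on_iff_abs_summable_on_complex)
  then show "summable (\<lambda>n. \<bar>dirichlet_prod a b n\<bar> * real n powr (-\<sigma>))"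
    unfolding norm_dirichlet_term by (auto dest: summable_on_imp_summable)
qed

lemma dirichlet_series_of_real:
  assumes "dirichlet_abs_conv a" "\<sigma> > 1"
  shows "(\<lambda>n. a n * real n powr (-\<sigma>)) sums Re (dirichlet_series a (of_real \<sigma>))"
    and "dirichlet_series a (of_real \<sigma>) \<in> \<real>"
proof -
  have real_term: "of_real (a n * real n powr (-\<sigma>))
      = (of_real (a n) * of_nat n powr (- of_real \<sigma>) :: complex)" for n
    using powr_of_real[of "real n" "-\<sigma>"] by simp
  have sums: "(\<lambda>n. of_real (a n * real n powr (-\<sigma>))) sums dirichlet_series a (of_real \<sigma>)"
    unfolding real_term by (rule dirichlet_series_sums[OF assms(1)]) (use assms(2) in simp)
  show "(\<lambda>n. a n * real n powr (-\<sigma>)) sums Re (dirichlet_series a (of_real \<sigma>))"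
    using sums_Re[OF sums] by simp
  then have "(\<lambda>n. of_real (a n * real n powr (-\<sigma>)) :: complex)
      sums of_real (Re (dirichlet_series a (of_real \<sigma>)))"
    by (simp only: sums_of_real_iff)
  then show "dirichlet_series a (of_real \<sigma>) \<in> \<real>"
    using sums sums_unique2 by (metis Reals_of_real)
qed

lemma dirichlet_series_tendsto_first_coeff:
  assumes "dirichlet_abs_conv a"
  shows "((\<lambda>\<sigma>. dirichlet_series a (of_real \<sigma>)) \<longlongrightarrow> of_real (a 1)) at_top"
proof -
  define u where "u = (\<lambda>n \<sigma>. of_real (a n) * of_nat n powr (- of_real \<sigma>) :: complex)"
  have "eventually (\<lambda>\<sigma>. summable (\<lambda>n. norm (u n \<sigma>))) at_top \<and>
     summable (\<lambda>n. norm (if n = 1 then of_real (a n) else 0 :: complex)) \<and>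
     ((\<lambda>\<sigma>. suminf (\<lambda>n. u n \<sigma>)) \<longlongrightarrow> suminf (\<lambda>n. if n = 1 then of_real (a n) else 0)) at_top"
  proof (rule tannerys_theorem)
    fix n :: nat
    show "(u n \<longlongrightarrow> (if n = 1 then of_real (a n) else 0)) at_top"
    proof (cases "n \<ge> 2")
      case True
      then have "((\<lambda>\<sigma>. \<bar>a n\<bar> * real n powr (-\<sigma>)) \<longlongrightarrow> 0) at_top" by real_asymp
      then have "((\<lambda>\<sigma>. norm (u n \<sigma>)) \<longlongrightarrow> 0) at_top" by (simp add: u_def norm_dirichlet_term)
      then show ?thesis using True by (simp add: tendsto_norm_zero_iff)
    next
      case False
      then have "n = 0 \<or> n = 1" by linarith
      then show ?thesis by (auto simp: u_def)
    qed
  next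
    have "norm (u n \<sigma>) \<le> \<bar>a n\<bar> * real n powr (-2)" if "\<sigma> \<ge> 2" for n \<sigma>
      using that
      by (cases "n = 0") (auto simp: u_def norm_dirichlet_term intro!: mult_left_mono powr_mono)
    then show "eventually (\<lambda>(n, \<sigma>). norm (u n \<sigma>) \<le> \<bar>a n\<bar> * real n powr (-2)) (at_top \<times>\<^sub>F at_top)"
      by (auto simp: eventually_prod_filter eventually_at_top_linorder
          intro!: exI[of _ "\<lambda>_. True"] exI[of _ "\<lambda>\<sigma>. \<sigma> \<ge> 2"])
    show "summable (\<lambda>n. \<bar>a n\<bar> * real n powr (-2))" by (rule dirichlet_abs_convD[OF assms]) simp
  qed simp
  moreover have "suminf (\<lambda>n. if n = 1 then of_real (a n) else 0) = (of_real (a 1) :: complex)"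
    by (rule sums_unique[OF sums_single, symmetric])
  ultimately show ?thesis by (simp add: dirichlet_series_def u_def)
qed

lemma has_field_derivative_of_nat_powr_minus:
  "((\<lambda>s. of_nat n powr (-s)) has_field_derivative
      - (of_real (ln (real n)) * of_nat n powr (-s) :: complex)) (at s)"
proof (cases "n = 0")
  case False
  have "((\<lambda>s. exp (- s * of_real (ln (real n)))) has_field_derivative
      - (of_real (ln (real n)) * exp (- s * of_real (ln (real n))))) (at s)"
    by (auto intro!: derivative_eq_intros)
  with False show ?thesis by (simp add: powr_def Ln_of_nat)
qed simp

lemma Re_and_norm_in_ball:
  assumes "y \<in> ball s d"
  shows "Re y > Re s - d" "norm y < norm s + d"
proof -
  have "norm (y - s) < d" using assms by (simp add: dist_norm norm_minus_commute)
  then show "Re y > Re s - d" "norm y < norm s + d"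
    using abs_Re_le_cmod[of "y - s"] norm_triangle_ineq2[of y s] by auto
qed

lemma dirichlet_series_has_field_derivative:
  assumes "dirichlet_abs_conv a" "Re s > 1"
  shows "(dirichlet_series a has_field_derivative
      - dirichlet_series (\<lambda>n. a n * ln (real n)) s) (at s)"
proof -
  define S where "S = {s. Re s > 1}"
  have "open S" unfolding S_def by (rule open_halfspace_Re_gt)
  have "\<exists>g g'. \<forall>s\<in>S. ((\<lambda>n. of_real (a n) * of_nat n powr (-s)) sums g s)
      \<and> ((\<lambda>n. of_real (a n) * - (of_real (ln (real n)) * of_nat n powr (-s))) sums g' s)
      \<and> (g has_field_derivative g' s) (at s)"
  proof (rule series_and_derivative_comparison_local[OF \<open>open S\<close>])
    fix n :: nat and s :: complex
    show "((\<lambda>s. of_real (a n) * of_nat n powr (-s))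
        has_field_derivative of_real (a n) * - (of_real (ln (real n)) * of_nat n powr (-s))) (at s)"
      by (intro DERIV_cmult has_field_derivative_of_nat_powr_minus)
  next
    fix s assume s: "s \<in> S"
    define d where "d = (Re s - 1) / 2"
    have d: "d > 0" "1 + d > 1" using s by (simp_all add: d_def S_def)
    have "norm (of_real (a n) * of_nat n powr (-y) :: complex) \<le> \<bar>a n\<bar> * real n powr (-(1 + d))"
      if "y \<in> ball s d" for y n
    proof -
      have "Re y \<ge> 1 + d" using Re_and_norm_in_ball(1)[OF that] by (simp add: d_def field_simps)
      then show ?thesis
        by (cases "n = 0") (auto simp: norm_dirichlet_term intro!: mult_left_mono powr_mono)
    qed
    then show "\<exists>d h. 0 < d \<and> summable h \<and> (\<forall>\<^sub>F n in sequentially. \<forall>y\<in>ball s d \<inter> S.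
        norm (of_real (a n) * of_nat n powr (-y) :: complex) \<le> h n)"
      using d dirichlet_abs_convD[OF assms(1) d(2)]
      by (intro exI[of _ d] exI[of _ "\<lambda>n. \<bar>a n\<bar> * real n powr (-(1 + d))"]) auto
  qed
  then obtain g g' where g: "\<And>s. s \<in> S \<Longrightarrow> (\<lambda>n. of_real (a n) * of_nat n powr (-s)) sums g s"
      "\<And>s. s \<in> S \<Longrightarrow> (\<lambda>n. of_real (a n) * - (of_real (ln (real n)) * of_nat n powr (-s))) sums g' s"
      "\<And>s. s \<in> S \<Longrightarrow> (g has_field_derivative g' s) (at s)" by blast
  have "s \<in> S" using assms by (simp add: S_def)
  have "g' s = - dirichlet_series (\<lambda>n. a n * ln (real n)) s"
    using sums_minus[OF g(2)[OF \<open>s \<in> S\<close>]] by (simp add: dirichlet_series_def sums_iff mult.assoc)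
  moreover have "(dirichlet_series a has_field_derivative g' s) (at s)"
    by (rule has_field_derivative_transform_within_open[OF g(3)[OF \<open>s \<in> S\<close>] \<open>open S\<close> \<open>s \<in> S\<close>])
       (use g(1) in \<open>auto simp: dirichlet_series_def sums_iff\<close>)
  ultimately show ?thesis by simp
qed

lemma dirichlet_abs_conv_mult_ln_power:
  "dirichlet_abs_conv a \<Longrightarrow> dirichlet_abs_conv (\<lambda>n. a n * ln (real n) ^ k)"
proof (induction k)
  case (Suc k)
  then show ?case
    using dirichlet_abs_conv_mult_ln[of "\<lambda>n. a n * ln (real n) ^ k"] by (simp add: mult_ac)
qed simp

lemma higher_deriv_dirichlet_series:
  assumes "dirichlet_abs_conv a" "Re s > 1"
  shows "(deriv ^^ k) (dirichlet_series a) s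
      = (-1) ^ k * dirichlet_series (\<lambda>n. a n * ln (real n) ^ k) s"
  using assms(2)
proof (induction k arbitrary: s)
  case (Suc k)
  define b where "b = (\<lambda>n. a n * ln (real n) ^ k)"
  have b: "dirichlet_abs_conv b"
    unfolding b_def by (rule dirichlet_abs_conv_mult_ln_power[OF assms(1)])
  have "eventually (\<lambda>z. z \<in> {z. Re z > 1}) (nhds s)"
    using Suc.prems open_halfspace_Re_gt[of 1] by (intro eventually_nhds_in_open) auto
  then have "eventually (\<lambda>z. (deriv ^^ k) (dirichlet_series a) z
      = (-1) ^ k * dirichlet_series b z) (nhds s)"
    by eventually_elim (use Suc.IH in \<open>simp add: b_def\<close>)
  then have "(deriv ^^ Suc k) (dirichlet_series a) s
      = deriv (\<lambda>z. (-1) ^ k * dirichlet_series b z) s"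
    by (simp add: deriv_cong_ev)
  also have "\<dots> = (-1) ^ k * - dirichlet_series (\<lambda>n. b n * ln (real n)) s"
    by (intro DERIV_imp_deriv DERIV_cmult dirichlet_series_has_field_derivative b Suc.prems)
  finally show ?case by (simp add: b_def mult_ac)
qed simp

lemma Taylor_sums_of_dirichlet_extension:
  assumes a: "dirichlet_abs_conv a"
    and h: "h holomorphic_on {s. Re s > c}" "\<And>s. Re s > 1 \<Longrightarrow> h s = dirichlet_series a s"
    and \<sigma>: "c < \<sigma>" "\<sigma> < 2"
  shows "summable (\<lambda>k. (2 - \<sigma>) ^ k / fact k
      * suminf (\<lambda>n. a n * ln (real n) ^ k * real n powr (-2)))"
proof -
  have half_plane: "open {s. Re s > 1}" by (rule open_halfspace_Re_gt)
  have "ball 2 (2 - c) \<subseteq> {s. Re s > c}"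
  proof
    fix s :: complex assume "s \<in> ball 2 (2 - c)"
    then have "\<bar>2 - Re s\<bar> < 2 - c" using abs_Re_le_cmod[of "2 - s"] by (simp add: dist_norm)
    then show "s \<in> {s. Re s > c}" by simp
  qed
  moreover have "dist (2 :: complex) (of_real \<sigma>) = \<bar>2 - \<sigma>\<bar>"
    using dist_of_real[of 2 \<sigma>, where ?'a = complex] by (simp add: dist_real_def)
  ultimately have "(\<lambda>k. (deriv ^^ k) h 2 / fact k * (of_real \<sigma> - 2) ^ k) sums h (of_real \<sigma>)"
    using \<sigma> by (intro holomorphic_power_series[OF holomorphic_on_subset[OF h(1)]]) auto
  moreover have "(deriv ^^ k) h 2 / fact k * (of_real \<sigma> - 2) ^ k
      = of_real ((2 - \<sigma>) ^ k / fact k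
          * suminf (\<lambda>n. a n * ln (real n) ^ k * real n powr (-2)))" for k
  proof -
    define b where "b = (\<lambda>n. a n * ln (real n) ^ k)"
    have b: "dirichlet_abs_conv b" unfolding b_def by (rule dirichlet_abs_conv_mult_ln_power[OF a])
    have "(deriv ^^ k) h 2 = (deriv ^^ k) (dirichlet_series a) 2"
      using h(2) half_plane
      by (intro higher_deriv_cong_ev eventually_nhds_in_open[THEN eventually_mono]) auto
    also have "\<dots> = (-1) ^ k * dirichlet_series b 2"
      unfolding b_def by (rule higher_deriv_dirichlet_series[OF a]) simp
    also have "dirichlet_series b 2 = of_real (suminf (\<lambda>n. b n * real n powr (-2)))"
      using dirichlet_series_of_real[OF b, of 2] by (simp add: sums_iff)
    finally have "(deriv ^^ k) h 2 = (-1) ^ k * of_real (suminf (\<lambda>n. b n * real n powr (-2)))" .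
    moreover have "(-1) ^ k * (of_real \<sigma> - 2 :: complex) ^ k = of_real ((2 - \<sigma>) ^ k)"
      by (simp flip: power_mult_distrib)
    ultimately show ?thesis by (simp add: b_def mult_ac)
  qed
  ultimately show ?thesis by (simp only: sums_iff summable_complex_of_real)
qed

text \<open>Landau's theorem. Expand the extension around \<open>2\<close>, where its Taylor coefficients are
  Dirichlet series with nonnegative terms; interchanging the two summations gives the series at \<open>\<sigma>\<close>.\<close>

theorem summable_nonneg_dirichlet_series_if_extends:
  assumes a: "dirichlet_abs_conv a" "\<And>n. a n \<ge> 0"
    and h: "h holomorphic_on {s. Re s > c}" "\<And>s. Re s > 1 \<Longrightarrow> h s = dirichlet_series a s"
    and \<sigma>: "c < \<sigma>" "\<sigma> < 2"
  shows "summable (\<lambda>n. a n * real n powr (-\<sigma>))"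
proof -
  define t where "t k n = (2 - \<sigma>) ^ k / fact k * (a n * ln (real n) ^ k * real n powr (-2))" for k n
  have ln_nonneg: "ln (real n) \<ge> 0" for n by (cases "n = 0") simp_all
  have t_nonneg: "t k n \<ge> 0" for k n
    using \<sigma> a(2)[of n] ln_nonneg[of n] by (simp add: t_def)
  have t_sums: "t k sums ((2 - \<sigma>) ^ k / fact k
      * suminf (\<lambda>n. a n * ln (real n) ^ k * real n powr (-2)))" for k
    using dirichlet_abs_convD[OF dirichlet_abs_conv_mult_ln_power[OF a(1), of k], of 2]
      a(2) ln_nonneg
    unfolding t_def by (intro sums_mult summable_sums) (simp add: abs_mult)
  have "(\<lambda>k. suminf (t k)) summable_on UNIV"
  proof (subst summable_on_UNIV_nonneg_real_iff)
    show "suminf (t k) \<ge> 0" for k by (rule suminf_nonneg[OF sums_summable[OF t_sums] t_nonneg])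
    show "summable (\<lambda>k. suminf (t k))"
      using Taylor_sums_of_dirichlet_extension[OF a(1) h \<sigma>] t_sums by (simp add: sums_iff)
  qed
  moreover have "((\<lambda>n. t k n) has_sum suminf (t k)) UNIV" for k
    using t_sums[of k] t_nonneg by (intro sums_nonneg_imp_has_sum) (auto simp: sums_iff)
  ultimately have "(\<lambda>(k, n). t k n) summable_on UNIV \<times> UNIV"
    by (intro summable_on_SigmaI) (auto simp: t_nonneg)
  then obtain S where "((\<lambda>(n, k). t k n) has_sum S) (UNIV \<times> UNIV)"
    by (subst (asm) summable_on_swap) (auto simp: summable_on_def)
  moreover have "((\<lambda>k. t k n) has_sum (a n * real n powr (-\<sigma>))) UNIV" for n
  proof (rule sums_nonneg_imp_has_sum)
    have "(\<lambda>k. ((2 - \<sigma>) * ln (real n)) ^ k /\<^sub>R fact k) sums exp ((2 - \<sigma>) * ln (real n))"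
      by (rule exp_converges)
    from sums_mult[OF this, of "a n * real n powr (-2)"]
    have "(\<lambda>k. t k n) sums (a n * real n powr (-2) * exp ((2 - \<sigma>) * ln (real n)))"
      by (simp add: t_def power_mult_distrib divide_inverse mult_ac)
    moreover have "a n * real n powr (-2) * exp ((2 - \<sigma>) * ln (real n)) = a n * real n powr (-\<sigma>)"
      by (cases "n = 0") (simp_all add: powr_def algebra_simps flip: exp_add)
    ultimately show "(\<lambda>k. t k n) sums (a n * real n powr (-\<sigma>))" by simp
  qed (rule t_nonneg)
  ultimately have "((\<lambda>n. a n * real n powr (-\<sigma>)) has_sum S) UNIV"
    by - (rule has_sum_SigmaD[where f = "\<lambda>(n, k). t k n" and B = "\<lambda>_. UNIV"], auto)
  then show ?thesis by (intro sums_summable has_sum_imp_sums)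
qed

section \<open>Analytic continuation to the half plane \<open>Re s > 0\<close>\<close>

lemma norm_powr_minus_diff_le:
  fixes s :: complex and x y :: real
  assumes x: "0 < x" "x \<le> y" and s: "Re s > -1"
  shows "norm (of_real x powr (-s) - of_real y powr (-s)) \<le> norm s * (y - x) * x powr (- Re s - 1)"
proof -
  let ?I = "closed_segment (of_real x) (of_real y) :: complex set"
  have "norm (of_real x powr (-s) - of_real y powr (-s))
      \<le> (norm s * x powr (- Re s - 1)) * norm (of_real x - of_real y :: complex)"
  proof (rule field_differentiable_bound[where S = ?I
        and f = "\<lambda>z. z powr (-s)" and f' = "\<lambda>z. (-s) * z powr (-s - 1)"])
    fix z assume "z \<in> ?I"
    then obtain u where u: "z = of_real u" "u \<in> {x..y}"
      using x unfolding closed_segment_of_real closed_segment_eq_real_ivl by auto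
    have "z \<notin> \<real>\<^sub>\<le>\<^sub>0" using u x by (auto simp: complex_nonpos_Reals_iff)
    then show "((\<lambda>z. z powr (-s)) has_field_derivative (-s) * z powr (-s - 1)) (at z within ?I)"
      by (rule has_field_derivative_at_within[OF has_field_derivative_powr])
    have "norm ((-s) * z powr (-s - 1)) = norm s * u powr (- Re s - 1)"
      unfolding norm_mult norm_minus_cancel u(1) using u(2) x by (simp add: norm_powr_real_powr)
    also have "\<dots> \<le> norm s * x powr (- Re s - 1)"
      using u(2) x s by (intro mult_left_mono powr_mono2') auto
    finally show "norm ((-s) * z powr (-s - 1)) \<le> norm s * x powr (- Re s - 1)" .
  qed auto
  also have "norm (of_real x - of_real y :: complex) = y - x"
    using x unfolding of_real_diff[symmetric] norm_of_real by simp
  finally show ?thesis by (simp only: mult_ac)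
qed

lemma holomorphic_series_half_plane:
  fixes f :: "nat \<Rightarrow> complex \<Rightarrow> complex"
  assumes hol: "\<And>k. f k holomorphic_on UNIV"
    and bound: "\<And>k s. k \<ge> 1 \<Longrightarrow> Re s > 0
        \<Longrightarrow> norm (f k s) \<le> C * (norm s + 1)\<^sup>2 * real k powr (- Re s - 1)"
    and "C \<ge> 0"
  obtains F where "F holomorphic_on {s. Re s > 0}" "\<And>s. Re s > 0 \<Longrightarrow> (\<lambda>k. f k s) sums F s"
proof -
  define S where "S = {s. Re s > 0}"
  have "open S" unfolding S_def by (rule open_halfspace_Re_gt)
  obtain F where F: "\<forall>s\<in>S. (\<lambda>k. f k s) sums F s \<and> F field_differentiable (at s)"
  proof (rule series_differentiable_comparison_complex[OF \<open>open S\<close>])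
    show "f k field_differentiable (at s)" for k s
      using hol[of k] by (simp add: holomorphic_on_def)
    fix s assume "s \<in> S"
    define d where "d = Re s / 2"
    define h where "h k = C * (norm s + d + 1)\<^sup>2 * real k powr (- d - 1)" for k
    have d: "d > 0" using \<open>s \<in> S\<close> by (simp add: d_def S_def)
    have h_nonneg: "h k \<ge> 0" for k using \<open>C \<ge> 0\<close> by (simp add: h_def)
    have "norm (f k y) \<le> h k" if y: "y \<in> ball s d" and "k \<ge> 1" for y k
    proof -
      have "Re y > d" using Re_and_norm_in_ball(1)[OF y] by (simp add: d_def)
      have "C * (norm y + 1)\<^sup>2 * real k powr (- Re y - 1) \<le> h k"
        unfolding h_def using \<open>C \<ge> 0\<close> \<open>k \<ge> 1\<close> \<open>Re y > d\<close> Re_and_norm_in_ball(2)[OF y]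
        by (intro mult_mono mult_nonneg_nonneg power_mono powr_mono) auto
      then show ?thesis using bound[OF \<open>k \<ge> 1\<close>, of y] \<open>Re y > d\<close> d by linarith
    qed
    then have "\<forall>\<^sub>F k in sequentially. \<forall>y\<in>ball s d \<inter> S. norm (f k y)
        \<le> norm (of_real (h k) :: complex)"
      using h_nonneg by (intro eventually_sequentiallyI[of 1]) auto
    moreover have "summable (\<lambda>k. of_real (h k) :: complex)"
      unfolding h_def summable_complex_of_real using d
      by (intro summable_mult) (simp add: summable_real_powr_iff)
    ultimately show "\<exists>d h. 0 < d \<and> summable h \<and> range h \<subseteq> (\<real>\<^sub>\<ge>\<^sub>0 :: complex set) \<and>
        (\<forall>\<^sub>F k in sequentially. \<forall>y\<in>ball s d \<inter> S. norm (f k y) \<le> norm (h k))"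
      using d h_nonneg by (intro exI[of _ d] exI[of _ "\<lambda>k. complex_of_real (h k)"]) auto
  qed
  then have "F holomorphic_on {s. Re s > 0}"
    using \<open>open S\<close> by (simp add: S_def holomorphic_on_def field_differentiable_at_within)
  then show ?thesis using F that[of F] by (simp add: S_def)
qed

lemma tendsto_of_nat_powr_minus:
  assumes "Re s > 0"
  shows "(\<lambda>n. of_nat n powr (-s) :: complex) \<longlonglongrightarrow> 0"
proof (rule tendsto_norm_zero_cancel)
  have "(\<lambda>n. real n powr (- Re s)) \<longlonglongrightarrow> 0"
    using assms by (intro tendsto_neg_powr filterlim_real_sequentially) auto
  then show "(\<lambda>n. norm (of_nat n powr (-s) :: complex)) \<longlonglongrightarrow> 0"
    by (simp add: norm_powr_real_powr)
qed

lemma summation_by_parts: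
  fixes b c :: "nat \<Rightarrow> 'a :: comm_ring"
  shows "(\<Sum>n<N. b n * c n) = (\<Sum>n<N. b n) * c N + (\<Sum>k<N. (\<Sum>n<Suc k. b n) * (c k - c (Suc k)))"
  by (induction N) (simp_all add: algebra_simps)

lemma dirichlet_series_extends_if_bounded_partial_sums:
  assumes b: "dirichlet_abs_conv b" and bounded: "\<And>N. \<bar>\<Sum>n<N. b n\<bar> \<le> C"
  obtains K where "K holomorphic_on {s. Re s > 0}" "\<And>s. Re s > 1 \<Longrightarrow> dirichlet_series b s = K s"
proof -
  define P where "P N = (\<Sum>n<N. of_real (b n) :: complex)" for N
  define f where "f k s = P (Suc k) * (of_nat k powr (-s) - of_nat (Suc k) powr (-s))" for k s
  have P: "norm (P N) \<le> C" for N
    unfolding P_def of_real_sum[symmetric] norm_of_real by (rule bounded)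
  then have "C \<ge> 0" using norm_ge_zero order_trans by blast
  have bound: "norm (f k s) \<le> C * (norm s + 1)\<^sup>2 * real k powr (- Re s - 1)"
      if k: "k \<ge> 1" and s: "Re s > 0" for k s
  proof -
    have "norm (of_real (real k) powr (-s) - of_real (real (Suc k)) powr (-s) :: complex)
        \<le> norm s * (real (Suc k) - real k) * real k powr (- Re s - 1)"
      using k s by (intro norm_powr_minus_diff_le) auto
    also have "\<dots> \<le> (norm s + 1)\<^sup>2 * real k powr (- Re s - 1)"
      by (intro mult_right_mono) (auto simp: power2_eq_square algebra_simps)
    finally show ?thesis
      unfolding f_def norm_mult of_real_of_nat_eq mult.assoc using P \<open>C \<ge> 0\<close>
      by (intro mult_mono) auto
  qed
  have "f k holomorphic_on UNIV" for k unfolding f_def by (intro holomorphic_intros)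
  then obtain K where K: "K holomorphic_on {s. Re s > 0}" "\<And>s. Re s > 0 \<Longrightarrow> (\<lambda>k. f k s) sums K s"
    using holomorphic_series_half_plane[OF _ bound \<open>C \<ge> 0\<close>] by blast
  have "dirichlet_series b s = K s" if s: "Re s > 1" for s
  proof -
    have "(\<lambda>N. P N * of_nat N powr (-s)) \<longlonglongrightarrow> 0"
    proof (rule Lim_null_comparison)
      show "\<forall>\<^sub>F N in sequentially. norm (P N * of_nat N powr (-s))
          \<le> C * norm (of_nat N powr (-s) :: complex)"
        using P by (simp add: norm_mult mult_right_mono)
      show "(\<lambda>N. C * norm (of_nat N powr (-s) :: complex)) \<longlonglongrightarrow> 0"
        using tendsto_of_nat_powr_minus[of s] s
        by (intro tendsto_mult_right_zero tendsto_norm_zero) simp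
    qed
    then have "(\<lambda>N. P N * of_nat N powr (-s) + (\<Sum>k<N. f k s)) \<longlonglongrightarrow> 0 + K s"
      using K(2)[of s] s by (intro tendsto_add) (simp_all add: sums_def)
    then have "(\<lambda>n. of_real (b n) * of_nat n powr (-s)) sums K s"
      by (simp add: sums_def summation_by_parts[of "\<lambda>n. of_real (b n)"] P_def f_def)
    then show ?thesis by (simp add: dirichlet_series_def sums_iff)
  qed
  with K(1) show ?thesis by (rule that)
qed

lemma norm_zeta_term_le:
  fixes s :: complex and x :: real
  assumes x: "0 < x" and s: "Re s > 0"
  shows "norm
        ((s - 1) * of_real x powr (-s) - of_real x powr (1 - s) + of_real (x + 1) powr (1 - s))
     \<le> norm (s - 1) * norm s * x powr (- Re s - 1)"
proof -
  let ?I = "closed_segment (of_real x) (of_real (x + 1)) :: complex set"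
  define \<phi> where "\<phi> z = (s - 1) * z * of_real x powr (-s) + z powr (1 - s)" for z
  have "norm (\<phi> (of_real (x + 1)) - \<phi> (of_real x))
      \<le> (norm (s - 1) * norm s * x powr (- Re s - 1))
          * norm (of_real (x + 1) - of_real x :: complex)"
  proof (rule field_differentiable_bound[where S = ?I
        and f' = "\<lambda>z. (s - 1) * (of_real x powr (-s) - z powr (-s))"])
    fix z assume "z \<in> ?I"
    then obtain u where u: "z = of_real u" "u \<in> {x..x + 1}"
      unfolding closed_segment_of_real closed_segment_eq_real_ivl by auto
    have "z \<notin> \<real>\<^sub>\<le>\<^sub>0" using u x by (auto simp: complex_nonpos_Reals_iff)
    then have "((\<lambda>z. z powr (1 - s)) has_field_derivative (1 - s) * z powr (1 - s - 1)) (at z)"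
      by (rule has_field_derivative_powr)
    moreover have "1 - s - 1 = -s" by simp
    ultimately have "(\<phi> has_field_derivative
        ((s - 1) * of_real x powr (-s) + (1 - s) * z powr (-s))) (at z)"
      unfolding \<phi>_def by (intro DERIV_add) (auto intro!: derivative_eq_intros)
    moreover have "(s - 1) * of_real x powr (-s) + (1 - s) * z powr (-s)
        = (s - 1) * (of_real x powr (-s) - z powr (-s))"
      by (simp add: algebra_simps)
    ultimately show "(\<phi> has_field_derivative (s - 1) * (of_real x powr (-s) - z powr (-s)))
        (at z within ?I)"
      by (metis has_field_derivative_at_within)
    have "norm (of_real x powr (-s) - z powr (-s)) \<le> norm s * (u - x) * x powr (- Re s - 1)"
      unfolding u(1) using u(2) x s by (intro norm_powr_minus_diff_le) auto
    also have "\<dots> \<le> norm s * 1 * x powr (- Re s - 1)"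
      using u(2) by (intro mult_right_mono mult_left_mono) auto
    finally show "norm ((s - 1) * (of_real x powr (-s) - z powr (-s)))
        \<le> norm (s - 1) * norm s * x powr (- Re s - 1)"
      by (simp add: norm_mult mult_left_mono mult.assoc)
  qed auto
  then show ?thesis by (simp add: \<phi>_def algebra_simps)
qed

lemma zeta_terms_sums:
  assumes "Re s > 1"
  shows "(\<lambda>k. (s - 1) * of_nat (Suc k) powr (-s)
        - of_nat (Suc k) powr (1 - s) + of_nat (Suc (Suc k)) powr (1 - s))
     sums ((s - 1) * dirichlet_series (\<lambda>_. 1) s - 1)"
proof -
  have "(\<lambda>k. of_nat k powr (-s)) sums dirichlet_series (\<lambda>_. 1) s"
    using dirichlet_series_sums[OF dirichlet_abs_conv_const assms, of 1] by simp
  from sums_split_initial_segment[OF this, of 1]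
  have "(\<lambda>k. of_nat (Suc k) powr (-s)) sums dirichlet_series (\<lambda>_. 1) s" by simp
  moreover have "(\<lambda>k. of_nat (Suc k) powr (1 - s) :: complex) \<longlonglongrightarrow> 0"
    using LIMSEQ_Suc[OF tendsto_of_nat_powr_minus[of "s - 1"]] assms by simp
  then have "(\<lambda>k. of_nat (Suc k) powr (1 - s) - of_nat (Suc (Suc k)) powr (1 - s) :: complex)
      sums 1"
    using telescope_sums' by fastforce
  ultimately have "(\<lambda>k. (s - 1) * of_nat (Suc k) powr (-s)
      - (of_nat (Suc k) powr (1 - s) - of_nat (Suc (Suc k)) powr (1 - s)))
      sums ((s - 1) * dirichlet_series (\<lambda>_. 1) s - 1)"
    by (intro sums_diff sums_mult)
  then show ?thesis by (simp only: diff_diff_eq2 diff_add_eq)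
qed

lemma zeta_extends:
  obtains W where "W holomorphic_on {s. Re s > 0}" "W 1 = 1"
    and "\<And>s. Re s > 1 \<Longrightarrow> (s - 1) * dirichlet_series (\<lambda>_. 1) s = W s"
proof -
  define f :: "nat \<Rightarrow> complex \<Rightarrow> complex" where "f k s = (if k = 0 then 0
      else (s - 1) * of_nat k powr (-s) - of_nat k powr (1 - s) + of_nat (Suc k)
          powr (1 - s))" for k s
  have bound: "norm (f k s) \<le> 1 * (norm s + 1)\<^sup>2 * real k powr (- Re s - 1)"
    if "k \<ge> 1" "Re s > 0" for k s
  proof -
    have "norm (f k s) \<le> norm (s - 1) * norm s * real k powr (- Re s - 1)"
      using norm_zeta_term_le[of "real k" s] that by (simp add: f_def add.commute)
    also have "\<dots> \<le> (norm s + 1)\<^sup>2 * real k powr (- Re s - 1)"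
      unfolding power2_eq_square using norm_triangle_ineq4[of s 1]
      by (intro mult_right_mono mult_mono) auto
    finally show ?thesis by simp
  qed
  have "f k holomorphic_on UNIV" for k
    unfolding f_def by (cases "k = 0") (auto intro!: holomorphic_intros)
  then obtain F where F: "F holomorphic_on {s. Re s > 0}" "\<And>s. Re s > 0 \<Longrightarrow> (\<lambda>k. f k s) sums F s"
    using holomorphic_series_half_plane[OF _ bound zero_le_one] by blast
  show ?thesis
  proof (rule that[of "\<lambda>s. 1 + F s"])
    show "(\<lambda>s. 1 + F s) holomorphic_on {s. Re s > 0}" by (intro holomorphic_intros F)
    have "f k 1 = 0" for k by (simp add: f_def powr_def del: of_nat_Suc)
    then have "(\<lambda>k. f k 1) sums 0" by simp
    then show "1 + F 1 = 1" using F(2)[of 1] sums_unique2 by fastforce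
    fix s assume s: "Re s > 1"
    have "(\<lambda>k. f (Suc k) s) sums F s"
      using sums_split_initial_segment[OF F(2), of s 1] s by (simp add: f_def)
    then have "(s - 1) * dirichlet_series (\<lambda>_. 1) s - 1 = F s"
      using zeta_terms_sums[OF s] by (intro sums_unique2) (auto simp: f_def simp del: of_nat_Suc)
    then show "(s - 1) * dirichlet_series (\<lambda>_. 1) s = 1 + F s" by (simp add: algebra_simps)
  qed
qed

definition difference_quotient :: "(complex \<Rightarrow> complex) \<Rightarrow> complex \<Rightarrow> complex \<Rightarrow> complex" where
  "difference_quotient h a z = (if z = a then deriv h a else (h z - h a) / (z - a))"

lemma holomorphic_difference_quotient:
  "h holomorphic_on S \<Longrightarrow> open S \<Longrightarrow> difference_quotient h a holomorphic_on S"
  unfolding difference_quotient_def[abs_def] by (rule pole_lemma_open)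

lemma zeta_eq_pole_plus_holomorphic:
  obtains R where "R holomorphic_on {s. Re s > 0}"
    and "\<And>s. Re s > 1 \<Longrightarrow> dirichlet_series (\<lambda>_. 1) s = R s + 1 / (s - 1)"
proof -
  obtain W where W: "W holomorphic_on {s. Re s > 0}" "W 1 = 1"
      "\<And>s. Re s > 1 \<Longrightarrow> (s - 1) * dirichlet_series (\<lambda>_. 1) s = W s"
    using zeta_extends by blast
  show ?thesis
  proof (rule that)
    show "difference_quotient W 1 holomorphic_on {s. Re s > 0}"
      by (rule holomorphic_difference_quotient[OF W(1) open_halfspace_Re_gt])
    fix s :: complex assume s: "Re s > 1"
    then have "s - 1 \<noteq> 0" by auto
    then show "dirichlet_series (\<lambda>_. 1) s = difference_quotient W 1 s + 1 / (s - 1)"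
      by (auto simp: difference_quotient_def W(2) W(3)[OF s, symmetric] diff_divide_distrib)
  qed
qed

lemma periodic_mod_eq:
  fixes g :: "nat \<Rightarrow> 'a"
  assumes "\<And>n. g (n + M) = g n"
  shows "g (n mod M) = g n"
proof -
  have "g (k * M + r) = g r" for k r
  proof (induction k)
    case (Suc k)
    have "Suc k * M + r = (k * M + r) + M" by simp
    then show ?case using assms Suc by metis
  qed simp
  from this[of "n div M" "n mod M"] show ?thesis by simp
qed

lemma periodic_bounded:
  fixes g :: "nat \<Rightarrow> real"
  assumes "M > 0" "\<And>n. g (n + M) = g n"
  shows "\<bar>g n\<bar> \<le> (\<Sum>j<M. \<bar>g j\<bar>)"
  using member_le_sum[of "n mod M" "{..<M}" "\<lambda>j. \<bar>g j\<bar>"] assms(1)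
  by (simp add: periodic_mod_eq[of g M, OF assms(2)])

lemma periodic_partial_sums_bounded:
  fixes g :: "nat \<Rightarrow> real"
  assumes "M > 0" and per: "\<And>n. g (n + M) = g n" and zero: "(\<Sum>n<M. g n) = 0"
  shows "\<bar>\<Sum>n<N. g n\<bar> \<le> (\<Sum>j<M. \<bar>g j\<bar>)"
proof (induction N rule: less_induct)
  case (less N)
  show ?case
  proof (cases "N \<le> M")
    case True
    have "\<bar>\<Sum>n<N. g n\<bar> \<le> (\<Sum>n<N. \<bar>g n\<bar>)" by (rule sum_abs)
    also have "\<dots> \<le> (\<Sum>n<M. \<bar>g n\<bar>)" using True by (intro sum_mono2) auto
    finally show ?thesis .
  next
    case False
    have "(\<Sum>n<M + k. g n) = (\<Sum>n<M. g n) + (\<Sum>n<k. g n)" for k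
      by (induction k) (auto simp: per add.commute[of M])
    from this[of "N - M"] show ?thesis
      using less.IH[of "N - M"] \<open>M > 0\<close> False zero by simp
  qed
qed

lemma periodic_dirichlet_series_extends:
  fixes g :: "nat \<Rightarrow> real"
  assumes "M > 0" and per: "\<And>n. g (n + M) = g n"
  obtains V where "V holomorphic_on {s. Re s > 0}" "V 1 = of_real ((\<Sum>n<M. g n) / real M)"
    and "\<And>s. Re s > 1 \<Longrightarrow> (s - 1) * dirichlet_series g s = V s"
proof -
  define m where "m = (\<Sum>n<M. g n) / real M"
  have g: "dirichlet_abs_conv g"
    by (rule dirichlet_abs_conv_if_le[OF dirichlet_abs_conv_const[of "\<Sum>j<M. \<bar>g j\<bar>"]])
       (use periodic_bounded[of M g, OF assms] in \<open>force intro: order_trans\<close>)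
  have "(\<Sum>n<M. g n - m) = 0" using \<open>M > 0\<close> by (simp add: m_def sum_subtractf)
  then obtain K where K: "K holomorphic_on {s. Re s > 0}"
      "\<And>s. Re s > 1 \<Longrightarrow> dirichlet_series (\<lambda>n. g n - m) s = K s"
    using assms dirichlet_series_extends_if_bounded_partial_sums[OF
        dirichlet_abs_conv_diff[OF g dirichlet_abs_conv_const]
        periodic_partial_sums_bounded[of M "\<lambda>n. g n - m"]] by auto
  obtain W where W: "W holomorphic_on {s. Re s > 0}" "W 1 = 1"
    "\<And>s. Re s > 1 \<Longrightarrow> (s - 1) * dirichlet_series (\<lambda>_. 1) s = W s"
    using zeta_extends by blast
  show ?thesis
  proof (rule that[of "\<lambda>s. of_real m * W s + (s - 1) * K s"])
    show "(\<lambda>s. of_real m * W s + (s - 1) * K s) holomorphic_on {s. Re s > 0}"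
      by (intro holomorphic_intros W K)
    show "of_real m * W 1 + (1 - 1) * K 1 = of_real ((\<Sum>n<M. g n) / real M)"
      using W by (simp add: m_def)
    fix s assume s: "Re s > 1"
    have "dirichlet_series g s = of_real m * dirichlet_series (\<lambda>_. 1) s + K s"
      using dirichlet_series_diff[OF g dirichlet_abs_conv_const s, of m]
        dirichlet_series_cmult[OF dirichlet_abs_conv_const s, of m 1] K(2)[OF s] by simp
    then show "(s - 1) * dirichlet_series g s = of_real m * W s + (s - 1) * K s"
      unfolding W(3)[OF s, symmetric] by (simp add: algebra_simps)
  qed
qed

section \<open>Real characters\<close>

locale real_character =
  fixes M :: nat and f :: "nat \<Rightarrow> real"
  assumes modulus: "M > 1"
    and mult: "f (m * n) = f m * f n"
    and periodic: "f (n + M) = f n"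
    and coprime_imp: "coprime n M \<Longrightarrow> f n = 1 \<or> f n = -1"
    and not_coprime_imp: "\<not> coprime n M \<Longrightarrow> f n = 0"

definition coprime_restrict :: "nat \<Rightarrow> (nat \<Rightarrow> real) \<Rightarrow> nat \<Rightarrow> real" where
  "coprime_restrict M h n = (if coprime n M then h n else 0)"

lemma real_character_coprime_restrict:
  fixes h :: "nat \<Rightarrow> real"
  assumes "M > 1" "\<And>m n. coprime m M \<Longrightarrow> coprime n M \<Longrightarrow> h (m * n) = h m * h n"
    and "\<And>n. h (n + M) = h n" "\<And>n. coprime n M \<Longrightarrow> h n = 1 \<or> h n = -1"
  shows "real_character M (coprime_restrict M h)"
proof
  have "coprime (n + M) M \<longleftrightarrow> coprime n M" for n unfolding coprime_iff_gcd_eq_1 by simp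
  then show "coprime_restrict M h (n + M) = coprime_restrict M h n" for n
    by (simp add: coprime_restrict_def assms(3))
qed (use assms in \<open>auto simp: coprime_restrict_def coprime_mult_left_iff\<close>)

lemma sum_divisors_prime_power_times:
  fixes f :: "nat \<Rightarrow> 'a :: comm_semiring_1"
  assumes f: "\<And>m n. f (m * n) = f m * f n" "f 1 = 1" and p: "prime p" "\<not> p dvd m"
  shows "(\<Sum>d | d dvd p ^ a * m. f d) = (\<Sum>i\<le>a. f p ^ i) * (\<Sum>d | d dvd m. f d)"
proof -
  let ?I = "{..a} \<times> {d. d dvd m}"
  have "m > 0" using p(2) by (auto intro!: Nat.gr0I)
  have f_power: "f (p ^ i) = f p ^ i" for i by (induction i) (auto simp: f(1) f(2)[simplified])
  have multiplicity: "multiplicity p (p ^ i * d) = i" if "d dvd m" for i d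
  proof -
    have "\<not> p dvd d" using that p(2) by (meson dvd_trans)
    then show ?thesis
      using p(1) \<open>m > 0\<close> that
      by (simp add: prime_elem_multiplicity_mult_distrib not_dvd_imp_multiplicity_0 dvd_pos_nat
          prime_gt_0_nat)
  qed
  have inj: "inj_on (\<lambda>(i, d). p ^ i * d) ?I"
  proof (rule inj_onI, clarify)
    fix i d j e assume de: "d dvd m" "e dvd m" "p ^ i * d = p ^ j * e"
    then have "i = j" using multiplicity by metis
    then show "i = j \<and> d = e" using de(3) p(1) by (simp add: prime_gt_0_nat)
  qed
  have image: "{d. d dvd p ^ a * m} = (\<lambda>(i, d). p ^ i * d) ` ?I"
  proof (intro equalityI subsetI)
    fix k assume "k \<in> {d. d dvd p ^ a * m}"
    then obtain b c where k: "k = b * c" "b dvd p ^ a" "c dvd m" by (auto dest: division_decomp)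
    then obtain i where "i \<le> a" "b = p ^ i" using p(1) by (auto simp: divides_primepow_nat)
    with k show "k \<in> (\<lambda>(i, d). p ^ i * d) ` ?I" by force
  qed (auto intro!: mult_dvd_mono le_imp_power_dvd)
  have "(\<Sum>d | d dvd p ^ a * m. f d) = (\<Sum>(i, d)\<in>?I. f (p ^ i * d))"
    unfolding image by (subst sum.reindex[OF inj]) (simp add: case_prod_unfold)
  also have "\<dots> = (\<Sum>i\<le>a. f p ^ i) * (\<Sum>d | d dvd m. f d)"
    by (simp add: sum_product sum.cartesian_product f(1) f_power)
  finally show ?thesis .
qed

lemma horizontal_tendsto_holomorphic:
  assumes "h holomorphic_on {s. Re s > 0}"
  shows "((\<lambda>\<sigma>. h (Complex \<sigma> t)) \<longlongrightarrow> h (Complex 1 t)) (at_right 1)"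
    and "((\<lambda>\<sigma>. (h (Complex \<sigma> t) - h (Complex 1 t)) / of_real (\<sigma> - 1))
        \<longlongrightarrow> deriv h (Complex 1 t)) (at_right 1)"
proof -
  have "open {s::complex. Re s > 0}" by (rule open_halfspace_Re_gt)
  then have deriv: "(h has_field_derivative deriv h (Complex 1 t)) (at (Complex 1 t))"
    by (rule holomorphic_derivI[OF assms]) simp
  have line: "((\<lambda>\<sigma>. Complex \<sigma> t) \<longlongrightarrow> Complex 1 t) (at_right 1)"
    unfolding Complex_eq by (intro tendsto_intros)
  then show "((\<lambda>\<sigma>. h (Complex \<sigma> t)) \<longlongrightarrow> h (Complex 1 t)) (at_right 1)"
    by (rule isCont_tendsto_compose[OF DERIV_isCont[OF deriv]])
  have "filterlim (\<lambda>\<sigma>. Complex \<sigma> t) (at (Complex 1 t)) (at_right 1)"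
    using line by (auto simp: filterlim_at eventually_at_filter)
  moreover have "((\<lambda>z. (h z - h (Complex 1 t)) / (z - Complex 1 t))
      \<longlongrightarrow> deriv h (Complex 1 t)) (at (Complex 1 t))"
    using deriv by (simp add: has_field_derivative_iff)
  ultimately have "((\<lambda>\<sigma>. (h (Complex \<sigma> t) - h (Complex 1 t)) / (Complex \<sigma> t - Complex 1 t))
      \<longlongrightarrow> deriv h (Complex 1 t)) (at_right 1)"
    by (rule filterlim_compose[rotated])
  moreover have "Complex \<sigma> t - Complex 1 t = of_real (\<sigma> - 1)" for \<sigma> by (simp add: complex_eq_iff)
  ultimately show "((\<lambda>\<sigma>. (h (Complex \<sigma> t) - h (Complex 1 t)) / of_real (\<sigma> - 1))
      \<longlongrightarrow> deriv h (Complex 1 t)) (at_right 1)"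
    by (simp only:)
qed

context real_character
begin

lemma value_cases: "f n = 1 \<or> f n = -1 \<or> f n = 0"
  using coprime_imp not_coprime_imp by blast

lemma abs_le_1: "\<bar>f n\<bar> \<le> 1"
  using value_cases[of n] by auto

lemma at_1: "f 1 = 1"
  using coprime_imp[of 1] mult[of 1 1] by auto

lemma real_character_times:
  assumes "real_character M g"
  shows "real_character M (\<lambda>n. f n * g n)"
proof -
  interpret g: real_character M g by (rule assms)
  show ?thesis
  proof
    show "f n * g n = 1 \<or> f n * g n = -1" if "coprime n M" for n
      using coprime_imp[OF that] g.coprime_imp[OF that] by auto
  qed (use modulus in \<open>simp_all add: mult g.mult periodic g.periodic not_coprime_imp\<close>)
qed

lemma abs_conv: "dirichlet_abs_conv f"
  by (rule dirichlet_abs_conv_if_le[OF dirichlet_abs_conv_const[of 1]]) (use abs_le_1 in simp)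

lemma abs_mult_mangoldt_le: "n > 0 \<Longrightarrow> \<bar>f n * mangoldt n\<bar> \<le> ln (real n)"
  using mult_mono[OF abs_le_1 mangoldt_le] by (simp add: abs_mult mangoldt_nonneg)

lemma abs_conv_mangoldt: "dirichlet_abs_conv (\<lambda>n. f n * mangoldt n)"
proof (rule dirichlet_abs_conv_if_le)
  show "dirichlet_abs_conv (\<lambda>n. 1 * ln (real n))"
    by (rule dirichlet_abs_conv_mult_ln[OF dirichlet_abs_conv_const])
qed (use abs_mult_mangoldt_le in force)

lemma abs_conv_mangoldt_over_ln: "dirichlet_abs_conv (\<lambda>n. f n * mangoldt n / ln (real n))"
proof (rule dirichlet_abs_conv_if_le[OF dirichlet_abs_conv_const[of 1]])
  fix n :: nat assume "n > 0"
  then show "\<bar>f n * mangoldt n / ln (real n)\<bar> \<le> \<bar>1\<bar>"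
    using abs_mult_mangoldt_le[of n] by (cases "n = 1") (simp_all add: abs_divide)
qed

lemma dirichlet_prod_mangoldt: "dirichlet_prod (\<lambda>n. f n * mangoldt n) f n = f n * ln (real n)"
proof (cases "n = 0")
  case False
  have "f d * mangoldt d * f (n div d) = f n * mangoldt d" if "d dvd n" for d
    using mult[of d "n div d"] that by (simp add: mult_ac)
  then have "dirichlet_prod (\<lambda>n. f n * mangoldt n) f n = f n * (\<Sum>d | d dvd n. mangoldt d)"
    by (auto simp: dirichlet_prod_def sum_distrib_left intro!: sum.cong)
  then show ?thesis using mangoldt_sum[of n, where ?'a = real] False by simp
qed (simp add: dirichlet_prod_def)

lemma has_field_derivative_series:
  assumes "Re s > 1"
  shows "(dirichlet_series f has_field_derivative
     - (dirichlet_series (\<lambda>n. f n * mangoldt n) s * dirichlet_series f s)) (at s)"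
  using dirichlet_series_has_field_derivative[OF abs_conv assms]
    dirichlet_series_dirichlet_prod[OF abs_conv_mangoldt abs_conv assms]
  by (simp add: dirichlet_prod_mangoldt[abs_def])

theorem series_eq_exp:
  assumes "Re s > 1"
  shows "dirichlet_series f s = exp (dirichlet_series (\<lambda>n. f n * mangoldt n / ln (real n)) s)"
proof -
  define S where "S = {s. Re s > 1}"
  define P where "P = dirichlet_series (\<lambda>n. f n * mangoldt n / ln (real n))"
  have P: "(P has_field_derivative - dirichlet_series (\<lambda>n. f n * mangoldt n) s) (at s)"
      if "s \<in> S" for s
  proof -
    have "f n * mangoldt n / ln (real n) * ln (real n) = f n * mangoldt n" for n
      by (cases "n \<le> 1") (auto simp: le_Suc_eq)
    then show ?thesis
      using dirichlet_series_has_field_derivative[OF abs_conv_mangoldt_over_ln, of s] that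
      by (simp add: P_def S_def)
  qed
  have "\<exists>C. \<forall>s\<in>S. dirichlet_series f s * exp (- P s) = C"
  proof (rule has_field_derivative_zero_constant)
    show "convex S" unfolding S_def by (rule convex_halfspace_Re_gt)
    fix s assume "s \<in> S"
    then have "((\<lambda>s. dirichlet_series f s * exp (- P s)) has_field_derivative 0) (at s)"
      by (auto intro!: derivative_eq_intros P has_field_derivative_series simp: S_def)
    then show "((\<lambda>s. dirichlet_series f s * exp (- P s)) has_field_derivative 0) (at s within S)"
      by (rule has_field_derivative_at_within)
  qed
  then obtain C where C: "\<And>s. s \<in> S \<Longrightarrow> dirichlet_series f s * exp (- P s) = C" by blast
  have "((\<lambda>\<sigma>. dirichlet_series f (of_real \<sigma>) * exp (- P (of_real \<sigma>)))
      \<longlongrightarrow> of_real (f 1) * exp (- of_real (f 1 * mangoldt 1 / ln (real 1)))) at_top"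
    unfolding P_def
    by (intro tendsto_intros dirichlet_series_tendsto_first_coeff abs_conv
        abs_conv_mangoldt_over_ln)
  moreover have "eventually (\<lambda>\<sigma>. dirichlet_series f (of_real \<sigma>) * exp (- P (of_real \<sigma>)) = C) at_top"
    using eventually_gt_at_top[of 1] by eventually_elim (simp add: C S_def)
  ultimately have "((\<lambda>_. C) \<longlongrightarrow>
      of_real (f 1) * exp (- of_real (f 1 * mangoldt 1 / ln (real 1)))) (at_top :: real filter)"
    by (rule Lim_transform_eventually)
  then have "C = 1" using at_1 by (simp add: tendsto_const_iff)
  then show ?thesis using C[of s] assms by (simp add: S_def P_def exp_minus field_simps)
qed

lemma series_nonzero: "Re s > 1 \<Longrightarrow> dirichlet_series f s \<noteq> 0"
  by (simp add: series_eq_exp)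

lemma mertens_cos_nonneg: "0 \<le> 3 * (f n * f n) + 4 * (f n * cos \<theta>) + f n * f n * cos (2 * \<theta>)"
proof -
  have "0 \<le> 2 * (f n * (f n + cos \<theta>))\<^sup>2" by simp
  also have "\<dots> = 3 * (f n * f n) + 4 * (f n * cos \<theta>) + f n * f n * (2 * (cos \<theta>)\<^sup>2 - 1)"
    using value_cases[of n] by (auto simp: power2_eq_square algebra_simps)
  finally show ?thesis by (simp add: cos_double_cos)
qed

lemma mertens_3_4_1:
  assumes "\<sigma> > 1"
  shows "norm (dirichlet_series (\<lambda>n. f n * f n) (Complex \<sigma> 0)) ^ 3
     * norm (dirichlet_series f (Complex \<sigma> t)) ^ 4
     * norm (dirichlet_series (\<lambda>n. f n * f n) (Complex \<sigma> (2 * t))) \<ge> 1"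
proof -
  interpret sq: real_character M "\<lambda>n. f n * f n"
    by (rule real_character_times[OF real_character_axioms])
  define P where "P h = dirichlet_series (\<lambda>n. h n * mangoldt n / ln (real n))" for h :: "nat \<Rightarrow> real"
  define E where "E = 3 * Re (P (\<lambda>n. f n * f n) (Complex \<sigma> 0)) + 4 * Re (P f (Complex \<sigma> t))
      + Re (P (\<lambda>n. f n * f n) (Complex \<sigma> (2 * t)))"
  define k where "k n = mangoldt n / ln (real n) * real n powr (-\<sigma>)" for n
  have P_sums: "(\<lambda>n. h n * (k n * cos (u * ln (real n)))) sums Re (P h (Complex \<sigma> u))"
    if "real_character M h" for h u
    using Re_dirichlet_series_cis_sums[OF real_character.abs_conv_mangoldt_over_ln[OF that] assms,
        where t = u and x = 0]
    by (simp add: P_def k_def mult_ac)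
  have "(\<lambda>n. 3 * (f n * f n * (k n * cos (0 * ln (real n))))
      + 4 * (f n * (k n * cos (t * ln (real n))))
      + f n * f n * (k n * cos (2 * t * ln (real n)))) sums E"
    unfolding E_def
    by (intro sums_add sums_mult P_sums real_character_axioms sq.real_character_axioms)
  moreover have "3 * (f n * f n * (k n * cos (0 * ln (real n))))
      + 4 * (f n * (k n * cos (t * ln (real n))))
      + f n * f n * (k n * cos (2 * t * ln (real n))) \<ge> 0" for n
  proof -
    have "k n \<ge> 0" by (cases "n = 0") (auto simp: k_def mangoldt_nonneg)
    from mult_left_mono[OF mertens_cos_nonneg[of n "t * ln (real n)"] this]
    show ?thesis by (simp add: algebra_simps)
  qed
  ultimately have "E \<ge> 0" by (auto simp: sums_iff suminf_nonneg)
  then have "1 \<le> exp E" by simp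
  also have "exp E = norm (dirichlet_series (\<lambda>n. f n * f n) (Complex \<sigma> 0)) ^ 3
     * norm (dirichlet_series f (Complex \<sigma> t)) ^ 4
     * norm (dirichlet_series (\<lambda>n. f n * f n) (Complex \<sigma> (2 * t)))"
    using assms
    by (simp add: series_eq_exp sq.series_eq_exp E_def P_def exp_add exp_of_nat_mult[symmetric])
  finally show ?thesis .
qed

lemma series_extends:
  obtains V where "V holomorphic_on {s. Re s > 0}" "V 1 = of_real ((\<Sum>n<M. f n) / real M)"
    and "\<And>s. Re s > 1 \<Longrightarrow> (s - 1) * dirichlet_series f s = V s"
  using periodic_dirichlet_series_extends[of M f] modulus periodic
  by (metis less_trans zero_less_one)

lemma mertens_3_4_1_extension:
  assumes V: "\<And>s. Re s > 1 \<Longrightarrow> (s - 1) * dirichlet_series f s = V s"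
    and U: "\<And>s. Re s > 1 \<Longrightarrow> (s - 1) * dirichlet_series (\<lambda>n. f n * f n) s = U s"
    and "\<sigma> > 1"
  shows "\<bar>t\<bar> ^ 4 * \<bar>2 * t\<bar> \<le> (\<sigma> - 1) * (norm (U (Complex \<sigma> 0)) ^ 3
     * norm (V (Complex \<sigma> t) / of_real (\<sigma> - 1)) ^ 4 * norm (U (Complex \<sigma> (2 * t))))"
proof -
  define d where "d u = norm (Complex \<sigma> u - 1)" for u
  define A where "A u = norm (dirichlet_series (\<lambda>n. f n * f n) (Complex \<sigma> u))" for u
  define B where "B = norm (dirichlet_series f (Complex \<sigma> t))"
  have d: "d 0 = \<sigma> - 1" "\<bar>u\<bar> \<le> d u" for u
    using \<open>\<sigma> > 1\<close> abs_Im_le_cmod[of "Complex \<sigma> u - 1"] by (simp_all add: d_def cmod_def)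
  have norm_UV: "norm (U (Complex \<sigma> u)) = d u * A u" "norm (V (Complex \<sigma> t)) = d t * B" for u
    using \<open>\<sigma> > 1\<close> by (simp_all add: d_def A_def B_def norm_mult[symmetric] U V)
  have "1 \<le> A 0 ^ 3 * B ^ 4 * A (2 * t)"
    unfolding A_def B_def by (rule mertens_3_4_1[OF \<open>\<sigma> > 1\<close>])
  then have "\<bar>t\<bar> ^ 4 * \<bar>2 * t\<bar> * 1 \<le> d t ^ 4 * d (2 * t) * (A 0 ^ 3 * B ^ 4 * A (2 * t))"
    using d(2) by (intro mult_mono power_mono) (auto simp: d_def)
  also have "\<dots> = (d 0 * A 0) ^ 3 * (d t * B) ^ 4 * (d (2 * t) * A (2 * t)) / d 0 ^ 3"
    using \<open>\<sigma> > 1\<close> by (simp add: d(1) power_mult_distrib)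
  also have "\<dots> = d 0 * ((d 0 * A 0) ^ 3 * (d t * B / d 0) ^ 4 * (d (2 * t) * A (2 * t)))"
    using \<open>\<sigma> > 1\<close> by (simp add: d(1) power_divide) (simp add: eval_nat_numeral)
  also have "d t * B / d 0 = norm (V (Complex \<sigma> t) / of_real (\<sigma> - 1))"
    using \<open>\<sigma> > 1\<close> unfolding norm_divide norm_of_real norm_UV d(1) by simp
  finally show ?thesis by (simp only: norm_UV d(1) mult_1_right)
qed

lemma extension_nonzero_off_1:
  assumes V: "V holomorphic_on {s. Re s > 0}" "\<And>s. Re s > 1 \<Longrightarrow> (s - 1) * dirichlet_series f s = V s"
    and "t \<noteq> 0"
  shows "V (Complex 1 t) \<noteq> 0"
proof
  assume "V (Complex 1 t) = 0"
  interpret sq: real_character M "\<lambda>n. f n * f n"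
    by (rule real_character_times[OF real_character_axioms])
  obtain U where U: "U holomorphic_on {s. Re s > 0}"
      "\<And>s. Re s > 1 \<Longrightarrow> (s - 1) * dirichlet_series (\<lambda>n. f n * f n) s = U s"
    using sq.series_extends by blast
  define X where "X \<sigma> = (\<sigma> - 1) * (norm (U (Complex \<sigma> 0)) ^ 3
      * norm (V (Complex \<sigma> t) / of_real (\<sigma> - 1)) ^ 4 * norm (U (Complex \<sigma> (2 * t))))" for \<sigma>
  have "(X \<longlongrightarrow> (1 - 1) * (norm (U (Complex 1 0)) ^ 3
      * norm (deriv V (Complex 1 t)) ^ 4 * norm (U (Complex 1 (2 * t))))) (at_right 1)"
    unfolding X_def[abs_def]
    using horizontal_tendsto_holomorphic(2)[OF V(1), of t, unfolded \<open>V (Complex 1 t) = 0\<close> diff_zero]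
    by (intro tendsto_intros horizontal_tendsto_holomorphic U)
  moreover have "eventually (\<lambda>\<sigma>. \<bar>t\<bar> ^ 4 * \<bar>2 * t\<bar> \<le> X \<sigma>) (at_right 1)"
    using eventually_at_right_less[of 1]
    by eventually_elim (simp only: X_def mertens_3_4_1_extension[OF V(2) U(2)])
  ultimately have "\<bar>t\<bar> ^ 4 * \<bar>2 * t\<bar> \<le> 0" by (intro tendsto_lowerbound[of X]) auto
  then show False using \<open>t \<noteq> 0\<close> by (simp add: mult_le_0_iff)
qed

lemma sum_powers_ge: "(\<Sum>i\<le>k. f p ^ i) \<ge> 0" "(\<Sum>i\<le>2 * k. f p ^ i) \<ge> 1"
proof -
  have alternating: "(\<Sum>i\<le>k. (-1::real) ^ i) = (if even k then 1 else 0)" for k by (induction k) auto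
  have zero: "(\<Sum>i\<le>k. (0::real) ^ i) = 1" for k by (induction k) auto
  show "(\<Sum>i\<le>k. f p ^ i) \<ge> 0" "(\<Sum>i\<le>2 * k. f p ^ i) \<ge> 1"
    using value_cases[of p] by (auto simp: alternating zero)
qed

lemma divisor_sum_nonneg_ge_1_at_squares:
  "n > 0 \<Longrightarrow> (\<Sum>d | d dvd n. f d) \<ge> 0 \<and> (\<Sum>d | d dvd n\<^sup>2. f d) \<ge> 1"
proof (induction n rule: less_induct)
  case (less n)
  show ?case
  proof (cases "n = 1")
    case True
    then show ?thesis using at_1 by simp
  next
    case False
    then obtain p where p: "prime p" "p dvd n" by (metis prime_factor_nat)
    define a where "a = multiplicity p n"
    have "n \<noteq> 0" "\<not> is_unit p" using less.prems p(1) not_prime_unit by auto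
    then obtain m where n: "n = p ^ a * m" "\<not> p dvd m"
      using multiplicity_decompose'[of n p] unfolding a_def by blast
    have "m > 0" using n less.prems by (auto intro!: Nat.gr0I)
    have "a > 0" using p less.prems unfolding a_def by (simp add: prime_multiplicity_gt_zero_iff)
    then have "p ^ a > 1" using prime_gt_1_nat[OF p(1)] by (metis one_less_power)
    then have "m < n" using \<open>m > 0\<close> n by simp
    then have sums_m: "(\<Sum>d | d dvd m. f d) \<ge> 0" "(\<Sum>d | d dvd m\<^sup>2. f d) \<ge> 1"
      using less.IH \<open>m > 0\<close> by blast+
    have "n\<^sup>2 = p ^ (2 * a) * m\<^sup>2"
      by (simp add: n(1) power_mult_distrib power_mult[symmetric] mult.commute)
    moreover have "\<not> p dvd m\<^sup>2" using p n by (simp add: prime_dvd_power_iff)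
    ultimately have "(\<Sum>d | d dvd n\<^sup>2. f d) = (\<Sum>i\<le>2 * a. f p ^ i) * (\<Sum>d | d dvd m\<^sup>2. f d)"
      using sum_divisors_prime_power_times[of f p "m\<^sup>2" "2 * a", OF mult at_1 p(1)] by simp
    moreover have "1 * 1 \<le> (\<Sum>i\<le>2 * a. f p ^ i) * (\<Sum>d | d dvd m\<^sup>2. f d)"
      using sum_powers_ge(2)[of p a] sums_m by (intro mult_mono) auto
    moreover have "(\<Sum>d | d dvd n. f d) = (\<Sum>i\<le>a. f p ^ i) * (\<Sum>d | d dvd m. f d)"
      unfolding n(1) by (rule sum_divisors_prime_power_times[of f, OF mult at_1 p(1) n(2)])
    ultimately show ?thesis using sum_powers_ge(1)[of p a] sums_m by simp
  qed
qed

lemma not_summable_divisor_sums: "\<not> summable (\<lambda>n. dirichlet_prod f (\<lambda>_. 1) n * real n powr (-1/2))"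
proof
  define r where "r = dirichlet_prod f (\<lambda>_. 1)"
  have r: "n > 0 \<Longrightarrow> r n \<ge> 0 \<and> r (n\<^sup>2) \<ge> 1" for n
    using divisor_sum_nonneg_ge_1_at_squares[of n] by (simp add: r_def dirichlet_prod_def)
  assume "summable (\<lambda>n. dirichlet_prod f (\<lambda>_. 1) n * real n powr (-1/2))"
  then have "summable ((\<lambda>n. r n * real n powr (-1/2)) \<circ> (\<lambda>n. n\<^sup>2))"
    unfolding r_def[symmetric]
  proof (rule summable_reindex)
    show "r n * real n powr (-1/2) \<ge> 0" for n using r[of n] by (cases "n = 0") simp_all
  qed (simp add: inj_def)
  then have "summable (\<lambda>n. 1 / real n)"
  proof (rule summable_comparison_test'[where N = 1])
    fix n :: nat assume "n \<ge> 1"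
    then have "real (n\<^sup>2) powr (-1/2) = 1 / real n"
      by (simp add: powr_minus_divide powr_half_sqrt real_sqrt_abs)
    moreover have "1 * (1 / real n) \<le> r (n\<^sup>2) * (1 / real n)"
      using r[of n] \<open>n \<ge> 1\<close> by (intro mult_right_mono) auto
    ultimately show "norm (1 / real n) \<le> ((\<lambda>n. r n * real n powr (-1/2)) \<circ> (\<lambda>n. n\<^sup>2)) n"
      by simp
  qed
  then show False using not_summable_harmonic[where ?'a = real] by (simp add: inverse_eq_divide)
qed

text \<open>If the series vanished at \<open>1\<close>, its product with the zeta function, whose coefficients are
  nonnegative and at least \<open>1\<close> at squares, would have no pole, contradicting Landau's theorem.\<close>

theorem extension_nonzero_at_1:
  assumes F: "F holomorphic_on {s. Re s > 0}" "\<And>s. Re s > 1 \<Longrightarrow> dirichlet_series f s = F s"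
  shows "F 1 \<noteq> 0"
proof
  assume "F 1 = 0"
  define r where "r = dirichlet_prod f (\<lambda>_. 1)"
  obtain W where W: "W holomorphic_on {s. Re s > 0}"
      "\<And>s. Re s > 1 \<Longrightarrow> (s - 1) * dirichlet_series (\<lambda>_. 1) s = W s"
    using zeta_extends by blast
  define h where "h = difference_quotient F 1"
  have "h holomorphic_on {s. Re s > 0}"
    unfolding h_def by (rule holomorphic_difference_quotient[OF F(1) open_halfspace_Re_gt])
  then have "(\<lambda>s. W s * h s) holomorphic_on {s. Re s > 0}"
    by (intro holomorphic_intros W)
  moreover have "W s * h s = dirichlet_series r s" if "Re s > 1" for s
  proof -
    have "s \<noteq> 1" using that by auto
    then show ?thesis
      using W(2)[OF that] F(2)[OF that]
        dirichlet_series_dirichlet_prod[OF abs_conv dirichlet_abs_conv_const that]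
      by (simp add: r_def h_def difference_quotient_def \<open>F 1 = 0\<close> field_simps)
  qed
  moreover have "r n \<ge> 0" for n
    using divisor_sum_nonneg_ge_1_at_squares[of n]
    by (cases "n = 0") (simp_all add: r_def dirichlet_prod_def)
  moreover have "dirichlet_abs_conv r"
    unfolding r_def
    by (rule dirichlet_abs_conv_dirichlet_prod[OF abs_conv dirichlet_abs_conv_const])
  ultimately have "summable (\<lambda>n. r n * real n powr (-(1/2)))"
    by (intro summable_nonneg_dirichlet_series_if_extends[where c = 0 and h = "\<lambda>s. W s * h s"]) auto
  then show False using not_summable_divisor_sums by (simp add: r_def)
qed

lemma complex_Re_ge_1_cases [case_names inside boundary one]:
  assumes "Re s \<ge> 1"
  obtains "Re s > 1" | t where "t \<noteq> 0" "s = Complex 1 t" | "s = 1"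
  using assms that by (metis complex.collapse le_less one_complex.code)

lemma extension_nonzero:
  assumes F: "F holomorphic_on {s. Re s > 0}"
      "\<And>s. Re s > 1 \<Longrightarrow> (s - 1) ^ \<delta> * dirichlet_series f s = F s"
    and \<delta>: "\<delta> = 0 \<or> \<delta> = 1" and "F 1 \<noteq> 0" "Re s \<ge> 1"
  shows "F s \<noteq> 0"
  using \<open>Re s \<ge> 1\<close>
proof (cases s rule: complex_Re_ge_1_cases)
  case inside
  then have "(s - 1) ^ \<delta> * dirichlet_series f s \<noteq> 0" using series_nonzero by auto
  then show ?thesis using F(2)[OF inside] by simp
next
  case (boundary t)
  have "(\<lambda>s. (s - 1) ^ (1 - \<delta>) * F s) holomorphic_on {s. Re s > 0}" by (intro holomorphic_intros F)
  moreover have "(s - 1) * dirichlet_series f s = (s - 1) ^ (1 - \<delta>) * F s" if "Re s > 1" for s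
    using \<delta> by (auto simp flip: F(2)[OF that])
  ultimately have "(s - 1) ^ (1 - \<delta>) * F s \<noteq> 0"
    unfolding boundary(2) using \<open>t \<noteq> 0\<close> by (rule extension_nonzero_off_1)
  then show ?thesis by simp
qed (use \<open>F 1 \<noteq> 0\<close> in simp)

lemma mean_pos_if_nonneg:
  assumes "\<And>n. f n \<ge> 0"
  shows "(\<Sum>n<M. f n) / real M > 0"
proof -
  have "f 1 \<le> (\<Sum>n<M. f n)" using modulus assms by (intro member_le_sum) auto
  then show ?thesis using at_1 modulus by simp
qed

theorem completed_series:
  obtains F and \<delta> :: nat where "F holomorphic_on {s. Re s > 0}" "\<And>s. Re s \<ge> 1 \<Longrightarrow> F s \<noteq> 0"
    and "\<And>s. Re s > 1 \<Longrightarrow> (s - 1) ^ \<delta> * dirichlet_series f s = F s"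
    and "\<delta> = 0 \<or> \<delta> = 1" "(\<And>n. f n \<ge> 0) \<Longrightarrow> \<delta> = 1"
proof -
  obtain V where V: "V holomorphic_on {s. Re s > 0}" "V 1 = of_real ((\<Sum>n<M. f n) / real M)"
      "\<And>s. Re s > 1 \<Longrightarrow> (s - 1) * dirichlet_series f s = V s"
    using series_extends by blast
  show ?thesis
  proof (cases "V 1 = 0")
    case False
    then have "V s \<noteq> 0" if "Re s \<ge> 1" for s
      using that V(3) by (intro extension_nonzero[of V 1 s] V(1)) auto
    then show ?thesis using V by (intro that[of V 1]) auto
  next
    case True
    define F where "F = difference_quotient V 1"
    have F: "F holomorphic_on {s. Re s > 0}"
      unfolding F_def by (rule holomorphic_difference_quotient[OF V(1) open_halfspace_Re_gt])
    have series_eq: "dirichlet_series f s = F s" if "Re s > 1" for s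
      using that V(3)[OF that, symmetric]
      by (cases "s = 1") (auto simp: F_def difference_quotient_def True)
    have "F 1 \<noteq> 0" by (rule extension_nonzero_at_1[OF F series_eq])
    then have "F s \<noteq> 0" if "Re s \<ge> 1" for s
      using that series_eq by (intro extension_nonzero[of F 0 s] F) auto
    moreover have "\<not> (\<forall>n. f n \<ge> 0)"
      using True mean_pos_if_nonneg unfolding V(2) of_real_eq_0_iff by (metis less_irrefl)
    ultimately show ?thesis using F series_eq by (intro that[of F 0]) auto
  qed
qed

lemma mangoldt_series_eq_log_derivative:
  assumes F: "\<And>s. Re s > 1 \<Longrightarrow> (s - 1) ^ \<delta> * dirichlet_series f s = F s"
    and \<delta>: "\<delta> = 0 \<or> \<delta> = 1" and s: "Re s > 1"
  shows "dirichlet_series (\<lambda>n. f n * mangoldt n) s = of_nat \<delta> / (s - 1) - deriv F s / F s"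
proof -
  define L where "L = dirichlet_series f s"
  define D where "D = dirichlet_series (\<lambda>n. f n * mangoldt n) s"
  have nonzero: "s - 1 \<noteq> 0" "L \<noteq> 0" using s series_nonzero by (auto simp: L_def)
  have "((\<lambda>s. (s - 1) ^ \<delta> * dirichlet_series f s) has_field_derivative
      (s - 1) ^ \<delta> * - (D * L) + of_nat \<delta> * (s - 1) ^ (\<delta> - 1) * L) (at s)"
    unfolding D_def L_def by (auto intro!: derivative_eq_intros has_field_derivative_series s)
  then have "(F has_field_derivative (s - 1) ^ \<delta> * - (D * L)
      + of_nat \<delta> * (s - 1) ^ (\<delta> - 1) * L) (at s)"
    by (rule has_field_derivative_transform_within_open[OF _ open_halfspace_Re_gt[of 1]])
       (use s F in auto)
  then have "deriv F s / F s
      = ((s - 1) ^ \<delta> * - (D * L) + of_nat \<delta> * (s - 1) ^ (\<delta> - 1) * L) / ((s - 1) ^ \<delta> * L)"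
    by (simp add: DERIV_imp_deriv F[OF s, symmetric] L_def)
  also have "\<dots> = - D + of_nat \<delta> / (s - 1)"
    using \<delta> nonzero by (auto simp: field_simps)
  finally show ?thesis by (simp add: D_def)
qed

text \<open>The residue is the order of the pole of the series at \<open>1\<close>.\<close>

theorem boundary_residue_mangoldt:
  obtains \<delta> where "boundary_residue (\<lambda>n. f n * mangoldt n) \<delta>" "\<delta> \<ge> 0" "(\<And>n. f n \<ge> 0) \<Longrightarrow> \<delta> = 1"
proof -
  obtain F and \<delta> :: nat where F: "F holomorphic_on {s. Re s > 0}" "\<And>s. Re s \<ge> 1 \<Longrightarrow> F s \<noteq> 0"
      "\<And>s. Re s > 1 \<Longrightarrow> (s - 1) ^ \<delta> * dirichlet_series f s = F s"
    and \<delta>: "\<delta> = 0 \<or> \<delta> = 1" "(\<And>n. f n \<ge> 0) \<Longrightarrow> \<delta> = 1"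
    using completed_series by metis
  obtain R where R: "R holomorphic_on {s. Re s > 0}"
      "\<And>s. Re s > 1 \<Longrightarrow> dirichlet_series (\<lambda>_. 1) s = R s + 1 / (s - 1)"
    using zeta_eq_pole_plus_holomorphic by blast
  define G where "G s = - deriv F s / F s - of_nat \<delta> * R s" for s
  have "dirichlet_series (\<lambda>n. f n * mangoldt n) s
      - of_real (real \<delta>) * dirichlet_series (\<lambda>_. 1) s = G s"
    if "Re s > 1" for s
    using mangoldt_series_eq_log_derivative[OF F(3) \<delta>(1) that] R(2)[OF that]
    by (simp add: G_def distrib_left)
  moreover have continuous: "continuous_on {s. Re s \<ge> 1} h"
      if "h holomorphic_on {s. Re s > 0}" for h
    using holomorphic_on_imp_continuous_on[OF that] by (rule continuous_on_subset) auto
  have "continuous_on {s. Re s \<ge> 1} G"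
    unfolding G_def using F(2)
    by (intro continuous_intros continuous F(1) R(1)
        holomorphic_deriv[OF F(1) open_halfspace_Re_gt]) auto
  ultimately have "boundary_residue (\<lambda>n. f n * mangoldt n) (real \<delta>)"
    unfolding boundary_residue_def by blast
  then show ?thesis using \<delta>(2) by (intro that[of "real \<delta>"]) auto
qed

end

section \<open>Primes at which given real characters take the value 1\<close>

lemma summable_on_nonneg_summable:
  fixes u :: "nat \<Rightarrow> real"
  assumes "summable u" "\<And>n. u n \<ge> 0"
  shows "u summable_on A"
  using assms
  by (intro summable_on_subset[of u UNIV A]) (auto simp: summable_on_UNIV_nonneg_real_iff)

lemma summable_on_ln_over_prime_powers:
  "(\<lambda>(p, k). ln (real p) / real p ^ Suc k) summable_on {2..} \<times> {1..}"
proof (rule summable_on_SigmaI)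
  fix p :: nat assume "p \<in> {2..}"
  then have "((\<lambda>k. (1 / real p) ^ k) has_sum (1 / real p / (1 - 1 / real p))) {1..}"
    by (intro has_sum_geometric_from_1) simp
  from has_sum_cmult_right[OF this, of "ln (real p) / real p"]
  show "((\<lambda>k. case (p, k) of (p, k) \<Rightarrow> ln (real p) / real p ^ Suc k) has_sum
      ln (real p) / real p * (1 / real p / (1 - 1 / real p))) {1..}"
    by (simp add: power_one_over)
next
  have "dirichlet_abs_conv (\<lambda>n. 1 * ln (real n))"
    by (rule dirichlet_abs_conv_mult_ln[OF dirichlet_abs_conv_const])
  from dirichlet_abs_convD[OF this, of 2]
  have "(\<lambda>p. 2 * (\<bar>ln (real p)\<bar> * real p powr (-2))) summable_on {2..}"
    by (intro summable_on_nonneg_summable summable_mult) auto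
  then show "(\<lambda>p. ln (real p) / real p * (1 / real p / (1 - 1 / real p))) summable_on {2..}"
  proof (rule summable_on_comparison_test)
    fix p :: nat assume p: "p \<in> {2..}"
    have "1 / (1 - 1 / real p) \<le> 2" using p by (simp add: field_simps)
    then have "(ln (real p) / (real p)\<^sup>2) * (1 / (1 - 1 / real p)) \<le> (ln (real p) / (real p)\<^sup>2) * 2"
      using p by (intro mult_left_mono) auto
    moreover have "real p powr (-2) = 1 / (real p)\<^sup>2" using p by (simp add: powr_minus_divide)
    ultimately show "ln (real p) / real p * (1 / real p / (1 - 1 / real p))
        \<le> 2 * (\<bar>ln (real p)\<bar> * real p powr (-2))"
      using p by (simp add: power2_eq_square mult_ac)
  qed auto
qed auto

lemma summable_mangoldt_proper_prime_powers:
  "summable (\<lambda>n. \<bar>if prime n then 0 else mangoldt n\<bar> * real n powr (-1))"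
proof -
  define P where "P = {(p :: nat, k :: nat). prime p \<and> k \<ge> 1}"
  define h where "h n = (mangoldt n / real n :: real)" for n
  have "(\<lambda>(p, k). ln (real p) / real p ^ Suc k) summable_on P"
    by (rule summable_on_subset[OF summable_on_ln_over_prime_powers])
       (auto simp: P_def dest: prime_ge_2_nat)
  also have "?this \<longleftrightarrow> (h \<circ> (\<lambda>(p, k). p ^ Suc k)) summable_on P"
    by (rule summable_on_cong) (auto simp: P_def h_def simp del: power_Suc)
  also have "\<dots> \<longleftrightarrow> h summable_on ((\<lambda>(p, k). p ^ Suc k) ` P)"
  proof (rule summable_on_reindex[symmetric], rule inj_onI, clarify)
    fix p k p' k' assume "(p, k) \<in> P" "(p', k') \<in> P" and powers_eq: "p ^ Suc k = p' ^ Suc k'"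
    then have "prime p" "prime p'" by (auto simp: P_def)
    from prime_power_inj'[OF this powers_eq] show "p = p' \<and> k = k'" by simp
  qed
  also have "\<dots> \<longleftrightarrow> (\<lambda>n. \<bar>if prime n then 0 else mangoldt n\<bar> * real n powr (-1)) summable_on UNIV"
  proof (rule summable_on_cong_neutral)
    fix n :: nat assume n: "n \<in> UNIV - (\<lambda>(p, k). p ^ Suc k) ` P"
    have "mangoldt n = (0 :: real)" if "\<not> prime n"
    proof (rule ccontr)
      assume "mangoldt n \<noteq> (0 :: real)"
      then obtain p k where prime_power: "prime p" "k > 0" "n = p ^ k"
        by (auto simp: mangoldt_def primepow_def split: if_splits)
      then have "k \<noteq> 1" using that by auto
      then obtain j where "k = Suc j" "j \<ge> 1" using prime_power(2) by (cases k) auto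
      then show False using n prime_power by (force simp: P_def)
    qed
    then show "\<bar>if prime n then 0 else mangoldt n\<bar> * real n powr (-1) = 0" by simp
  next
    fix n :: nat assume "n \<in> (\<lambda>(p, k). p ^ Suc k) ` P \<inter> UNIV"
    then obtain p k where "prime p" "k \<ge> 1" "n = p ^ Suc k" by (auto simp: P_def)
    then have "\<not> prime n" by (simp add: prime_power_iff del: power_Suc)
    then show "h n = \<bar>if prime n then 0 else mangoldt n\<bar> * real n powr (-1)"
      by (simp add: h_def powr_minus_divide)
  qed auto
  finally show ?thesis by (rule summable_on_imp_summable)
qed

lemma real_character_coprime_restrict_prod:
  assumes "finite A" "\<And>g. g \<in> A \<Longrightarrow> real_character M g" "M > 1"
  shows "real_character M (coprime_restrict M (\<lambda>n. \<Prod>g\<in>A. g n))"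
  using assms(1,2)
proof (induction A rule: finite_induct)
  case empty
  show ?case by (rule real_character_coprime_restrict) (use \<open>M > 1\<close> in auto)
next
  case (insert g A)
  then have "real_character M (\<lambda>n. g n * coprime_restrict M (\<lambda>n. \<Prod>g\<in>A. g n) n)"
    by (intro real_character.real_character_times) auto
  also have "(\<lambda>n. g n * coprime_restrict M (\<lambda>n. \<Prod>g\<in>A. g n) n)
      = coprime_restrict M (\<lambda>n. \<Prod>g\<in>insert g A. g n)"
    using insert.hyps by (auto simp: coprime_restrict_def)
  finally show ?case .
qed

text \<open>Up to the factor \<open>2 ^ card I\<close>, the indicator of the integers at which all members of \<open>I\<close> are \<open>1\<close>.\<close>

definition genus_weight :: "nat \<Rightarrow> (nat \<Rightarrow> real) set \<Rightarrow> nat \<Rightarrow> real" where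
  "genus_weight M I = coprime_restrict M (\<lambda>n. \<Prod>g\<in>I. 1 + g n)"

context
  fixes M :: nat and I :: "(nat \<Rightarrow> real) set"
  assumes finite_I: "finite I" and character: "\<And>g. g \<in> I \<Longrightarrow> real_character M g" and modulus: "M > 1"
begin

lemma genus_weight_nonneg: "genus_weight M I n \<ge> 0"
proof -
  have "1 + g n \<ge> 0" if "g \<in> I" for g
    using real_character.value_cases[OF character[OF that], of n] by auto
  then show ?thesis by (auto simp: genus_weight_def coprime_restrict_def intro!: prod_nonneg)
qed

lemma genus_weight_le: "genus_weight M I n \<le> 2 ^ card I"
proof -
  have "0 \<le> 1 + g n \<and> 1 + g n \<le> 2" if "g \<in> I" for g
    using real_character.value_cases[OF character[OF that], of n] by auto
  then have "(\<Prod>g\<in>I. 1 + g n) \<le> (\<Prod>g\<in>I. 2)" by (intro prod_mono) auto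
  then show ?thesis by (simp add: genus_weight_def coprime_restrict_def)
qed

lemma genus_weight_nonzeroD:
  assumes "genus_weight M I n \<noteq> 0"
  shows "coprime n M" "g \<in> I \<Longrightarrow> g n = 1"
proof -
  show "coprime n M"
    using assms by (auto simp: genus_weight_def coprime_restrict_def split: if_splits)
  assume "g \<in> I"
  then have "1 + g n \<noteq> 0"
    using assms finite_I by (auto simp: genus_weight_def coprime_restrict_def split: if_splits)
  then show "g n = 1"
    using real_character.coprime_imp[OF character[OF \<open>g \<in> I\<close>] \<open>coprime n M\<close>] by auto
qed

lemma abs_conv_genus_weight_mult:
  assumes "\<And>n. \<bar>b n\<bar> \<le> mangoldt n"
  shows "dirichlet_abs_conv (\<lambda>n. genus_weight M I n * b n)"
proof (rule dirichlet_abs_conv_if_le)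
  show "dirichlet_abs_conv (\<lambda>n. 2 ^ card I * ln (real n))"
    by (rule dirichlet_abs_conv_mult_ln[OF dirichlet_abs_conv_const])
  fix n :: nat assume "n > 0"
  then have "\<bar>b n\<bar> \<le> ln (real n)" using assms[of n] mangoldt_le[of n] by linarith
  then have "\<bar>genus_weight M I n\<bar> * \<bar>b n\<bar> \<le> 2 ^ card I * ln (real n)"
    using genus_weight_nonneg[of n] genus_weight_le[of n] by (intro mult_mono) auto
  then show "\<bar>genus_weight M I n * b n\<bar> \<le> \<bar>2 ^ card I * ln (real n)\<bar>"
    using \<open>n > 0\<close> by (simp add: abs_mult)
qed

lemma genus_weight_boundary_residue:
  obtains c where "c > 0" "boundary_residue (\<lambda>n. genus_weight M I n * mangoldt n) c"
proof -
  define f where "f A = coprime_restrict M (\<lambda>n. \<Prod>g\<in>A. g n)" for A :: "(nat \<Rightarrow> real) set"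
  have f: "real_character M (f A)" if "A \<in> Pow I" for A
    unfolding f_def using that character modulus finite_subset[OF _ finite_I]
    by (intro real_character_coprime_restrict_prod) auto
  have "\<exists>\<delta>. boundary_residue (\<lambda>n. f A n * mangoldt n) \<delta> \<and> \<delta> \<ge> 0 \<and> ((\<forall>n. f A n \<ge> 0) \<longrightarrow> \<delta> = 1)"
    if "A \<in> Pow I" for A
    using real_character.boundary_residue_mangoldt[OF f[OF that]] by metis
  then obtain \<delta> where \<delta>: "\<And>A. A \<in> Pow I \<Longrightarrow> boundary_residue (\<lambda>n. f A n * mangoldt n) (\<delta> A)"
      "\<And>A. A \<in> Pow I \<Longrightarrow> \<delta> A \<ge> 0" "\<And>A. A \<in> Pow I \<Longrightarrow> (\<forall>n. f A n \<ge> 0) \<Longrightarrow> \<delta> A = 1"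
    by metis
  have "genus_weight M I n = (\<Sum>A\<in>Pow I. f A n)" for n
    using prod_add[OF finite_I, of "\<lambda>g. g n" "\<lambda>_. 1"]
    by (simp add: genus_weight_def f_def coprime_restrict_def add.commute)
  then have "boundary_residue (\<lambda>n. genus_weight M I n * mangoldt n) (\<Sum>A\<in>Pow I. \<delta> A)"
    using boundary_residue_sum[OF real_character.abs_conv_mangoldt[OF f] \<delta>(1), of "Pow I" "\<lambda>A. A"]
    by (simp add: sum_distrib_right)
  moreover have "\<delta> {} = 1" by (rule \<delta>(3)) (auto simp: f_def coprime_restrict_def)
  then have "(\<Sum>A\<in>Pow I. \<delta> A) > 0"
    using \<delta>(2) finite_I member_le_sum[of "{}" "Pow I" \<delta>] by simp
  ultimately show ?thesis using that by blast
qed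

lemma genus_weight_primes_boundary_residue:
  obtains c where "c > 0"
    and "boundary_residue (\<lambda>n. genus_weight M I n * (if prime n then mangoldt n else 0)) c"
proof -
  define w where "w = genus_weight M I"
  define q where "q n = w n * (if prime n then 0 else mangoldt n)" for n
  obtain c where c: "c > 0" "boundary_residue (\<lambda>n. w n * mangoldt n) c"
    using genus_weight_boundary_residue unfolding w_def by blast
  have abs_conv: "dirichlet_abs_conv (\<lambda>n. w n * mangoldt n)" "dirichlet_abs_conv q"
    unfolding w_def q_def[abs_def]
    by (auto intro!: abs_conv_genus_weight_mult simp: mangoldt_nonneg simp del: mangoldt_prime)
  have "summable (\<lambda>n. \<bar>q n\<bar> * real n powr (-1))"
  proof (rule summable_comparison_test'[where N = 0])
    show "summable (\<lambda>n. 2 ^ card I *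
        (\<bar>if prime n then 0 else mangoldt n\<bar> * real n powr (-1)) :: real)"
      by (intro summable_mult summable_mangoldt_proper_prime_powers)
    fix n :: nat
    have "\<bar>q n\<bar> \<le> 2 ^ card I * \<bar>if prime n then 0 else mangoldt n\<bar>"
      unfolding q_def abs_mult using genus_weight_nonneg[of n] genus_weight_le[of n]
      by (intro mult_right_mono) (auto simp: w_def)
    then show "norm (\<bar>q n\<bar> * real n powr (-1))
        \<le> 2 ^ card I * (\<bar>if prime n then 0 else mangoldt n\<bar> * real n powr (-1))"
      using mult_right_mono[of "\<bar>q n\<bar>" _ "real n powr (-1)"] by (simp add: mult.assoc)
  qed
  then have "boundary_residue (\<lambda>n. w n * mangoldt n - q n) c"
    by (intro boundary_residue_diff_summable abs_conv c)
  moreover have "w n * mangoldt n - q n = w n * (if prime n then mangoldt n else 0)" for n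
    by (simp add: q_def)
  ultimately show ?thesis using that[OF c(1)] by (simp add: w_def)
qed

theorem primes_in_log_window:
  assumes "\<eta> > 0"
  shows "eventually (\<lambda>x. \<exists>p. prime p \<and> coprime p M \<and> (\<forall>g\<in>I. g p = 1)
      \<and> \<bar>ln (real p) - x\<bar> \<le> \<eta>) at_top"
proof -
  define a where "a n = genus_weight M I n * (if prime n then mangoldt n else 0)" for n
  obtain c where c: "c > 0" "boundary_residue a c"
    using genus_weight_primes_boundary_residue unfolding a_def[abs_def] by blast
  have "dirichlet_abs_conv a"
    unfolding a_def[abs_def]
    by (auto intro!: abs_conv_genus_weight_mult simp: mangoldt_nonneg simp del: mangoldt_prime)
  moreover have "a n \<ge> 0" for n
    using genus_weight_nonneg[of n] by (simp add: a_def mangoldt_nonneg del: mangoldt_prime)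
  ultimately have "eventually (\<lambda>x. \<exists>n. a n > 0 \<and> \<bar>ln (real n) - x\<bar> \<le> \<eta>) at_top"
    using c assms by (intro positive_coeff_in_log_window)
  then show ?thesis
  proof (rule eventually_mono)
    fix x assume "\<exists>n. a n > 0 \<and> \<bar>ln (real n) - x\<bar> \<le> \<eta>"
    then obtain p where p: "a p > 0" "\<bar>ln (real p) - x\<bar> \<le> \<eta>" by blast
    then have "prime p" "genus_weight M I p \<noteq> 0" by (auto simp: a_def split: if_splits)
    then show "\<exists>p. prime p \<and> coprime p M \<and> (\<forall>g\<in>I. g p = 1) \<and> \<bar>ln (real p) - x\<bar> \<le> \<eta>"
      using genus_weight_nonzeroD p(2) by blast
  qed
qed

end

section \<open>Primes modulo which small integers are squares\<close>

lemma cong_imp_eq_if_abs_diff_less: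
  fixes a b :: int
  assumes "[a = b] (mod p)" "\<bar>a - b\<bar> < p"
  shows "a = b"
proof -
  have "p dvd (a - b)" using assms(1) by (simp add: cong_iff_dvd_diff)
  then show ?thesis using assms(2) dvd_imp_le_int[of "a - b" p] by auto
qed

lemma abs_Legendre_le_1: "\<bar>Legendre a p\<bar> \<le> 1"
  by (simp add: Legendre_def)

lemma Legendre_mult:
  assumes "prime q" "2 < q"
  shows "Legendre (a * b) (int q) = Legendre a (int q) * Legendre b (int q)"
proof (rule cong_imp_eq_if_abs_diff_less)
  let ?k = "(q - 1) div 2"
  have "[Legendre a q * Legendre b q = a ^ ?k * b ^ ?k] (mod q)"
    by (intro cong_mult euler_criterion assms)
  also have "a ^ ?k * b ^ ?k = (a * b) ^ ?k" by (simp add: power_mult_distrib)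
  finally show "[Legendre (a * b) q = Legendre a q * Legendre b q] (mod q)"
    using euler_criterion[OF assms, of "a * b"] cong_sym cong_trans by blast
  have "\<bar>Legendre a q\<bar> * \<bar>Legendre b q\<bar> \<le> 1 * 1"
    by (intro mult_mono abs_Legendre_le_1) auto
  then show "\<bar>Legendre (a * b) (int q) - Legendre a q * Legendre b q\<bar> < int q"
    using abs_Legendre_le_1[of "a * b" "int q"] assms(2) by (auto simp: abs_mult[symmetric])
qed

lemma Legendre_cong:
  assumes "[a = b] (mod p)"
  shows "Legendre a p = Legendre b p"
proof -
  have cong_iff: "[y = a] (mod p) \<longleftrightarrow> [y = b] (mod p)" for y
    using assms cong_trans cong_sym by blast
  moreover have "[a = 0] (mod p) \<longleftrightarrow> [b = 0] (mod p)" using cong_iff[of 0] cong_sym by blast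
  ultimately show ?thesis by (simp add: Legendre_def QuadRes_def)
qed

lemma QuadRes_square: "QuadRes p (a\<^sup>2)"
  unfolding QuadRes_def by (rule exI[of _ a]) simp

lemma QuadRes_cong: "[a = b] (mod p) \<Longrightarrow> QuadRes p a \<Longrightarrow> QuadRes p b"
  unfolding QuadRes_def using cong_trans by blast

lemma QuadRes_mult:
  assumes "QuadRes p a" "QuadRes p b"
  shows "QuadRes p (a * b)"
proof -
  obtain y z where "[y\<^sup>2 = a] (mod p)" "[z\<^sup>2 = b] (mod p)"
    using assms unfolding QuadRes_def by blast
  from cong_mult[OF this] have "[(y * z)\<^sup>2 = a * b] (mod p)" by (simp add: power_mult_distrib)
  then show ?thesis unfolding QuadRes_def by blast
qed

lemma QuadRes_if_Legendre_eq_1: "Legendre a p = 1 \<Longrightarrow> QuadRes p a"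
  by (auto simp: Legendre_def split: if_splits)

lemma QuadRes_if_euler_criterion:
  assumes p: "prime p" "2 < p" and a: "[a ^ ((p - 1) div 2) = 1] (mod int p)"
  shows "QuadRes (int p) a"
proof (rule QuadRes_if_Legendre_eq_1, rule cong_imp_eq_if_abs_diff_less)
  show "[Legendre a p = 1] (mod p)" using euler_criterion[OF p, of a] a cong_trans by blast
  show "\<bar>Legendre a p - 1\<bar> < int p" using abs_Legendre_le_1[of a "int p"] p(2) by linarith
qed

lemma QuadRes_minus_1_and_2:
  assumes p: "prime p" "p mod 8 = 1"
  shows "QuadRes (int p) (-1)" "QuadRes (int p) 2"
proof -
  have "2 < p" using p prime_ge_2_nat[OF p(1)] by (cases "p = 2") auto
  note euler = QuadRes_if_euler_criterion[OF p(1) \<open>2 < p\<close>]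
  obtain k where "p = 8 * k + 1" using p(2) by (metis div_mult_mod_eq mult.commute)
  then have half: "(p - 1) div 2 = 4 * k" by simp
  show minus_1: "QuadRes (int p) (-1)"
    by (rule euler, subst half) (simp add: power_mult)
  then obtain i where i: "[i\<^sup>2 = -1] (mod p)" by (auto simp: QuadRes_def)
  have "[(i\<^sup>2)\<^sup>2 = (-1)\<^sup>2] (mod p)" by (intro cong_pow i)
  then have "[i ^ 4 = 1] (mod p)" by (simp flip: power_mult)
  then have "[(i ^ 4) ^ k = 1 ^ k] (mod p)" by (rule cong_pow)
  then have "QuadRes (int p) i"
    by (intro euler, subst half) (simp add: power_mult)
  then have "QuadRes (int p) (-1 * (i * (1 + i)\<^sup>2))"
    by (intro QuadRes_mult minus_1 QuadRes_square)
  moreover have "[-1 * (i * (1 + i)\<^sup>2) = 2] (mod p)"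
  proof -
    have "-1 * (i * (1 + i)\<^sup>2) - 2 = - (i + 2) * (i\<^sup>2 - (-1))"
      by (simp add: power2_eq_square algebra_simps)
    then show ?thesis using i by (metis cong_iff_dvd_diff dvd_mult)
  qed
  ultimately show "QuadRes (int p) 2" by (rule QuadRes_cong[rotated])
qed

lemma QuadRes_prime_if_Legendre_eq_1:
  assumes p: "prime p" "p mod 4 = 1" and q: "prime q" "2 < q"
    and "p \<noteq> q" "Legendre (int p) (int q) = 1"
  shows "QuadRes (int p) (int q)"
proof (rule QuadRes_if_Legendre_eq_1)
  have "2 < p" using p prime_ge_2_nat[OF p(1)] by (cases "p = 2") auto
  have "p = 4 * (p div 4) + 1" using p(2) by (metis div_mult_mod_eq mult.commute)
  then have "(p - 1) div 2 = 2 * (p div 4)" by linarith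
  then have "even ((p - 1) div 2 * ((q - 1) div 2))" by simp
  then show "Legendre (int q) (int p) = 1"
    using Quadratic_Reciprocity[OF p(1) \<open>2 < p\<close> q \<open>p \<noteq> q\<close>] assms(6) by simp
qed

lemma QuadRes_nat_if_QuadRes_prime_divisors:
  fixes a :: nat
  assumes "\<And>q. prime q \<Longrightarrow> q dvd a \<Longrightarrow> QuadRes p (int q)"
  shows "QuadRes p (int a)"
  using assms
proof (induction a rule: prime_divisors_induct)
  case (unit a)
  then show ?case using QuadRes_square[of p 1] by simp
next
  case (factor q a)
  then show ?case using QuadRes_mult[of p "int q" "int a"] by (simp add: dvd_mult)
qed (use QuadRes_square[of p 0] in simp)

lemma QuadRes_small_if_QuadRes_small_primes:
  assumes p: "prime p" "p mod 8 = 1"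
    and odd_primes: "\<And>q. prime q \<Longrightarrow> 2 < q \<Longrightarrow> q \<le> N \<Longrightarrow> QuadRes (int p) (int q)"
    and a: "\<bar>a\<bar> \<le> int N"
  shows "QuadRes (int p) a"
proof -
  have QuadRes_nat: "QuadRes (int p) (int m)" if "0 < m" "m \<le> N" for m
  proof (rule QuadRes_nat_if_QuadRes_prime_divisors)
    fix q :: nat assume q: "prime q" "q dvd m"
    then have "q \<le> N" using that dvd_imp_le[of q m] by simp
    then show "QuadRes (int p) (int q)"
      using QuadRes_minus_1_and_2(2)[OF p] odd_primes[OF q(1)] prime_ge_2_nat[OF q(1)]
      by (cases "q = 2") auto
  qed
  show ?thesis
  proof (cases a "0::int" rule: linorder_cases)
    case less
    then have "QuadRes (int p) (-1 * int (nat (-a)))"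
      using a by (intro QuadRes_mult QuadRes_minus_1_and_2(1)[OF p] QuadRes_nat) auto
    then show ?thesis using less by simp
  next
    case equal
    then show ?thesis using QuadRes_square[of "int p" 0] by simp
  next
    case greater
    then show ?thesis using QuadRes_nat[of "nat a"] a by simp
  qed
qed

lemma odd_if_coprime_multiple_of_8:
  fixes n M :: nat
  assumes "coprime n M" "8 dvd M"
  shows "odd n"
proof -
  have "2 dvd M" using assms(2) by presburger
  then show ?thesis using coprime_common_divisor[OF assms(1), of 2] by auto
qed

definition chi4 :: "nat \<Rightarrow> real" where
  "chi4 n = (if n mod 4 = 1 then 1 else -1)"

definition chi8 :: "nat \<Rightarrow> real" where
  "chi8 n = (if n mod 8 = 1 \<or> n mod 8 = 7 then 1 else -1)"

definition legendre_char :: "nat \<Rightarrow> nat \<Rightarrow> real" where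
  "legendre_char q n = of_int (Legendre (int n) (int q))"

lemma real_character_chi4:
  assumes "8 dvd M" "M > 1"
  shows "real_character M (coprime_restrict M chi4)"
proof (rule real_character_coprime_restrict[OF assms(2)])
  fix m n assume "coprime m M" "coprime n M"
  then have "odd m" "odd n" using odd_if_coprime_multiple_of_8 assms(1) by blast+
  then have "m mod 4 = 1 \<or> m mod 4 = 3" "n mod 4 = 1 \<or> n mod 4 = 3" by presburger+
  moreover have "m * n mod 4 = (m mod 4) * (n mod 4) mod 4" by (simp add: mod_mult_eq)
  ultimately show "chi4 (m * n) = chi4 m * chi4 n" by (auto simp: chi4_def)
next
  have "4 dvd M" using assms(1) by presburger
  then have "(n + M) mod 4 = n mod 4" for n
    by (metis add.right_neutral dvd_imp_mod_0 mod_add_right_eq)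
  then show "chi4 (n + M) = chi4 n" for n by (simp add: chi4_def)
qed (simp add: chi4_def)

lemma real_character_chi8:
  assumes "8 dvd M" "M > 1"
  shows "real_character M (coprime_restrict M chi8)"
proof (rule real_character_coprime_restrict[OF assms(2)])
  fix m n assume "coprime m M" "coprime n M"
  then have "odd m" "odd n" using odd_if_coprime_multiple_of_8 assms(1) by blast+
  then have "m mod 8 = 1 \<or> m mod 8 = 3 \<or> m mod 8 = 5 \<or> m mod 8 = 7"
      "n mod 8 = 1 \<or> n mod 8 = 3 \<or> n mod 8 = 5 \<or> n mod 8 = 7"
    by presburger+
  moreover have "m * n mod 8 = (m mod 8) * (n mod 8) mod 8" by (simp add: mod_mult_eq)
  ultimately show "chi8 (m * n) = chi8 m * chi8 n"
    by (elim disjE) (simp_all add: chi8_def)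
next
  have "(n + M) mod 8 = n mod 8" for n
    using assms(1) by (metis add.right_neutral dvd_imp_mod_0 mod_add_right_eq)
  then show "chi8 (n + M) = chi8 n" for n by (simp add: chi8_def)
qed (simp add: chi8_def)

lemma real_character_legendre_char:
  assumes q: "prime q" "2 < q" "q dvd M" and "M > 1"
  shows "real_character M (coprime_restrict M (legendre_char q))"
proof (rule real_character_coprime_restrict[OF \<open>M > 1\<close>])
  show "legendre_char q (m * n) = legendre_char q m * legendre_char q n" for m n
    using Legendre_mult[OF q(1,2), of "int m" "int n"] by (simp add: legendre_char_def)
  have "[int (n + M) = int n] (mod int q)" for n
    using q(3) by (simp add: cong_iff_dvd_diff)
  then show "legendre_char q (n + M) = legendre_char q n" for n
    unfolding legendre_char_def using Legendre_cong by metis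
  fix n assume "coprime n M"
  then have "coprime n q" using q(3) coprime_divisors[of n n q M] by auto
  then have "\<not> q dvd n" using q(1) by (metis coprime_absorb_right nat_dvd_1_iff_1 not_prime_1)
  then show "legendre_char q n = 1 \<or> legendre_char q n = -1"
    by (auto simp: legendre_char_def Legendre_def cong_0_iff)
qed

definition QuadRes_upto :: "nat \<Rightarrow> int \<Rightarrow> bool" where
  "QuadRes_upto N p \<longleftrightarrow> (\<forall>a. \<bar>a\<bar> \<le> int N \<longrightarrow> QuadRes p a)"

theorem primes_QuadRes_upto_in_log_window:
  assumes "\<eta> > 0"
  shows "eventually (\<lambda>x. \<exists>p. (prime p \<and> QuadRes_upto N (int p)) \<and> \<bar>ln (real p) - x\<bar> \<le> \<eta>) at_top"
proof -
  define M :: nat where "M = 8 * fact N"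
  have "fact N \<ge> (1::nat)" by (rule fact_ge_1)
  then have "M > 1" unfolding M_def by linarith
  then have M: "8 dvd M" "M > 1" by (simp_all add: M_def)
  have prime_dvd_M: "q dvd M" if "prime q" "q \<le> N" for q
    using that prime_ge_1_nat[OF that(1)] by (simp add: M_def dvd_fact)
  define I where "I = coprime_restrict M ` ({chi4, chi8} \<union> legendre_char ` {q. prime q
      \<and> 2 < q \<and> q \<le> N})"
  have "finite I" by (simp add: I_def)
  moreover have "real_character M g" if "g \<in> I" for g
    using that M prime_dvd_M real_character_chi4 real_character_chi8 real_character_legendre_char
    unfolding I_def by auto
  ultimately have "eventually (\<lambda>x. \<exists>p. prime p \<and> coprime p M \<and> (\<forall>g\<in>I. g p = 1)
      \<and> \<bar>ln (real p) - x\<bar> \<le> \<eta>) at_top"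
    using M(2) assms by (rule primes_in_log_window)
  then show ?thesis
  proof (rule eventually_mono, elim exE conjE)
    fix x p assume p: "prime p" "coprime p M" "\<forall>g\<in>I. g p = 1" "\<bar>ln (real p) - x\<bar> \<le> \<eta>"
    have "chi4 p = 1" "chi8 p = 1" using p(2,3) by (simp_all add: I_def coprime_restrict_def)
    then have "p mod 4 = 1" "p mod 8 = 1 \<or> p mod 8 = 7"
      by (simp_all add: chi4_def chi8_def split: if_splits)
    then have "p mod 8 = 1" by presburger
    have "QuadRes (int p) (int q)" if q: "prime q" "2 < q" "q \<le> N" for q
    proof (rule QuadRes_prime_if_Legendre_eq_1[OF p(1) \<open>p mod 4 = 1\<close> q(1,2)])
      show "p \<noteq> q"
        using p(1,2) prime_dvd_M[OF q(1,3)]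
        by (metis coprime_absorb_left nat_dvd_1_iff_1 not_prime_1)
      have "legendre_char q p = 1" using p(2,3) q by (simp add: I_def coprime_restrict_def)
      then show "Legendre (int p) (int q) = 1" by (simp add: legendre_char_def)
    qed
    then have "QuadRes_upto N (int p)"
      unfolding QuadRes_upto_def
      using QuadRes_small_if_QuadRes_small_primes[OF p(1) \<open>p mod 8 = 1\<close>] by blast
    then show "\<exists>p. (prime p \<and> QuadRes_upto N (int p)) \<and> \<bar>ln (real p) - x\<bar> \<le> \<eta>"
      using p by blast
  qed
qed

section \<open>Integer relations modulo a prime\<close>

lemma prime_dvd_poly_if_many_roots:
  fixes P :: "int poly" and p :: int
  assumes "prime p" "finite R" "degree P < card R" "inj_on (\<lambda>t. t mod p) R"
      "\<And>t. t \<in> R \<Longrightarrow> p dvd poly P t"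
  shows "p dvd poly P t"
  using assms(2-)
proof (induction "degree P" arbitrary: P R t)
  case 0
  then obtain c where "P = [:c:]" by (metis degree_eq_zeroE)
  moreover obtain a where "a \<in> R" using 0 by fastforce
  ultimately show ?case using 0(5)[of a] by simp
next
  case (Suc n)
  obtain a where a: "a \<in> R" using Suc.prems by fastforce
  define S where "S = synthetic_div P a"
  have P_eq: "poly P t = (t - a) * poly S t + poly P a" for t
    using arg_cong[OF synthetic_div_correct'[of a P], of "\<lambda>q. poly q t"]
    by (simp add: S_def algebra_simps)
  have "p dvd poly S t" for t
  proof (rule Suc.hyps(1)[of S "R - {a}"])
    show "n = degree S" using Suc.hyps(2) by (simp add: S_def degree_synthetic_div)
    then show "degree S < card (R - {a})"
      using Suc.prems(1,2) Suc.hyps(2) a by (simp add: card_Diff_singleton)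
    show "inj_on (\<lambda>t. t mod p) (R - {a})" using Suc.prems(3) by (rule inj_on_subset) auto
    fix t assume t: "t \<in> R - {a}"
    then have "t mod p \<noteq> a mod p" using Suc.prems(3) a by (auto dest: inj_onD)
    then have "\<not> p dvd (t - a)" by (simp add: mod_eq_dvd_iff)
    moreover have "p dvd (t - a) * poly S t"
      using P_eq[of t] Suc.prems(4)[of t] Suc.prems(4)[OF a] t
      by (metis DiffD1 add_diff_cancel_right' dvd_diff)
    ultimately show "p dvd poly S t" using assms(1) by (simp add: prime_dvd_mult_iff)
  qed (use Suc.prems in auto)
  then show ?case using P_eq[of t] Suc.prems(4)[OF a] by simp
qed

lemma common_denominator:
  fixes S :: "'a :: field_char_0 set"
  assumes "finite S" "S \<subseteq> \<rat>"
  obtains N :: int where "N > 0" "\<And>x. x \<in> S \<Longrightarrow> of_int N * x \<in> \<int>"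
  using assms
proof (induction S arbitrary: thesis rule: finite_induct)
  case empty
  then show ?case by (metis empty_iff zero_less_one)
next
  case (insert y S)
  obtain N where N: "N > 0" "\<And>x. x \<in> S \<Longrightarrow> of_int N * x \<in> \<int>" using insert by auto
  obtain a b :: int where y: "b > 0" "y = of_int a / of_int b"
    using insert.prems(2) by (auto elim: Rats_cases')
  show ?case
  proof (rule insert.prems(1)[of "N * b"])
    show "N * b > 0" using N y by simp
    fix x assume x: "x \<in> insert y S"
    show "of_int (N * b) * x \<in> \<int>"
    proof (cases "x = y")
      case True
      then have "of_int (N * b) * x = of_int (N * a)" using y by simp
      then show ?thesis by (metis Ints_of_int)
    next
      case False
      then have "of_int N * x \<in> \<int>" using N(2) x by blast
      moreover have "of_int (N * b) * x = of_int b * (of_int N * x)" by simp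
      ultimately show ?thesis by (metis Ints_mult Ints_of_int)
    qed
  qed
qed

lemma primitive_int_multiple:
  fixes r :: "'k \<Rightarrow> rat"
  assumes "finite K" "\<exists>k\<in>K. r k \<noteq> 0"
  obtains q :: rat and e :: "'k \<Rightarrow> int" where "\<And>k. k \<in> K \<Longrightarrow> of_int (e k) = q * r k" "Gcd (e ` K) = 1"
proof -
  have "x \<in> \<rat>" for x :: rat using Rats_of_rat[of x, where ?'a = rat] by simp
  then have "r ` K \<subseteq> \<rat>" by (rule image_subsetI)
  then obtain N :: int where N: "N > 0" "\<And>k. k \<in> K \<Longrightarrow> of_int N * r k \<in> \<int>"
    using common_denominator[OF finite_imageI[OF assms(1)], of r] by (metis imageI)
  define d where "d k = \<lfloor>of_int N * r k\<rfloor>" for k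
  have d: "of_int (d k) = of_int N * r k" if "k \<in> K" for k
    using N(2)[OF that] unfolding d_def by (metis Ints_cases floor_of_int)
  define g where "g = Gcd (d ` K)"
  define e where "e k = d k div g" for k
  have de: "d k = g * e k" if "k \<in> K" for k
    using that by (simp add: e_def g_def Gcd_dvd)
  have "g \<noteq> 0"
    using assms(2) N(1) d de by (metis mult_eq_0_iff of_int_0_eq_iff order_less_irrefl)
  show ?thesis
  proof (rule that[of e "of_int N / of_int g"])
    show "of_int (e k) = of_int N / of_int g * r k" if "k \<in> K" for k
      using d[OF that] de[OF that] \<open>g \<noteq> 0\<close> by (simp add: field_simps flip: of_int_mult)
    have "d ` K = (*) g ` (e ` K)" using de by (auto simp: image_image)
    then have "g = normalize (g * Gcd (e ` K))" unfolding g_def by (metis Gcd_mult)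
    moreover have "g \<ge> 0" "Gcd (e ` K) \<ge> 0" by (simp_all add: g_def)
    ultimately have "g = g * Gcd (e ` K)" by (simp add: normalize_int_def)
    then show "Gcd (e ` K) = 1" using \<open>g \<noteq> 0\<close> by simp
  qed
qed

lemma exists_rat_linear_functional:
  fixes c :: real
  assumes "c \<noteq> 0"
  obtains \<phi> :: "real \<Rightarrow> rat" where "\<phi> c = 1"
    and "\<And>x y. \<phi> (x + y) = \<phi> x + \<phi> y" "\<And>q x. \<phi> (of_rat q * x) = q * \<phi> x"
proof -
  interpret R: vector_space "\<lambda>(q::rat) (x::real). of_rat q * x"
    by unfold_locales (auto simp: algebra_simps of_rat_add of_rat_mult)
  interpret V: vector_space_pair "\<lambda>(q::rat) (x::real). of_rat q * x" "\<lambda>(q::rat) (x::rat). q * x"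
    by unfold_locales (auto simp: algebra_simps)
  have "R.independent {c}" using assms by simp
  then obtain \<phi> where "\<phi> c = 1"
    and linear: "Vector_Spaces.linear (\<lambda>q x. of_rat q * x) (\<lambda>q x. q * x) \<phi>"
    using V.linear_independent_extend[of "{c}" "\<lambda>_. 1"] by auto
  interpret L: Vector_Spaces.linear "\<lambda>(q::rat) (x::real). of_rat q * x"
      "\<lambda>(q::rat) (x::rat). q * x" \<phi>
    by (rule linear)
  show ?thesis using that[of \<phi>] \<open>\<phi> c = 1\<close> L.add L.scale by blast
qed

lemma rat_relation_of_real_relation:
  fixes c :: "'k \<Rightarrow> real"
  assumes "finite K" "k\<^sub>0 \<in> K" "c k\<^sub>0 \<noteq> 0" and rel: "\<And>y. y \<in> Y \<Longrightarrow> (\<Sum>k\<in>K. c k * of_int (y k)) = 0"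
  obtains r :: "'k \<Rightarrow> rat" where "r k\<^sub>0 = 1" "\<And>y. y \<in> Y \<Longrightarrow> (\<Sum>k\<in>K. r k * of_int (y k)) = 0"
proof -
  obtain \<phi> :: "real \<Rightarrow> rat" where \<phi>: "\<phi> (c k\<^sub>0) = 1"
      "\<And>x y. \<phi> (x + y) = \<phi> x + \<phi> y" "\<And>q x. \<phi> (of_rat q * x) = q * \<phi> x"
    using exists_rat_linear_functional[OF assms(3)] by blast
  have \<phi>_0: "\<phi> 0 = 0" using \<phi>(3)[of 0 0] by simp
  have \<phi>_sum: "\<phi> (sum f K) = (\<Sum>k\<in>K. \<phi> (f k))" for f
    using assms(1) by (induction K rule: finite_induct) (auto simp: \<phi>_0 \<phi>(2))
  have "(\<Sum>k\<in>K. \<phi> (c k) * of_int (y k)) = 0" if "y \<in> Y" for y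
  proof -
    have "\<phi> (c k * of_int (y k)) = \<phi> (c k) * of_int (y k)" for k
      using \<phi>(3)[of "of_int (y k)" "c k"] by (simp add: mult.commute)
    then show ?thesis using \<phi>_sum[of "\<lambda>k. c k * of_int (y k)"] rel[OF that] \<phi>_0 by simp
  qed
  then show ?thesis by (rule that[of "\<lambda>k. \<phi> (c k)", OF \<phi>(1)])
qed

text \<open>A real relation gives a rational one by a \<open>\<rat>\<close>-linear functional, hence a primitive integer one.\<close>

theorem real_relation_trivial_if_trivial_mod_prime:
  fixes c :: "'k \<Rightarrow> real" and Y :: "('k \<Rightarrow> int) set" and p :: int
  assumes "finite K" "prime p"
    and trivial: "\<And>e k. (\<And>y. y \<in> Y \<Longrightarrow> p dvd (\<Sum>k\<in>K. e k * y k)) \<Longrightarrow> k \<in> K \<Longrightarrow> p dvd e k"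
    and rel: "\<And>y. y \<in> Y \<Longrightarrow> (\<Sum>k\<in>K. c k * of_int (y k)) = 0"
    and "k\<^sub>0 \<in> K"
  shows "c k\<^sub>0 = 0"
proof (rule ccontr)
  assume "c k\<^sub>0 \<noteq> 0"
  then obtain r :: "'k \<Rightarrow> rat" where r: "r k\<^sub>0 = 1" "\<And>y. y \<in> Y \<Longrightarrow> (\<Sum>k\<in>K. r k * of_int (y k)) = 0"
    using rat_relation_of_real_relation[OF assms(1) \<open>k\<^sub>0 \<in> K\<close> _ rel] by blast
  have "\<exists>k\<in>K. r k \<noteq> 0" using r(1) \<open>k\<^sub>0 \<in> K\<close> by (intro bexI[of _ k\<^sub>0]) auto
  then obtain q e where e: "\<And>k. k \<in> K \<Longrightarrow> of_int (e k) = q * r k" "Gcd (e ` K) = 1"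
    using primitive_int_multiple[OF assms(1)] by blast
  have "(\<Sum>k\<in>K. e k * y k) = 0" if "y \<in> Y" for y
  proof -
    have "of_int (\<Sum>k\<in>K. e k * y k) = q * (\<Sum>k\<in>K. r k * of_int (y k))"
      by (simp add: e(1) sum_distrib_left mult.assoc)
    then show ?thesis using r(2)[OF that] by (simp only: mult_zero_right of_int_eq_0_iff)
  qed
  then have "p dvd e k" if "k \<in> K" for k using trivial[of e] that by simp
  then have "p dvd Gcd (e ` K)" by (intro Gcd_greatest) auto
  then show False using e(2) \<open>prime p\<close> by (simp add: not_prime_unit)
qed

section \<open>Bilinear forms\<close>

definition bilin :: "('d::finite \<Rightarrow> 'd \<Rightarrow> 'a) \<Rightarrow> ('d \<Rightarrow> 'a) \<Rightarrow> ('d \<Rightarrow> 'a) \<Rightarrow> 'a::comm_ring_1" where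
  "bilin B x y = (\<Sum>i\<in>UNIV. \<Sum>j\<in>UNIV. B i j * x i * y j)"

lemma bilin_sum_left: "bilin B (\<lambda>i. \<Sum>k\<in>S. a k * v k i) y = (\<Sum>k\<in>S. a k * bilin B (v k) y)"
proof -
  have "bilin B (\<lambda>i. \<Sum>k\<in>S. a k * v k i) y = (\<Sum>i\<in>UNIV. \<Sum>k\<in>S. \<Sum>j\<in>UNIV. a k * (B i j * v k i * y j))"
    unfolding bilin_def sum_distrib_left sum_distrib_right
    by (subst sum.swap) (simp add: mult_ac)
  also have "\<dots> = (\<Sum>k\<in>S. \<Sum>i\<in>UNIV. \<Sum>j\<in>UNIV. a k * (B i j * v k i * y j))"
    by (rule sum.swap)
  finally show ?thesis by (simp add: bilin_def sum_distrib_left)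
qed

lemma bilin_flip: "bilin B x y = bilin (\<lambda>i j. B j i) y x"
  unfolding bilin_def by (subst sum.swap) (simp add: mult_ac)

lemma bilin_sum_right: "bilin B x (\<lambda>i. \<Sum>k\<in>S. a k * v k i) = (\<Sum>k\<in>S. a k * bilin B x (v k))"
  by (simp add: bilin_flip[of B x] bilin_sum_left)

lemma bilin_add_scale_unit:
  assumes "\<And>i j. B i j = B j i"
  shows "bilin B (\<lambda>i. h * u i + (if i = k then a else 0)) (\<lambda>i. h * u i + (if i = k then a else 0))
     = h * h * bilin B u u + 2 * h * a * (\<Sum>i\<in>UNIV. B i k * u i) + a * a * B k k"
proof -
  have left: "bilin C (\<lambda>i. h * u i + (if i = k then a else 0)) y
      = h * bilin C u y + a * (\<Sum>j\<in>UNIV. C k j * y j)" for C y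
  proof -
    have "C i j * (h * u i + (if i = k then a else 0)) * y j
        = h * (C i j * u i * y j) + (if i = k then a * (C k j * y j) else 0)" for i j
      by (simp add: algebra_simps)
    then have "bilin C (\<lambda>i. h * u i + (if i = k then a else 0)) y
        = (\<Sum>i\<in>UNIV. \<Sum>j\<in>UNIV. h * (C i j * u i * y j))
          + (\<Sum>j\<in>UNIV. \<Sum>i\<in>UNIV. if i = k then a * (C k j * y j) else 0)"
      unfolding bilin_def by (simp add: sum.distrib sum.swap[of "\<lambda>i j. if i = k then _ j else 0"])
    then show ?thesis by (simp add: bilin_def sum_distrib_left)
  qed
  have bilin_commute: "bilin B u y = bilin B y u" for y
    unfolding bilin_flip[of B u y] by (simp only: assms)
  have "B k j * (h * u j + (if j = k then a else 0))
      = h * (B k j * u j) + (if j = k then a * B k k else 0)" for j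
    by (simp add: algebra_simps)
  then have "(\<Sum>j\<in>UNIV. B k j * (h * u j + (if j = k then a else 0)))
      = h * (\<Sum>j\<in>UNIV. B k j * u j) + a * B k k"
    by (simp add: sum.distrib sum_distrib_left)
  moreover have "bilin B u (\<lambda>i. h * u i + (if i = k then a else 0))
      = h * bilin B u u + a * (\<Sum>j\<in>UNIV. B k j * u j)"
    unfolding bilin_commute[of "\<lambda>i. h * u i + (if i = k then a else 0)"] by (rule left)
  moreover have "(\<Sum>i\<in>UNIV. B i k * u i) = (\<Sum>j\<in>UNIV. B k j * u j)"
    by (rule sum.cong) (simp_all only: assms[of _ k])
  ultimately show ?thesis by (simp only: left) (simp add: algebra_simps)
qed

lemma bilin_cong_mod:
  fixes B :: "'d::finite \<Rightarrow> 'd \<Rightarrow> int"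
  assumes "\<And>i. [x i = x' i] (mod p)" "\<And>i. [y i = y' i] (mod p)"
  shows "[bilin B x y = bilin B x' y'] (mod p)"
  unfolding bilin_def by (intro cong_sum cong_mult cong_refl assms)

lemma bilin_of_int:
  "bilin (\<lambda>i j. of_int (B i j)) (\<lambda>i. of_int (x i)) (\<lambda>i. of_int (y i)) = of_int (bilin B x y)"
  by (simp add: bilin_def)

section \<open>Curves with isotropic points at infinity\<close>

locale isotropic_curve =
  fixes p :: int and B :: "'d::finite \<Rightarrow> 'd \<Rightarrow> int"
    and v :: "'d \<Rightarrow> 'd \<Rightarrow> int" and \<alpha> :: "'d \<Rightarrow> int" and j\<^sub>0 :: 'd
  assumes prime: "prime p"
    and isotropic: "\<And>k. k \<noteq> j\<^sub>0 \<Longrightarrow> p dvd bilin B (v k) (v k)"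
    and anisotropic: "\<not> p dvd bilin B (v j\<^sub>0) (v j\<^sub>0)"
    and spanning: "\<And>c. (\<And>k. p dvd (\<Sum>i\<in>UNIV. c i * v k i)) \<Longrightarrow> p dvd c i"
    and independent: "\<And>l. (\<And>i. p dvd (\<Sum>k\<in>UNIV. l k * v k i)) \<Longrightarrow> p dvd l k"
    and poles: "\<And>k l. k \<noteq> l \<Longrightarrow> \<not> p dvd (\<alpha> k - \<alpha> l)"
begin

definition poles_except :: "'d set \<Rightarrow> int poly" where
  "poles_except A = (\<Prod>l\<in>- A. [:- \<alpha> l, 1:])"

definition curve_poly :: "'d \<Rightarrow> int poly" where
  "curve_poly i = (\<Sum>k\<in>UNIV. Polynomial.smult (v k i) (poles_except {k}))"

definition regular :: "int \<Rightarrow> bool" where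
  "regular t \<longleftrightarrow> (\<forall>k. \<not> p dvd (t - \<alpha> k))"

text \<open>\<open>x\<close> is the point \<open>\<Sum>\<^sub>k v\<^sub>k / (t - \<alpha>\<^sub>k)\<close> modulo \<open>p\<close>.\<close>

definition on_curve :: "int \<Rightarrow> ('d \<Rightarrow> int) \<Rightarrow> bool" where
  "on_curve t x \<longleftrightarrow> (\<forall>i. [poly (poles_except {}) t * x i = poly (curve_poly i) t] (mod p))"

lemma poly_poles_except: "poly (poles_except A) t = (\<Prod>l\<in>- A. (t - \<alpha> l))"
  unfolding poles_except_def by (simp add: poly_prod algebra_simps)

lemma poly_curve_poly: "poly (curve_poly i) t = (\<Sum>k\<in>UNIV. poly (poles_except {k}) t * v k i)"
  by (simp add: curve_poly_def poly_sum mult.commute)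

lemma degree_poles_except: "degree (poles_except A) \<le> CARD('d)"
proof -
  have "degree (poles_except A) \<le> (\<Sum>l\<in>- A. (degree \<circ> (\<lambda>l. [:- \<alpha> l, 1:])) l)"
    unfolding poles_except_def by (rule degree_prod_sum_le) simp
  also have "\<dots> \<le> CARD('d)" by (simp add: card_mono)
  finally show ?thesis .
qed

lemma poly_poles_except_insert:
  assumes "k \<notin> A"
  shows "poly (poles_except A) t = (t - \<alpha> k) * poly (poles_except (insert k A)) t"
proof -
  have "- A = insert k (- insert k A)" using assms by auto
  then show ?thesis unfolding poly_poles_except by (subst \<open>- A = _\<close>, subst prod.insert) auto
qed

lemma poly_poles_except_empty: "poly (poles_except {}) t = (t - \<alpha> k) * poly (poles_except {k}) t"
  by (rule poly_poles_except_insert) simp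

lemma regular_imp_not_dvd: "regular t \<Longrightarrow> \<not> p dvd poly (poles_except A) t"
  unfolding poly_poles_except regular_def using prime by (simp add: prime_dvd_prod_iff)

lemma not_dvd_poles_except_at_pole: "\<not> p dvd poly (poles_except {k}) (\<alpha> k)"
  unfolding poly_poles_except using prime poles[of k] by (auto simp: prime_dvd_prod_iff)

lemma poles_except_at_other_pole: "k \<notin> A \<Longrightarrow> poly (poles_except A) (\<alpha> k) = 0"
  unfolding poly_poles_except by auto

definition affine_poly :: "int \<Rightarrow> ('d \<Rightarrow> int) \<Rightarrow> int poly" where
  "affine_poly c\<^sub>0 c = Polynomial.smult c\<^sub>0 (poles_except {})
      + (\<Sum>i\<in>UNIV. Polynomial.smult (c i) (curve_poly i))"

lemma degree_affine_poly: "degree (affine_poly c\<^sub>0 c) \<le> CARD('d)"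
  unfolding affine_poly_def curve_poly_def
  by (intro degree_add_le degree_sum_le order_trans[OF degree_smult_le] degree_poles_except) auto

lemma affine_poly_on_curve:
  assumes "on_curve t x"
  shows "[poly (poles_except {}) t * (c\<^sub>0 + (\<Sum>i\<in>UNIV. c i * x i))
      = poly (affine_poly c\<^sub>0 c) t] (mod p)"
proof -
  have "poly (poles_except {}) t * (c\<^sub>0 + (\<Sum>i\<in>UNIV. c i * x i))
      = c\<^sub>0 * poly (poles_except {}) t + (\<Sum>i\<in>UNIV. c i * (poly (poles_except {}) t * x i))"
    by (simp add: distrib_left sum_distrib_left mult_ac)
  also have "[\<dots> = c\<^sub>0 * poly (poles_except {}) t + (\<Sum>i\<in>UNIV. c i * poly (curve_poly i) t)] (mod p)"
    using assms unfolding on_curve_def by (intro cong_add cong_sum cong_mult cong_refl) auto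
  finally show ?thesis by (simp add: affine_poly_def poly_sum)
qed

lemma affine_relation_trivial:
  assumes T: "finite T" "card T > CARD('d)" "inj_on (\<lambda>t. t mod p) T"
    and x: "\<And>t. t \<in> T \<Longrightarrow> on_curve t (x t)"
    and rel: "\<And>t. t \<in> T \<Longrightarrow> p dvd c\<^sub>0 + (\<Sum>i\<in>UNIV. c i * x t i)"
  shows "p dvd c\<^sub>0" "p dvd c i"
proof -
  have root: "p dvd poly (affine_poly c\<^sub>0 c) t" for t
  proof (rule prime_dvd_poly_if_many_roots[OF prime T(1) _ T(3)])
    show "degree (affine_poly c\<^sub>0 c) < card T" using degree_affine_poly T(2) by (rule le_less_trans)
    show "p dvd poly (affine_poly c\<^sub>0 c) t" if "t \<in> T" for t
      using cong_dvd_iff[OF affine_poly_on_curve[OF x[OF that]]] rel[OF that] by (metis dvd_mult)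
  qed
  have "p dvd (\<Sum>i\<in>UNIV. c i * v k i)" for k
  proof -
    have "poly (curve_poly i) (\<alpha> k) = poly (poles_except {k}) (\<alpha> k) * v k i" for i
      unfolding poly_curve_poly
      by (subst sum.remove[of _ k]) (auto simp: poles_except_at_other_pole)
    then have "poly (affine_poly c\<^sub>0 c) (\<alpha> k)
        = poly (poles_except {k}) (\<alpha> k) * (\<Sum>i\<in>UNIV. c i * v k i)"
      by (simp add: affine_poly_def poly_sum poles_except_at_other_pole sum_distrib_left mult_ac)
    then show ?thesis
      using root[of "\<alpha> k"] not_dvd_poles_except_at_pole prime by (simp add: prime_dvd_mult_iff)
  qed
  then show c: "p dvd c i" for i by (rule spanning)
  obtain t where "t \<in> T" using T(2) by fastforce
  from rel[OF this] c show "p dvd c\<^sub>0"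
    by (metis (no_types, lifting) dvd_add_left_iff dvd_mult2 dvd_sum)
qed

text \<open>The value of the form on the curve, divided by the common factor \<open>poles_except {j\<^sub>0}\<close>; the
  isotropic members of the basis contribute no double pole.\<close>

definition form_poly :: "int poly" where
  "form_poly = Polynomial.smult (bilin B (v j\<^sub>0) (v j\<^sub>0)) (poles_except {j\<^sub>0})
     + (\<Sum>k\<in>UNIV. \<Sum>l\<in>- {k}. Polynomial.smult (bilin B (v k) (v l)) (poles_except {k, l}))
       * [:- \<alpha> j\<^sub>0, 1:]"

lemma poles_except_mult:
  assumes "k \<noteq> l"
  shows "poly (poles_except {k}) t * poly (poles_except {l}) t
     = poly (poles_except {j}) t * (t - \<alpha> j) * poly (poles_except {k, l}) t"
proof -
  have "poly (poles_except {k}) t * poly (poles_except {l}) t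
      = poly (poles_except {}) t * poly (poles_except {k, l}) t"
    using poly_poles_except_insert[of k "{l}" t] assms
    by (simp add: poly_poles_except_empty[of t k] mult_ac)
  then show ?thesis by (simp add: poly_poles_except_empty[of t j] mult_ac)
qed

lemma form_on_curve_poly:
  "[bilin B (\<lambda>i. poly (curve_poly i) t) (\<lambda>i. poly (curve_poly i) t)
      = poly (poles_except {j\<^sub>0}) t * poly form_poly t] (mod p)"
proof -
  define E where "E k = poly (poles_except {k}) t" for k
  define b where "b k l = bilin B (v k) (v l)" for k l
  define S where "S = (\<Sum>k\<in>UNIV. \<Sum>l\<in>- {k}. b k l * poly (poles_except {k, l}) t)"
  have "bilin B (\<lambda>i. poly (curve_poly i) t) (\<lambda>i. poly (curve_poly i) t)
      = (\<Sum>k\<in>UNIV. \<Sum>l\<in>UNIV. E k * (E l * b k l))"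
    by (simp add: poly_curve_poly E_def b_def bilin_sum_left bilin_sum_right sum_distrib_left)
  also have "\<dots> = (\<Sum>k\<in>UNIV. E k * (E k * b k k)) + (\<Sum>k\<in>UNIV. \<Sum>l\<in>- {k}. E k * (E l * b k l))"
  proof -
    have "(\<Sum>l\<in>UNIV. E k * (E l * b k l))
        = E k * (E k * b k k) + (\<Sum>l\<in>- {k}. E k * (E l * b k l))" for k
      unfolding Compl_eq_Diff_UNIV by (rule sum.remove) auto
    then show ?thesis by (simp add: sum.distrib)
  qed
  also have "(\<Sum>k\<in>UNIV. \<Sum>l\<in>- {k}. E k * (E l * b k l)) = E j\<^sub>0 * (t - \<alpha> j\<^sub>0) * S"
    unfolding S_def sum_distrib_left
  proof (intro sum.cong refl)
    fix k l :: 'd assume "l \<in> - {k}"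
    then show "E k * (E l * b k l) = E j\<^sub>0 * (t - \<alpha> j\<^sub>0) * (b k l * poly (poles_except {k, l}) t)"
      using poles_except_mult[of k l t j\<^sub>0] by (auto simp: E_def mult.assoc[symmetric])
  qed
  also have "[(\<Sum>k\<in>UNIV. E k * (E k * b k k)) + E j\<^sub>0 * (t - \<alpha> j\<^sub>0) * S
      = E j\<^sub>0 * (E j\<^sub>0 * b j\<^sub>0 j\<^sub>0) + E j\<^sub>0 * (t - \<alpha> j\<^sub>0) * S] (mod p)"
  proof (intro cong_add cong_refl)
    have "p dvd (\<Sum>k\<in>UNIV - {j\<^sub>0}. E k * (E k * b k k))"
      by (intro dvd_sum dvd_mult) (use isotropic in \<open>auto simp: b_def\<close>)
    then show "[(\<Sum>k\<in>UNIV. E k * (E k * b k k)) = E j\<^sub>0 * (E j\<^sub>0 * b j\<^sub>0 j\<^sub>0)] (mod p)"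
      by (subst sum.remove[of _ j\<^sub>0]) (auto simp: cong_iff_dvd_diff)
  qed
  also have "E j\<^sub>0 * (E j\<^sub>0 * b j\<^sub>0 j\<^sub>0) + E j\<^sub>0 * (t - \<alpha> j\<^sub>0) * S
      = poly (poles_except {j\<^sub>0}) t * poly form_poly t"
    by (simp add: form_poly_def E_def S_def b_def poly_sum algebra_simps)
  finally show ?thesis .
qed

lemma quadratic_poly_on_curve:
  assumes x: "on_curve t x"
  shows "[(poly (poles_except {}) t)\<^sup>2 * (c\<^sub>0 + (\<Sum>i\<in>UNIV. c i * x i) + c' * bilin B x x)
     = poly (poles_except {j\<^sub>0}) t
       * poly (affine_poly c\<^sub>0 c * [:- \<alpha> j\<^sub>0, 1:] + Polynomial.smult c' form_poly) t] (mod p)"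
proof -
  define g where "g = poly (poles_except {}) t"
  have "g * g * bilin B x x = bilin B (\<lambda>i. g * x i) (\<lambda>i. g * x i)"
    by (simp add: bilin_def sum_distrib_left mult_ac)
  also have "[\<dots> = bilin B (\<lambda>i. poly (curve_poly i) t) (\<lambda>i. poly (curve_poly i) t)] (mod p)"
    using x by (intro bilin_cong_mod) (auto simp: g_def on_curve_def)
  finally have form: "[g * g * bilin B x x
      = poly (poles_except {j\<^sub>0}) t * poly form_poly t] (mod p)"
    using form_on_curve_poly by (rule cong_trans)
  have "g\<^sup>2 * (c\<^sub>0 + (\<Sum>i\<in>UNIV. c i * x i) + c' * bilin B x x)
      = g * (g * (c\<^sub>0 + (\<Sum>i\<in>UNIV. c i * x i))) + c' * (g * g * bilin B x x)"
    by (simp add: power2_eq_square algebra_simps)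
  also have "[\<dots> = g * poly (affine_poly c\<^sub>0 c) t
      + c' * (poly (poles_except {j\<^sub>0}) t * poly form_poly t)] (mod p)"
    unfolding g_def
    by (intro cong_add cong_mult cong_refl affine_poly_on_curve x form[unfolded g_def])
  also have "g * poly (affine_poly c\<^sub>0 c) t + c' * (poly (poles_except {j\<^sub>0}) t * poly form_poly t)
      = poly (poles_except {j\<^sub>0}) t
        * poly (affine_poly c\<^sub>0 c * [:- \<alpha> j\<^sub>0, 1:] + Polynomial.smult c' form_poly) t"
    unfolding g_def poly_poles_except_empty[of t j\<^sub>0] by (simp add: algebra_simps)
  finally show ?thesis unfolding g_def .
qed

lemma quadratic_relation_trivial:
  assumes T: "finite T" "card T > CARD('d) + 1" "inj_on (\<lambda>t. t mod p) T" "\<And>t. t \<in> T \<Longrightarrow> regular t"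
    and x: "\<And>t. t \<in> T \<Longrightarrow> on_curve t (x t)"
    and rel: "\<And>t. t \<in> T \<Longrightarrow> p dvd c\<^sub>0 + (\<Sum>i\<in>UNIV. c i * x t i) + c' * bilin B (x t) (x t)"
  shows "p dvd c\<^sub>0" "p dvd c i" "p dvd c'"
proof -
  define P where "P = affine_poly c\<^sub>0 c * [:- \<alpha> j\<^sub>0, 1:] + Polynomial.smult c' form_poly"
  have degree_mult_X: "degree (q * [:- \<alpha> j\<^sub>0, 1:]) \<le> CARD('d) + 1" if "degree q \<le> CARD('d)" for q
    using that degree_mult_le[of q "[:- \<alpha> j\<^sub>0, 1:]"] by simp
  have "degree P \<le> CARD('d) + 1"
    unfolding P_def form_poly_def
    by (intro degree_add_le degree_mult_X degree_affine_poly degree_sum_le degree_poles_except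
        order_trans[OF degree_smult_le] le_trans[OF degree_poles_except]) auto
  then have "degree P < card T" using T(2) by simp
  have root: "p dvd poly P t" for t
  proof (rule prime_dvd_poly_if_many_roots[OF prime T(1) \<open>degree P < card T\<close> T(3)])
    fix t assume t: "t \<in> T"
    have "p dvd poly (poles_except {j\<^sub>0}) t * poly P t"
      unfolding P_def
      by (rule cong_dvd_iff[OF quadratic_poly_on_curve[OF x[OF t]], THEN iffD1])
         (rule dvd_mult[OF rel[OF t]])
    then show "p dvd poly P t"
      using regular_imp_not_dvd[OF T(4)[OF t]] prime by (simp add: prime_dvd_mult_iff)
  qed
  have "poly P (\<alpha> j\<^sub>0) = c' * (bilin B (v j\<^sub>0) (v j\<^sub>0) * poly (poles_except {j\<^sub>0}) (\<alpha> j\<^sub>0))"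
    by (simp add: P_def form_poly_def)
  then show c': "p dvd c'"
    using root[of "\<alpha> j\<^sub>0"] anisotropic not_dvd_poles_except_at_pole prime
    by (auto simp: prime_dvd_mult_iff)
  have affine_rel: "p dvd c\<^sub>0 + (\<Sum>i\<in>UNIV. c i * x t i)" if "t \<in> T" for t
    using rel[OF that] dvd_add_left_iff[OF dvd_mult2[OF c']] by simp
  have "card T > CARD('d)" using T(2) by simp
  from affine_relation_trivial[OF T(1) this T(3) x affine_rel] show "p dvd c\<^sub>0" "p dvd c i" by auto
qed

lemma on_curve_inj:
  assumes "regular s" "regular t" "on_curve s x" "on_curve t x"
  shows "s mod p = t mod p"
proof -
  define g where "g = poly (poles_except {})"
  define E where "E k = poly (poles_except {k})" for k
  define l where "l k = g t * E k s - g s * E k t" for k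
  have "p dvd l j\<^sub>0"
  proof (rule independent)
    fix i
    have "[g u * x i = poly (curve_poly i) u] (mod p)" if "on_curve u x" for u
      using that unfolding on_curve_def g_def by blast
    then have "[g t * (g s * x i) - g s * (g t * x i)
        = g t * poly (curve_poly i) s - g s * poly (curve_poly i) t] (mod p)"
      using assms(3,4) by (intro cong_diff cong_mult cong_refl) auto
    moreover have "g t * poly (curve_poly i) s - g s * poly (curve_poly i) t
        = (\<Sum>k\<in>UNIV. l k * v k i)"
      by (simp add: l_def E_def poly_curve_poly sum_distrib_left left_diff_distrib sum_subtractf
          mult.assoc)
    ultimately show "p dvd (\<Sum>k\<in>UNIV. l k * v k i)"
      by (simp add: mult.left_commute cong_iff_dvd_diff)
  qed
  also have "l j\<^sub>0 = E j\<^sub>0 s * E j\<^sub>0 t * (t - s)"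
    unfolding l_def g_def E_def poly_poles_except_empty[of _ j\<^sub>0] by (simp add: algebra_simps)
  finally have "p dvd t - s"
    using regular_imp_not_dvd assms prime by (simp add: E_def prime_dvd_mult_iff)
  then show ?thesis by (metis mod_eq_dvd_iff)
qed

lemma exists_on_curve:
  assumes "regular t"
  obtains x where "on_curve t x" "\<And>i. 1 \<le> x i \<and> x i \<le> p"
proof -
  define g where "g = poly (poles_except {}) t"
  have "coprime g p"
    using regular_imp_not_dvd[OF assms] prime by (simp add: g_def prime_imp_coprime coprime_commute)
  then obtain r where r: "[g * r = 1] (mod p)" using cong_solve_coprime_int by blast
  define x where "x i = 1 + (r * poly (curve_poly i) t - 1) mod p" for i
  have "[g * x i = poly (curve_poly i) t] (mod p)" for i
  proof -
    have "[x i = 1 + (r * poly (curve_poly i) t - 1)] (mod p)"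
      unfolding x_def by (intro cong_add cong_refl) (simp add: cong_def)
    then have "[g * x i = g * (r * poly (curve_poly i) t)] (mod p)"
      by (intro cong_mult cong_refl) simp
    also have "g * (r * poly (curve_poly i) t) = (g * r) * poly (curve_poly i) t" by simp
    also have "[\<dots> = 1 * poly (curve_poly i) t] (mod p)" by (intro cong_mult cong_refl r)
    finally show ?thesis by simp
  qed
  then have "on_curve t x" by (simp add: on_curve_def g_def)
  moreover have "1 \<le> x i \<and> x i \<le> p" for i
    using pos_mod_bound[OF prime_gt_0_int[OF prime]] pos_mod_sign[OF prime_gt_0_int[OF prime]]
    unfolding x_def by (smt (verit))
  ultimately show ?thesis by (rule that)
qed

end

definition skew_basis :: "'d \<Rightarrow> ('d \<Rightarrow> int) \<Rightarrow> int \<Rightarrow> ('d \<Rightarrow> int) \<Rightarrow> 'd \<Rightarrow> 'd \<Rightarrow> int" where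
  "skew_basis j\<^sub>0 u a h k i = (if k = j\<^sub>0 then u i else h k * u i + (if i = k then a else 0))"

lemma skew_basis_spanning:
  fixes u :: "'d::finite \<Rightarrow> int"
  assumes p: "prime p" "\<not> p dvd a" and u: "u j\<^sub>0 = 1"
    and c: "\<And>k. p dvd (\<Sum>i\<in>UNIV. c i * skew_basis j\<^sub>0 u a h k i)"
  shows "p dvd c i"
proof -
  have sum_cu: "p dvd (\<Sum>i\<in>UNIV. c i * u i)" using c[of j\<^sub>0] by (simp add: skew_basis_def)
  have off_j0: "p dvd c k" if k: "k \<noteq> j\<^sub>0" for k
  proof -
    have "(\<Sum>i\<in>UNIV. c i * skew_basis j\<^sub>0 u a h k i)
        = (\<Sum>i\<in>UNIV. h k * (c i * u i) + (if i = k then c i * a else 0))"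
      using k by (intro sum.cong) (auto simp: skew_basis_def algebra_simps)
    also have "\<dots> = h k * (\<Sum>i\<in>UNIV. c i * u i) + c k * a"
      by (simp add: sum.distrib sum_distrib_left)
    finally have "p dvd c k * a" using c[of k] sum_cu by (metis dvd_add_right_iff dvd_mult)
    then show ?thesis using p by (simp add: prime_dvd_mult_iff)
  qed
  have "(\<Sum>i\<in>UNIV. c i * u i) = c j\<^sub>0 + (\<Sum>i\<in>UNIV - {j\<^sub>0}. c i * u i)"
    using u by (subst sum.remove[of _ j\<^sub>0]) auto
  moreover have "p dvd (\<Sum>i\<in>UNIV - {j\<^sub>0}. c i * u i)" using off_j0 by (intro dvd_sum dvd_mult2) auto
  ultimately have "p dvd c j\<^sub>0" using sum_cu by (metis dvd_add_left_iff)
  then show ?thesis using off_j0 by (cases "i = j\<^sub>0") auto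
qed

lemma skew_basis_independent:
  fixes u :: "'d::finite \<Rightarrow> int"
  assumes p: "prime p" "\<not> p dvd a" and u: "u j\<^sub>0 = 1"
    and l: "\<And>i. p dvd (\<Sum>k\<in>UNIV. l k * skew_basis j\<^sub>0 u a h k i)"
  shows "p dvd l k"
proof -
  define S where "S = l j\<^sub>0 + (\<Sum>k\<in>UNIV - {j\<^sub>0}. l k * h k)"
  have sum_eq: "(\<Sum>k\<in>UNIV. l k * skew_basis j\<^sub>0 u a h k i)
      = S * u i + (if i = j\<^sub>0 then 0 else l i * a)" for i
  proof -
    have "(\<Sum>k\<in>UNIV. l k * skew_basis j\<^sub>0 u a h k i)
        = l j\<^sub>0 * u i + (\<Sum>k\<in>UNIV - {j\<^sub>0}. l k * skew_basis j\<^sub>0 u a h k i)"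
      by (subst sum.remove[of _ j\<^sub>0]) (auto simp: skew_basis_def)
    also have "(\<Sum>k\<in>UNIV - {j\<^sub>0}. l k * skew_basis j\<^sub>0 u a h k i)
        = (\<Sum>k\<in>UNIV - {j\<^sub>0}. l k * h k * u i + (if i = k then l k * a else 0))"
      by (intro sum.cong refl) (simp add: skew_basis_def distrib_left)
    also have "l j\<^sub>0 * u i + \<dots> = S * u i + (\<Sum>k\<in>UNIV - {j\<^sub>0}. if i = k then l k * a else 0)"
      by (simp add: S_def sum.distrib sum_distrib_right distrib_right)
    finally show ?thesis by simp
  qed
  have S: "p dvd S" using l[of j\<^sub>0] sum_eq[of j\<^sub>0] u by simp
  have off_j0: "p dvd l k" if "k \<noteq> j\<^sub>0" for k
  proof -
    have "p dvd S * u k + l k * a" using l[of k] sum_eq[of k] that by simp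
    then have "p dvd l k * a" using S by (metis dvd_add_right_iff dvd_mult2)
    then show ?thesis using p by (simp add: prime_dvd_mult_iff)
  qed
  have "p dvd (\<Sum>k\<in>UNIV - {j\<^sub>0}. l k * h k)" using off_j0 by (intro dvd_sum dvd_mult2) auto
  then have "p dvd l j\<^sub>0" using S unfolding S_def by (metis dvd_add_left_iff)
  then show ?thesis using off_j0 by (cases "k = j\<^sub>0") auto
qed

text \<open>The form on the line \<open>h u + a e\<^sub>k\<close> is a quadratic polynomial in \<open>h\<close>, which has a root modulo \<open>p\<close>
  because its discriminant is a square.\<close>

theorem isotropic_curve_exists:
  fixes B :: "'d::finite \<Rightarrow> 'd \<Rightarrow> int" and u :: "'d \<Rightarrow> int"
  assumes p: "prime p" and sym: "\<And>i j. B i j = B j i" and u: "u j\<^sub>0 = 1" "\<not> p dvd bilin B u u"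
    and disc: "\<And>k. QuadRes p ((\<Sum>i\<in>UNIV. B i k * u i)\<^sup>2 - bilin B u u * B k k)"
    and poles: "\<And>k l. k \<noteq> l \<Longrightarrow> \<not> p dvd (\<alpha> k - \<alpha> l)"
  obtains v where "isotropic_curve p B v \<alpha> j\<^sub>0"
proof -
  define a where "a = bilin B u u"
  define b where "b k = (\<Sum>i\<in>UNIV. B i k * u i)" for k
  obtain y where y: "\<And>k. [(y k)\<^sup>2 = (b k)\<^sup>2 - a * B k k] (mod p)"
    using disc unfolding QuadRes_def a_def b_def by metis
  define h where "h k = y k - b k" for k
  have "isotropic_curve p B (skew_basis j\<^sub>0 u a h) \<alpha> j\<^sub>0"
  proof
    fix k assume k: "k \<noteq> j\<^sub>0"
    have "bilin B (skew_basis j\<^sub>0 u a h k) (skew_basis j\<^sub>0 u a h k)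
        = h k * h k * a + 2 * h k * a * b k + a * a * B k k"
      using k bilin_add_scale_unit[of B "h k" u k a, OF sym]
      unfolding a_def[symmetric] b_def[symmetric]
      by (simp add: skew_basis_def[abs_def])
    also have "\<dots> = a * ((y k)\<^sup>2 - ((b k)\<^sup>2 - a * B k k))"
      by (simp add: h_def power2_eq_square algebra_simps)
    finally show "p dvd bilin B (skew_basis j\<^sub>0 u a h k) (skew_basis j\<^sub>0 u a h k)"
      using y[of k] by (simp add: cong_iff_dvd_diff)
  next
    show "\<not> p dvd bilin B (skew_basis j\<^sub>0 u a h j\<^sub>0) (skew_basis j\<^sub>0 u a h j\<^sub>0)"
      using u(2) by (simp add: skew_basis_def[abs_def])
  next
    have "\<not> p dvd a" using u(2) by (simp add: a_def)
    then show "p dvd c i" if "\<And>k. p dvd (\<Sum>i\<in>UNIV. c i * skew_basis j\<^sub>0 u a h k i)" for c i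
      using skew_basis_spanning[OF p _ u(1) that] by blast
    show "p dvd l k" if "\<And>i. p dvd (\<Sum>k\<in>UNIV. l k * skew_basis j\<^sub>0 u a h k i)" for l k
      using skew_basis_independent[OF p \<open>\<not> p dvd a\<close> u(1) that] .
  qed (use p poles in auto)
  then show ?thesis by (rule that)
qed

section \<open>Polynomials of degree at most two\<close>

definition monom_eval :: "('d::finite \<Rightarrow>\<^sub>0 nat) \<Rightarrow> real ^ 'd \<Rightarrow> real" where
  "monom_eval m x = (\<Prod>i\<in>UNIV. (x $ i) ^ Poly_Mapping.lookup m i)"

definition unit_monom :: "'d \<Rightarrow> 'd \<Rightarrow>\<^sub>0 nat" where
  "unit_monom i = Poly_Mapping.single i 1"

lemma lookup_unit_monom: "Poly_Mapping.lookup (unit_monom i) k = (if i = k then 1 else 0)"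
  by (simp add: unit_monom_def lookup_single when_def)

lemma unit_monom_eq_iff: "unit_monom i = unit_monom j \<longleftrightarrow> i = j"
  by (metis lookup_unit_monom zero_neq_one)

lemma unit_monom_nonzero: "unit_monom i \<noteq> 0"
  by (metis lookup_unit_monom lookup_zero zero_neq_one)

lemma eval_mpoly_eq:
  "eval_mpoly p x = (\<Sum>m\<in>Poly_Mapping.keys p. Poly_Mapping.lookup p m * monom_eval m x)"
  by (simp add: eval_mpoly_def monom_eval_def)

lemma monom_eval_0: "monom_eval 0 x = 1"
  by (simp add: monom_eval_def)

lemma monom_eval_add: "monom_eval (m + n) x = monom_eval m x * monom_eval n x"
  by (simp add: monom_eval_def lookup_add power_add prod.distrib)

lemma monom_eval_unit_monom: "monom_eval (unit_monom i) x = x $ i"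
  by (simp add: monom_eval_def lookup_unit_monom if_distrib[of "\<lambda>e. _ ^ e"] cong: if_cong)

lemma monom_degree_eq_0_iff: "monom_degree m = 0 \<longleftrightarrow> m = 0"
  by (auto simp: monom_degree_def poly_mapping_eq_iff fun_eq_iff)

lemma monom_degree_SucE:
  assumes "monom_degree m = Suc k"
  obtains i n where "m = n + unit_monom i" "monom_degree n = k"
proof -
  have "(\<Sum>i\<in>UNIV. Poly_Mapping.lookup m i) \<noteq> 0" using assms by (simp add: monom_degree_def)
  then obtain i where i: "Poly_Mapping.lookup m i \<noteq> 0" by (meson sum.neutral)
  define n where "n = m - unit_monom i"
  have m: "m = n + unit_monom i"
    using i
    by (auto simp: n_def poly_mapping_eq_iff fun_eq_iff lookup_add lookup_minus lookup_unit_monom)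
  then have "monom_degree m = monom_degree n + 1"
    by (simp add: monom_degree_def lookup_add sum.distrib lookup_unit_monom)
  then show ?thesis using that[OF m] assms by simp
qed

lemma eval_mpoly_affine:
  fixes f :: "('d::finite, real) mpoly"
  assumes "total_degree f \<le> 1"
  shows "eval_mpoly f x = Poly_Mapping.lookup f 0 + (\<chi> i. Poly_Mapping.lookup f (unit_monom i)) \<bullet> x"
proof -
  let ?e = "\<lambda>i::'d. unit_monom i"
  have "m \<in> insert 0 (range ?e)" if "m \<in> Poly_Mapping.keys f" for m
  proof -
    have "monom_degree m \<le> total_degree f"
      unfolding total_degree_def using that by (intro Max_ge) auto
    then have "monom_degree m = 0 \<or> monom_degree m = Suc 0" using assms by linarith
    then show ?thesis by (auto simp: monom_degree_eq_0_iff elim!: monom_degree_SucE)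
  qed
  then have "eval_mpoly f x = (\<Sum>m\<in>insert 0 (range ?e). Poly_Mapping.lookup f m * monom_eval m x)"
    unfolding eval_mpoly_eq by (intro sum.mono_neutral_left) (auto simp: in_keys_iff)
  also have "\<dots> = Poly_Mapping.lookup f 0 + (\<Sum>m\<in>range ?e. Poly_Mapping.lookup f m * monom_eval m x)"
    by (subst sum.insert) (auto simp: monom_eval_0 unit_monom_nonzero[symmetric])
  also have "(\<Sum>m\<in>range ?e. Poly_Mapping.lookup f m * monom_eval m x)
      = (\<Sum>i\<in>UNIV. Poly_Mapping.lookup f (?e i) * x $ i)"
    by (subst sum.reindex) (auto simp: inj_def monom_eval_unit_monom simp: unit_monom_eq_iff)
  finally show ?thesis by (simp add: inner_vec_def)
qed

definition polar_matrix :: "('d::finite, real) mpoly \<Rightarrow> 'd \<Rightarrow> 'd \<Rightarrow> real" where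
  "polar_matrix Q i j = (if i = j then 2 else 1)
      * Poly_Mapping.lookup Q (unit_monom i + unit_monom j)"

lemma polar_matrix_commute: "polar_matrix Q i j = polar_matrix Q j i"
  by (simp add: polar_matrix_def add.commute)

lemma quadratic_form_keyE:
  assumes "quadratic_form Q" "m \<in> Poly_Mapping.keys Q"
  obtains i j where "m = unit_monom i + unit_monom j"
proof -
  have "monom_degree m = Suc (Suc 0)" using assms by (simp add: quadratic_form_def homogeneous_def)
  then obtain j n where n: "m = n + unit_monom j" "monom_degree n = Suc 0"
    by (rule monom_degree_SucE)
  from n(2) obtain i n' where "n = n' + unit_monom i" "monom_degree n' = 0"
    by (rule monom_degree_SucE)
  then show ?thesis using that[of i j] n(1) by (simp add: monom_degree_eq_0_iff)
qed

lemma polar_matrix_nonzero: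
  assumes "quadratic_form Q" "Q \<noteq> 0"
  obtains i j where "polar_matrix Q i j \<noteq> 0"
proof -
  obtain m where m: "m \<in> Poly_Mapping.keys Q"
    using assms(2) by (metis all_not_in_conv keys_eq_empty)
  obtain i j where "m = unit_monom i + unit_monom j"
    using quadratic_form_keyE[OF assms(1) m] .
  then show ?thesis using m that[of i j] by (simp add: polar_matrix_def in_keys_iff)
qed

lemma unit_monom_add_eq_iff:
  "unit_monom a + unit_monom b = unit_monom i + unit_monom j
     \<longleftrightarrow> (a = i \<and> b = j) \<or> (a = j \<and> b = i)"
proof
  assume eq: "unit_monom a + unit_monom b = unit_monom i + unit_monom j"
  have count: "(if a = k then 1 else 0) + (if b = k then 1 else 0)
      = (if i = k then 1 else 0) + (if j = k then 1 else 0 :: nat)" for k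
    using arg_cong[OF eq, of "\<lambda>m. Poly_Mapping.lookup m k"] unfolding lookup_add lookup_unit_monom .
  show "(a = i \<and> b = j) \<or> (a = j \<and> b = i)"
  proof (cases "a = i")
    case True
    then show ?thesis using count[of b] by (simp split: if_splits)
  next
    case False
    then have "a = j" "b = i" using count[of a] count[of i] by (simp_all split: if_splits)
    then show ?thesis by simp
  qed
qed (auto simp: add.commute)

lemma eval_quadratic_form:
  fixes Q :: "('d::finite, real) mpoly"
  assumes "quadratic_form Q"
  shows "2 * eval_mpoly Q x = bilin (polar_matrix Q) (($) x) (($) x)"
proof -
  define e where "e = (\<lambda>(i::'d, j). unit_monom i + unit_monom j)"
  define w where "w z = (if fst z = snd z then 2 else 1 :: real)" for z :: "'d \<times> 'd"
  define f where "f m = Poly_Mapping.lookup Q m * monom_eval m x" for m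
  have weight: "(\<Sum>z | e z = m. w z) = 2" if m: "m \<in> Poly_Mapping.keys Q" for m
  proof -
    obtain i j where "m = e (i, j)" using quadratic_form_keyE[OF assms m] by (auto simp: e_def)
    then have "{z. e z = m} = {(i, j), (j, i)}" by (auto simp: e_def unit_monom_add_eq_iff)
    then show ?thesis by (cases "i = j") (simp_all add: w_def)
  qed
  have "bilin (polar_matrix Q) (($) x) (($) x) = (\<Sum>z\<in>UNIV. w z * f (e z))"
    unfolding UNIV_Times_UNIV[symmetric] bilin_def
    by (simp add: sum.cartesian_product case_prod_unfold polar_matrix_def w_def f_def e_def
        monom_eval_add monom_eval_unit_monom mult.assoc)
  also have "\<dots> = (\<Sum>z | e z \<in> Poly_Mapping.keys Q. w z * f (e z))"
    by (rule sum.mono_neutral_right) (auto simp: f_def in_keys_iff)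
  also have "\<dots> = (\<Sum>m\<in>Poly_Mapping.keys Q.
      \<Sum>z\<in>{z \<in> {z. e z \<in> Poly_Mapping.keys Q}. e z = m}. w z * f (e z))"
    by (rule sum.group[symmetric]) auto
  also have "\<dots> = (\<Sum>m\<in>Poly_Mapping.keys Q. (\<Sum>z | e z = m. w z) * f m)"
    unfolding sum_distrib_right by (intro sum.cong) auto
  also have "\<dots> = 2 * eval_mpoly Q x"
    by (simp add: weight eval_mpoly_eq f_def sum_distrib_left)
  finally show ?thesis ..
qed

definition represents_multiple :: "('d::finite \<Rightarrow> 'd \<Rightarrow> int) \<Rightarrow> ('d, real) mpoly \<Rightarrow> bool" where
  "represents_multiple B Q
     \<longleftrightarrow> (\<exists>s\<noteq>0. \<forall>x. s * eval_mpoly Q x = bilin (\<lambda>i j. of_int (B i j)) (($) x) (($) x))"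

lemma quadratic_form_int_matrix:
  fixes Q :: "('d::finite, real) mpoly"
  assumes Q: "quadratic_form Q" "Q \<noteq> 0" and rat: "\<forall>m. Poly_Mapping.lookup Q m \<in> \<rat>"
  obtains B i j where "represents_multiple B Q" "\<And>i j. B i j = B j i" "B i j \<noteq> 0"
proof -
  define S where "S = (\<lambda>(i, j). polar_matrix Q i j) ` UNIV"
  have "S \<subseteq> \<rat>" using rat by (auto simp: S_def polar_matrix_def)
  then obtain N :: int where N: "N > 0" "\<And>y. y \<in> S \<Longrightarrow> of_int N * y \<in> \<int>"
    using common_denominator[of S] unfolding S_def by auto
  define B where "B i j = \<lfloor>of_int N * polar_matrix Q i j\<rfloor>" for i j
  have B: "of_int (B i j) = of_int N * polar_matrix Q i j" for i j
  proof -
    have "of_int N * polar_matrix Q i j \<in> \<int>" by (rule N(2)) (auto simp: S_def)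
    then show ?thesis by (auto simp: B_def elim: Ints_cases)
  qed
  obtain i j where "polar_matrix Q i j \<noteq> 0" using polar_matrix_nonzero[OF Q] .
  show ?thesis
  proof (rule that[of B i j])
    have "2 * of_int N * eval_mpoly Q x = bilin (\<lambda>i j. of_int (B i j)) (($) x) (($) x)" for x
      using eval_quadratic_form[OF Q(1), of x] by (simp add: B bilin_def sum_distrib_left mult_ac)
    then show "represents_multiple B Q"
      unfolding represents_multiple_def using N(1) by (intro exI[of _ "2 * of_int N"]) auto
    show "B i j = B j i" for i j by (simp add: B_def polar_matrix_commute)
    have "real_of_int (B i j) \<noteq> 0" using B[of i j] N(1) \<open>polar_matrix Q i j \<noteq> 0\<close> by simp
    then show "B i j \<noteq> 0" by simp
  qed
qed

lemma exists_anisotropic_int_vector: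
  fixes B :: "'d::finite \<Rightarrow> 'd \<Rightarrow> int"
  assumes sym: "\<And>i j. B i j = B j i" and nonzero: "B i j \<noteq> 0"
  obtains u j\<^sub>0 where "u j\<^sub>0 = 1" "bilin B u u \<noteq> 0"
proof -
  define e where "e k l = (if l = k then 1 else 0 :: int)" for k l :: 'd
  have diag: "bilin B (e k) (e k) = B k k" for k
    using bilin_add_scale_unit[of B 0 "\<lambda>_. 0" k 1, OF sym] by (simp add: e_def[abs_def])
  show ?thesis
  proof (cases "\<exists>k. B k k \<noteq> 0")
    case True
    then obtain k where "B k k \<noteq> 0" by blast
    then show ?thesis using diag[of k] by (intro that[of "e k" k]) (auto simp: e_def)
  next
    case False
    then have "i \<noteq> j" using nonzero by auto
    define u where "u = (\<lambda>l. 1 * e i l + (if l = j then 1 else 0))"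
    have "(\<Sum>l\<in>UNIV. B l j * e i l) = B i j" by (simp add: e_def if_distrib cong: if_cong)
    then have "bilin B u u = 2 * B i j"
      unfolding u_def bilin_add_scale_unit[of B, OF sym] diag using False by simp
    then show ?thesis
      using nonzero \<open>i \<noteq> j\<close> by (intro that[of u i]) (auto simp: u_def e_def)
  qed
qed

section \<open>General position in grids\<close>

lemma finite_grid: "finite (grid n :: (real^'d::finite) set)"
proof -
  have "vec_nth ` (grid n :: (real^'d) set) \<subseteq> PiE UNIV (\<lambda>_. real ` {1..n})"
    by (auto simp: grid_def)
  moreover have "finite (PiE (UNIV :: 'd set) (\<lambda>_. real ` {1..n}))" by (intro finite_PiE) auto
  ultimately have "finite (vec_nth ` (grid n :: (real^'d) set))" by (rule finite_subset)
  then show ?thesis by (rule finite_imageD) (auto simp: inj_on_def vec_eq_iff)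
qed

lemma grid_mono: "m \<le> n \<Longrightarrow> grid m \<subseteq> grid n"
  by (force simp: grid_def)

lemma finite_general_position_cards:
  fixes Q :: "('d::finite, real) mpoly"
  assumes "finite A"
  shows "finite {card D | D. D \<subseteq> A \<and> general_position Q D}"
proof -
  have "{card D | D. D \<subseteq> A \<and> general_position Q D} \<subseteq> card ` Pow A" by auto
  then show ?thesis by (rule finite_subset) (simp add: assms)
qed

lemma max_general_position_ge:
  assumes "finite A" "D \<subseteq> A" "general_position Q D"
  shows "card D \<le> max_general_position Q A"
  unfolding max_general_position_def
  by (rule Max_ge[OF finite_general_position_cards]) (use assms in blast)+

lemma general_position_card_hyperplane_le:
  fixes Q :: "('d::finite, real) mpoly"
  assumes "general_position Q D" "is_hyperplane H"
  shows "card (D \<inter> H) \<le> CARD('d)"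
proof (rule ccontr)
  assume "\<not> card (D \<inter> H) \<le> CARD('d)"
  then obtain S where "S \<subseteq> D \<inter> H" "card S = CARD('d) + 1"
    by (metis Suc_eq_plus1 not_less_eq_eq obtain_subset_with_card_n)
  then have "S \<subseteq> D \<and> card S = CARD('d) + 1 \<and> (\<exists>H. is_hyperplane H \<and> S \<subseteq> H)"
    using assms(2) by blast
  then show False using assms(1) unfolding general_position_def by metis
qed

lemma general_position_card_le:
  fixes Q :: "('d::finite, real) mpoly"
  assumes D: "D \<subseteq> grid n" "general_position Q D"
  shows "card D \<le> CARD('d) * n"
proof -
  fix i :: 'd
  define H where "H k = {x :: real^'d. axis i 1 \<bullet> x = real k}" for k
  have "is_hyperplane (H k)" for k
    unfolding is_hyperplane_def H_def
    by (intro exI[of _ "axis i 1"] exI[of _ "real k"]) (simp add: axis_eq_0_iff)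
  note hyperplane = general_position_card_hyperplane_le[OF D(2) this]
  have "D = (\<Union>k\<in>{1..n}. D \<inter> H k)" using D(1) by (auto simp: H_def grid_def inner_axis')
  then have "card D = card (\<Union>k\<in>{1..n}. D \<inter> H k)" by (rule arg_cong)
  also have "\<dots> \<le> (\<Sum>k\<in>{1..n}. card (D \<inter> H k))" by (rule card_UN_le) simp
  also have "\<dots> \<le> (\<Sum>k\<in>{1..n}. CARD('d))" by (intro sum_mono hyperplane)
  finally show ?thesis by (simp add: mult.commute)
qed

theorem max_general_position_grid_le:
  fixes Q :: "('d::finite, real) mpoly"
  shows "max_general_position Q (grid n) \<le> CARD('d) * n"
  unfolding max_general_position_def
proof (rule Max.boundedI[OF finite_general_position_cards[OF finite_grid]])
  have "general_position Q {}" unfolding general_position_def by auto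
  then show "{card D | D. D \<subseteq> grid n \<and> general_position Q D} \<noteq> {}" by blast
qed (auto intro: general_position_card_le)

definition int_point :: "('d::finite \<Rightarrow> int) \<Rightarrow> real ^ 'd" where
  "int_point x = (\<chi> i. of_int (x i))"

lemma int_point_nth: "int_point x $ i = of_int (x i)"
  by (simp add: int_point_def)

lemma sum_UNIV_option:
  fixes f :: "'e::finite option \<Rightarrow> 'b::comm_monoid_add"
  shows "(\<Sum>k\<in>UNIV. f k) = f None + (\<Sum>i\<in>UNIV. f (Some i))"
  by (simp add: UNIV_option_conv sum.reindex)

context isotropic_curve
begin

lemma normal_eq_0_if_on_hyperplane:
  assumes T: "finite T" "card T > CARD('d)" "inj_on (\<lambda>t. t mod p) T"
    and x: "\<And>t. t \<in> T \<Longrightarrow> on_curve t (x t)"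
    and on_hyperplane: "\<And>t. t \<in> T \<Longrightarrow> a \<bullet> int_point (x t) = b"
  shows "a = 0"
proof -
  define y where "y t = case_option 1 (x t)" for t
  have "case_option (- b) (($) a) (Some i) = 0" for i
  proof (rule real_relation_trivial_if_trivial_mod_prime[OF finite prime, where Y = "y ` T"])
    fix e :: "'d option \<Rightarrow> int" and k
    assume relation: "\<And>w. w \<in> y ` T \<Longrightarrow> p dvd (\<Sum>k\<in>UNIV. e k * w k)"
    have "p dvd e None + (\<Sum>i\<in>UNIV. e (Some i) * x t i)" if "t \<in> T" for t
      using relation[OF imageI[OF that]] by (simp add: sum_UNIV_option y_def)
    from affine_relation_trivial[OF T x this] show "p dvd e k" by (cases k) auto
  next
    fix w assume "w \<in> y ` T"
    then show "(\<Sum>k\<in>UNIV. case_option (- b) (($) a) k * of_int (w k)) = 0"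
      using on_hyperplane by (auto simp: sum_UNIV_option y_def inner_vec_def int_point_nth)
  qed simp
  then show ?thesis by (simp add: vec_eq_iff)
qed

lemma form_coeff_eq_0_if_on_quadric:
  assumes T: "finite T" "card T > CARD('d) + 1" "inj_on (\<lambda>t. t mod p) T" "\<And>t. t \<in> T \<Longrightarrow> regular t"
    and x: "\<And>t. t \<in> T \<Longrightarrow> on_curve t (x t)"
    and on_quadric: "\<And>t. t \<in> T \<Longrightarrow> q * of_int (bilin B (x t) (x t)) + a \<bullet> int_point (x t) + b = 0"
  shows "q = 0"
proof -
  define y where "y t = case_option (bilin B (x t) (x t)) (case_option 1 (x t))" for t
  have "case_option q (case_option b (($) a)) None = 0"
  proof (rule real_relation_trivial_if_trivial_mod_prime[OF finite prime, where Y = "y ` T"])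
    fix e :: "'d option option \<Rightarrow> int" and k
    assume relation: "\<And>w. w \<in> y ` T \<Longrightarrow> p dvd (\<Sum>k\<in>UNIV. e k * w k)"
    have "p dvd e (Some None) + (\<Sum>i\<in>UNIV. e (Some (Some i)) * x t i)
        + e None * bilin B (x t) (x t)" if "t \<in> T" for t
      using relation[OF imageI[OF that]] by (simp add: sum_UNIV_option y_def add_ac)
    from quadratic_relation_trivial[OF T x this]
    have "p dvd e (Some None)" "\<And>i. p dvd e (Some (Some i))" "p dvd e None" by auto
    then show "p dvd e k" by (metis option.exhaust)
  next
    fix w assume "w \<in> y ` T"
    then show "(\<Sum>k\<in>UNIV. case_option q (case_option b (($) a)) k * of_int (w k)) = 0"
      using on_quadric by (auto simp: sum_UNIV_option y_def inner_vec_def int_point_nth add_ac)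
  qed simp
  then show ?thesis by simp
qed

lemma curve_points_not_subset_hyperplane:
  assumes T: "finite T" "card T > CARD('d)" "inj_on (\<lambda>t. t mod p) T"
    and x: "\<And>t. t \<in> T \<Longrightarrow> on_curve t (x t)"
    and "is_hyperplane H"
  shows "\<not> (\<lambda>t. int_point (x t)) ` T \<subseteq> H"
proof
  assume "(\<lambda>t. int_point (x t)) ` T \<subseteq> H"
  moreover obtain a b where equation: "a \<noteq> 0" "H = {x. a \<bullet> x = b}"
    using \<open>is_hyperplane H\<close> unfolding is_hyperplane_def by blast
  ultimately have "a \<bullet> int_point (x t) = b" if "t \<in> T" for t using that by auto
  then have "a = 0" using T x by (intro normal_eq_0_if_on_hyperplane[of T x a b]) auto
  with equation(1) show False by contradiction
qed

lemma curve_points_not_subset_quadric: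
  assumes T: "finite T" "card T > CARD('d) + 1" "inj_on (\<lambda>t. t mod p) T" "\<And>t. t \<in> T \<Longrightarrow> regular t"
    and x: "\<And>t. t \<in> T \<Longrightarrow> on_curve t (x t)"
    and Q: "represents_multiple B Q" and "is_quadric Q C"
  shows "\<not> (\<lambda>t. int_point (x t)) ` T \<subseteq> C"
proof
  assume subset: "(\<lambda>t. int_point (x t)) ` T \<subseteq> C"
  obtain f where f: "total_degree f \<le> 1" "C = {x. eval_mpoly Q x + eval_mpoly f x = 0}"
    using \<open>is_quadric Q C\<close> unfolding is_quadric_def by blast
  define a where "a = (\<chi> i. Poly_Mapping.lookup f (unit_monom i))"
  define b where "b = Poly_Mapping.lookup f 0"
  obtain s where s: "s \<noteq> 0" "\<And>x. s * eval_mpoly Q x = bilin (\<lambda>i j. of_int (B i j)) (($) x) (($) x)"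
    using Q unfolding represents_multiple_def by blast
  have "1 / s * of_int (bilin B (x t) (x t)) + a \<bullet> int_point (x t) + b = 0" if "t \<in> T" for t
  proof -
    have "eval_mpoly Q (int_point (x t)) + (b + a \<bullet> int_point (x t)) = 0"
      using that subset f unfolding a_def b_def by (auto simp: eval_mpoly_affine[symmetric])
    moreover have "s * eval_mpoly Q (int_point (x t)) = of_int (bilin B (x t) (x t))"
      by (simp add: s(2) int_point_nth[abs_def] bilin_of_int)
    then have "1 / s * of_int (bilin B (x t) (x t)) = eval_mpoly Q (int_point (x t))"
      using s(1) by (simp add: field_simps)
    ultimately show ?thesis by simp
  qed
  then have "1 / s = 0"
    using T x by (intro form_coeff_eq_0_if_on_quadric[of T x "1 / s" a b]) auto
  with s(1) show False by simp
qed

lemma curve_points_general_position: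
  assumes T: "finite T" "inj_on (\<lambda>t. t mod p) T" "\<And>t. t \<in> T \<Longrightarrow> regular t"
    and x: "\<And>t. t \<in> T \<Longrightarrow> on_curve t (x t)"
    and Q: "represents_multiple B Q"
  shows "general_position Q ((\<lambda>t. int_point (x t)) ` T)"
proof -
  have preimage: "\<exists>U. finite U \<and> card U = card S \<and> inj_on (\<lambda>t. t mod p) U \<and> U \<subseteq> T
      \<and> S = (\<lambda>t. int_point (x t)) ` U" if image: "S \<subseteq> (\<lambda>t. int_point (x t)) ` T" for S
  proof -
    obtain U where U: "U \<subseteq> T" "inj_on (\<lambda>t. int_point (x t)) U" "S = (\<lambda>t. int_point (x t)) ` U"
      using image unfolding subset_image_inj by blast
    then show ?thesis
      using finite_subset[OF U(1) T(1)] inj_on_subset[OF T(2) U(1)]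
      by (intro exI[of _ U]) (simp add: card_image)
  qed
  show ?thesis
    unfolding general_position_def
  proof (intro conjI allI impI notI; elim exE conjE)
    fix S H
    assume S: "S \<subseteq> (\<lambda>t. int_point (x t)) ` T" "card S = CARD('d) + 1" "is_hyperplane H" "S \<subseteq> H"
    obtain U where U: "finite U" "card U = card S" "inj_on (\<lambda>t. t mod p) U" "U \<subseteq> T"
        "S = (\<lambda>t. int_point (x t)) ` U"
      using preimage[OF S(1)] by metis
    then have "card U > CARD('d)" using S(2) by simp
    then have "\<not> (\<lambda>t. int_point (x t)) ` U \<subseteq> H"
      using U x by (intro curve_points_not_subset_hyperplane[OF _ _ _ _ S(3)]) auto
    then show False using U(5) S(4) by simp
  next
    fix S C
    assume S: "S \<subseteq> (\<lambda>t. int_point (x t)) ` T" "card S = CARD('d) + 2" "is_quadric Q C" "S \<subseteq> C"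
    obtain U where U: "finite U" "card U = card S" "inj_on (\<lambda>t. t mod p) U" "U \<subseteq> T"
        "S = (\<lambda>t. int_point (x t)) ` U"
      using preimage[OF S(1)] by metis
    then have "card U > CARD('d) + 1" using S(2) by simp
    then have "\<not> (\<lambda>t. int_point (x t)) ` U \<subseteq> C"
      using U x T(3) by (intro curve_points_not_subset_quadric[OF _ _ _ _ _ Q S(3)]) auto
    then show False using U(5) S(4) by simp
  qed
qed

theorem general_position_subset_grid:
  assumes T: "finite T" "inj_on (\<lambda>t. t mod p) T" "\<And>t. t \<in> T \<Longrightarrow> regular t"
    and Q: "represents_multiple B Q"
  obtains D where "D \<subseteq> grid (nat p)" "general_position Q D" "card D = card T"
proof -
  have "\<forall>t\<in>T. \<exists>x. on_curve t x \<and> (\<forall>i. 1 \<le> x i \<and> x i \<le> p)" using exists_on_curve T(3) by metis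
  then obtain x where x: "\<And>t. t \<in> T \<Longrightarrow> on_curve t (x t)" "\<And>t i. t \<in> T \<Longrightarrow> 1 \<le> x t i \<and> x t i \<le> p"
    by metis
  have "inj_on (\<lambda>t. int_point (x t)) T"
  proof (rule inj_onI)
    fix s t assume "s \<in> T" "t \<in> T" "int_point (x s) = int_point (x t)"
    then have "x s = x t" by (simp add: int_point_def vec_eq_iff fun_eq_iff)
    then have "s mod p = t mod p"
      using on_curve_inj[of s t "x s"] x(1) T(3) \<open>s \<in> T\<close> \<open>t \<in> T\<close> by metis
    then show "s = t" using T(2) \<open>s \<in> T\<close> \<open>t \<in> T\<close> by (auto dest: inj_onD)
  qed
  moreover have "int_point (x t) \<in> grid (nat p)" if "t \<in> T" for t
  proof -
    have "of_int (x t i) \<in> real ` {1..nat p}" for i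
      using x(2)[OF that, of i] by (intro image_eqI[of _ _ "nat (x t i)"]) auto
    then show ?thesis by (simp add: grid_def int_point_nth)
  qed
  ultimately show ?thesis
    using curve_points_general_position[OF T x(1) Q] by (intro that) (auto simp: card_image)
qed

end

lemma isotropic_curve_if_QuadRes_upto:
  fixes B :: "'d::finite \<Rightarrow> 'd \<Rightarrow> int"
  assumes sym: "\<And>i j. B i j = B j i" and "B i j \<noteq> 0"
  obtains N :: nat and j\<^sub>0 where "CARD('d) \<le> N"
    "\<And>p \<alpha>. prime p \<Longrightarrow> int N < p \<Longrightarrow> QuadRes_upto N p \<Longrightarrow> (\<And>k l. k \<noteq> l \<Longrightarrow> \<not> p dvd (\<alpha> k - \<alpha> l))
       \<Longrightarrow> \<exists>v. isotropic_curve p B v \<alpha> j\<^sub>0"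
proof -
  obtain u j\<^sub>0 where u: "u j\<^sub>0 = 1" "bilin B u u \<noteq> 0"
    using exists_anisotropic_int_vector[of B, OF assms] .
  define \<Delta> where "\<Delta> k = (\<Sum>i\<in>UNIV. B i k * u i)\<^sup>2 - bilin B u u * B k k" for k
  define F where "F = (\<lambda>a. nat \<bar>a\<bar>) ` ({bilin B u u, int CARD('d)} \<union> range \<Delta>)"
  have "finite F" by (simp add: F_def)
  then obtain N where "\<And>m. m \<in> F \<Longrightarrow> m \<le> N" unfolding finite_nat_set_iff_bounded_le by blast
  then have "nat \<bar>a\<bar> \<le> N" if "a \<in> {bilin B u u, int CARD('d)} \<union> range \<Delta>" for a
    using that unfolding F_def by blast
  from this[of "bilin B u u"] this[of "int CARD('d)"] this[of "\<Delta> _"]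
  have N: "\<bar>bilin B u u\<bar> \<le> int N" "CARD('d) \<le> N" "\<bar>\<Delta> k\<bar> \<le> int N" for k
    by (simp_all add: nat_le_iff)
  show ?thesis
  proof (rule that[OF N(2)])
    fix p :: int and \<alpha> :: "'d \<Rightarrow> int"
    assume p: "prime p" "int N < p" "QuadRes_upto N p"
      and poles: "\<And>k l. k \<noteq> l \<Longrightarrow> \<not> p dvd (\<alpha> k - \<alpha> l)"
    have "\<not> p dvd bilin B u u" using dvd_imp_le_int[OF u(2), of p] N(1) p(2) by auto
    moreover have "QuadRes p ((\<Sum>i\<in>UNIV. B i k * u i)\<^sup>2 - bilin B u u * B k k)" for k
      using p(3) N(3)[of k] by (simp add: QuadRes_upto_def \<Delta>_def)
    ultimately show "\<exists>v. isotropic_curve p B v \<alpha> j\<^sub>0"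
      using isotropic_curve_exists[of p B u j\<^sub>0 \<alpha>, OF p(1) sym u(1) _ _ poles] by metis
  qed
qed

theorem max_general_position_grid_ge:
  fixes Q :: "('d::finite, real) mpoly"
  assumes "quadratic_form Q" "Q \<noteq> 0" "\<forall>m. Poly_Mapping.lookup Q m \<in> \<rat>"
  obtains N where "\<And>p n. prime p \<Longrightarrow> N < p \<Longrightarrow> QuadRes_upto N (int p) \<Longrightarrow> p \<le> n
     \<Longrightarrow> p - CARD('d) \<le> max_general_position Q (grid n)"
proof -
  obtain B i j where B: "represents_multiple B Q" "\<And>i j. B i j = B j i" "B i j \<noteq> 0"
    using quadratic_form_int_matrix[OF assms] by metis
  obtain N j\<^sub>0 where N: "CARD('d) \<le> N" "\<And>p \<alpha>. prime p \<Longrightarrow> int N < p \<Longrightarrow> QuadRes_upto N p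
      \<Longrightarrow> (\<And>k l. k \<noteq> l \<Longrightarrow> \<not> p dvd (\<alpha> k - \<alpha> l)) \<Longrightarrow> \<exists>v. isotropic_curve p B v \<alpha> j\<^sub>0"
    using isotropic_curve_if_QuadRes_upto[of B, OF B(2,3)] by metis
  obtain \<beta> :: "'d \<Rightarrow> nat" where "bij_betw \<beta> UNIV {0..<CARD('d)}"
    using ex_bij_betw_finite_nat[of "UNIV :: 'd set"] by auto
  then have \<beta>: "\<beta> k < CARD('d)" "k \<noteq> l \<Longrightarrow> \<beta> k \<noteq> \<beta> l" for k l
    by (auto simp: bij_betw_def inj_on_def)
  show ?thesis
  proof (rule that[of N])
    fix p n :: nat
    assume p: "prime p" "N < p" "QuadRes_upto N (int p)" and "p \<le> n"
    have not_dvd: "\<not> int p dvd a" if "a \<noteq> 0" "\<bar>a\<bar> < int p" for a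
      using that dvd_imp_le_int[of a "int p"] by auto
    have "\<not> int p dvd (int (\<beta> k) - int (\<beta> l))" if "k \<noteq> l" for k l
      using \<beta>(1)[of k] \<beta>(1)[of l] \<beta>(2)[OF that] N(1) p(2) by (intro not_dvd) auto
    then obtain v where "isotropic_curve (int p) B v (\<lambda>k. int (\<beta> k)) j\<^sub>0"
      using N(2)[of "int p" "\<lambda>k. int (\<beta> k)"] p by auto
    then interpret isotropic_curve "int p" B v "\<lambda>k. int (\<beta> k)" j\<^sub>0 .
    define T where "T = {int CARD('d)..<int p}"
    have regular: "regular t" if "t \<in> T" for t
      unfolding regular_def
    proof
      show "\<not> int p dvd (t - int (\<beta> k))" for k
        using that \<beta>(1)[of k] by (intro not_dvd) (auto simp: T_def)
    qed
    have "finite T" "inj_on (\<lambda>t. t mod int p) T" by (auto simp: inj_on_def T_def)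
    then obtain D where D: "D \<subseteq> grid (nat (int p))" "general_position Q D" "card D = card T"
      by (rule general_position_subset_grid[OF _ _ regular B(1)])
    have "D \<subseteq> grid n" using subset_trans[OF D(1) grid_mono[of "nat (int p)" n]] \<open>p \<le> n\<close> by simp
    then have "card D \<le> max_general_position Q (grid n)"
      using finite_grid D(2) by (intro max_general_position_ge)
    then show "p - CARD('d) \<le> max_general_position Q (grid n)" by (simp add: D(3) T_def)
  qed
qed

lemma eventually_short_interval_if_log_window:
  assumes "\<And>\<eta>. \<eta> > 0 \<Longrightarrow> eventually (\<lambda>x. \<exists>p. P p \<and> \<bar>ln (real p) - x\<bar> \<le> \<eta>) at_top"
    and "\<And>p. P p \<Longrightarrow> p > 0" and "\<epsilon> > 0"
  shows "eventually (\<lambda>n. \<exists>p. P p \<and> p \<le> n \<and> (1 - \<epsilon>) * real n \<le> real p) sequentially"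
proof -
  define \<eta> where "\<eta> = \<epsilon> / 2"
  have "\<eta> > 0" using \<open>\<epsilon> > 0\<close> by (simp add: \<eta>_def)
  have "filterlim (\<lambda>n. ln (real n) - \<eta>) at_top sequentially" by real_asymp
  then have "eventually (\<lambda>n. \<exists>p. P p \<and> \<bar>ln (real p) - (ln (real n) - \<eta>)\<bar> \<le> \<eta>) sequentially"
    by (rule eventually_compose_filterlim[OF assms(1)[OF \<open>\<eta> > 0\<close>]])
  then show ?thesis
    using eventually_gt_at_top[of 0]
  proof eventually_elim
    case (elim n)
    then obtain p where p: "P p" "\<bar>ln (real p) - (ln (real n) - \<eta>)\<bar> \<le> \<eta>" by blast
    have pos: "real p > 0" "real n > 0" using assms(2)[OF p(1)] elim(2) by simp_all
    have "ln (real p) \<le> ln (real n)" using p(2) by linarith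
    then have "p \<le> n" using pos by simp
    have "ln (real n) + (- \<epsilon>) \<le> ln (real p)" using p(2) unfolding \<eta>_def by linarith
    then have "exp (ln (real n) + (- \<epsilon>)) \<le> exp (ln (real p))" by (simp only: exp_le_cancel_iff)
    then have "real n * exp (- \<epsilon>) \<le> real p" using pos by (simp only: exp_add exp_ln)
    moreover have "real n * (1 + (- \<epsilon>)) \<le> real n * exp (- \<epsilon>)"
      by (intro mult_left_mono exp_ge_add_one_self) simp
    ultimately have "(1 - \<epsilon>) * real n \<le> real p" by (simp add: mult.commute)
    then show ?case using p(1) \<open>p \<le> n\<close> by blast
  qed
qed

theorem eventually_max_general_position_grid_ge:
  fixes Q :: "('d::finite, real) mpoly"
  assumes Q: "quadratic_form Q" "Q \<noteq> 0" "\<forall>m. Poly_Mapping.lookup Q m \<in> \<rat>" and "\<epsilon> > 0"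
  shows "eventually (\<lambda>n. real n - real (max_general_position Q (grid n)) \<le> \<epsilon> * real n) sequentially"
proof -
  obtain N where N: "\<And>p n. prime p \<Longrightarrow> N < p \<Longrightarrow> QuadRes_upto N (int p) \<Longrightarrow> p \<le> n
      \<Longrightarrow> p - CARD('d) \<le> max_general_position Q (grid n)"
    using max_general_position_grid_ge[OF Q] by blast
  define \<delta> where "\<delta> = min (1 / 2) (\<epsilon> / 2)"
  have \<delta>: "0 < \<delta>" "\<delta> \<le> 1 / 2" "\<delta> \<le> \<epsilon> / 2" using \<open>\<epsilon> > 0\<close> by (auto simp: \<delta>_def)
  have "eventually (\<lambda>n. \<exists>p. (prime p \<and> QuadRes_upto N (int p)) \<and> p \<le> n
      \<and> (1 - \<delta>) * real n \<le> real p) sequentially"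
    by (rule eventually_short_interval_if_log_window[OF primes_QuadRes_upto_in_log_window])
       (use \<delta>(1) in \<open>auto simp: prime_gt_0_nat\<close>)
  moreover have "eventually (\<lambda>n. real N < 1 / 2 * real n) sequentially" by real_asymp
  moreover have "eventually (\<lambda>n. real CARD('d) \<le> \<epsilon> / 2 * real n) sequentially"
    using \<open>\<epsilon> > 0\<close> by real_asymp
  ultimately show ?thesis
  proof eventually_elim
    case (elim n)
    then obtain p where p: "prime p" "QuadRes_upto N (int p)" "p \<le> n" "(1 - \<delta>) * real n \<le> real p"
      by blast
    have "1 / 2 * real n \<le> (1 - \<delta>) * real n" "\<delta> * real n \<le> \<epsilon> / 2 * real n"
      by (rule mult_right_mono; use \<delta> in simp)+
    then have p_large: "real N < real p" "real n - \<epsilon> / 2 * real n \<le> real p"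
      using elim(2) p(4) unfolding left_diff_distrib by linarith+
    then have "N < p" by simp
    then have "real p - real CARD('d) \<le> real (max_general_position Q (grid n))"
      using N[OF p(1) _ p(2,3)] by linarith
    then show ?case using elim(3) p_large(2) by linarith
  qed
qed

theorem theorem1p4:
  fixes Q :: "('d::finite, real) mpoly"
  assumes "CARD('d) \<ge> 2"
    and "quadratic_form Q"
    and "\<forall>m. Poly_Mapping.lookup Q m \<in> \<rat>"
    and "Q \<noteq> 0"
  shows "(\<exists>e :: nat \<Rightarrow> real. e \<in> o(\<lambda>n. real n) \<and>
            (\<forall>n. real n - e n \<le> real (max_general_position Q (grid n)))) \<and>
         (\<forall>n. max_general_position Q (grid n) \<le> CARD('d) * n)"
proof (intro conjI exI allI)
  define e where "e n = max 0 (real n - real (max_general_position Q (grid n)))" for n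
  show "e \<in> o(\<lambda>n. real n)"
  proof (rule landau_o.smallI)
    fix \<epsilon> :: real assume "\<epsilon> > 0"
    show "eventually (\<lambda>n. norm (e n) \<le> \<epsilon> * norm (real n)) sequentially"
      using eventually_max_general_position_grid_ge[OF assms(2,4,3) \<open>\<epsilon> > 0\<close>]
      by eventually_elim (use \<open>\<epsilon> > 0\<close> in \<open>auto simp: e_def\<close>)
  qed
  show "real n - e n \<le> real (max_general_position Q (grid n))" for n by (simp add: e_def)
  show "max_general_position Q (grid n) \<le> CARD('d) * n" for n by (rule max_general_position_grid_le)
qed

end
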